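(* Let $X$ denote a strictly convex $C^{(3)}$ curve in the plane $\mathbb{R}^2$. Then the following are equivalent. 1) For all $P\in X$ and sufficiently small $h>0$, $S_P(h)=\lambda(P)V_P(h)$, where $\lambda(P)$ is a function of $P$. 2) For all $P\in X$ and sufficiently small $h>0$, $S_P(h)=\frac{2}{3}V_P(h)$. 3) $X$ is an open part of a parabola.
   Context: All curves are of class $C^{(3)}$ and connected. A regular plane curve $X:I\to\mathbb{R}^2$ on an open interval $I$ is convex if for all $t\in I$ the trace $X(I)$ lies entirely in one of the closed half-planes determined by the tangent line at $X(t)$. A simple convex curve $X$ in $\mathbb{R}^2$ is called strictly convex if it is of class $C^{(3)}$ and has positive curvature $\kappa$ with respect to the unit normal $N$ pointing to the convex side, i.e. $\kappa(s)=\langle X''(s),N(X(s))\rangle>0$ for an arclength parametrization $X(s)$. For $P\in X$ and sufficiently small $h>0$, let $\ell$ be the tangent line of $X$ at $P$, let $m$ be the line through $P+hN(P)$ parallel to $\ell$, and let $A_1,A_2$ be the points where $m$ intersects $X$. Let $\ell_1,\ell_2$ be the tangent lines of $X$ at $A_1,A_2$, and let $B=\ell_1\cap\ell_2$. $S_P(h)$ is the area of the region bounded by $X$ and the chord $A_1A_2$. $V_P(h)$ is the area of the triangle $BA_1A_2$. "For all $P\in X$ and sufficiently small $h>0$" means: for every $P\in X$ there is $h_0(P)>0$ such that the property holds for all $0<h<h_0(P)$. An open part of a parabola is a connected (relatively) open arc of a parabola, of arbitrary position in the plane. *)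

theory Defs
  imports "HOL-Analysis.Analysis"
begin

abbreviation velocity :: "(real \<Rightarrow> real^2) \<Rightarrow> real \<Rightarrow> real^2" where
  "velocity X t \<equiv> vector_derivative X (at t)"

text \<open>Meaningful for open \<open>I\<close> only, where the one-sided and two-sided derivatives need not be
  distinguished.\<close>

definition Ck_on :: "nat \<Rightarrow> (real \<Rightarrow> real^2) \<Rightarrow> real set \<Rightarrow> bool" where
  "Ck_on k X I \<longleftrightarrow>
     (\<forall>j<k. (velocity ^^ j) X differentiable_on I) \<and> continuous_on I ((velocity ^^ k) X)"

definition regular_curve :: "(real \<Rightarrow> real^2) \<Rightarrow> real set \<Rightarrow> bool" where
  "regular_curve X I \<longleftrightarrow>
     open I \<and> is_interval I \<and> I \<noteq> {} \<and> Ck_on 3 X I \<and> (\<forall>t\<in>I. velocity X t \<noteq> 0)"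

definition tangent_line :: "(real \<Rightarrow> real^2) \<Rightarrow> real \<Rightarrow> (real^2) set" where
  "tangent_line X t = {X t + c *\<^sub>R velocity X t | c. True}"

text \<open>\<open>n\<close> is a unit normal at \<open>X t\<close> and the whole trace lies in the closed half-plane bounded by
  the tangent line at \<open>X t\<close> into which \<open>n\<close> points.\<close>

definition convex_side_normal :: "(real \<Rightarrow> real^2) \<Rightarrow> real set \<Rightarrow> real \<Rightarrow> real^2 \<Rightarrow> bool" where
  "convex_side_normal X I t n \<longleftrightarrow>
     norm n = 1 \<and> n \<bullet> velocity X t = 0 \<and> (\<forall>s\<in>I. (X s - X t) \<bullet> n \<ge> 0)"

definition convex_curve :: "(real \<Rightarrow> real^2) \<Rightarrow> real set \<Rightarrow> bool" where
  "convex_curve X I \<longleftrightarrow> regular_curve X I \<and> (\<forall>t\<in>I. \<exists>n. convex_side_normal X I t n)"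

text \<open>The choice is only ambiguous when the trace lies on a line, and then the curvature
  vanishes.\<close>

definition unit_normal :: "(real \<Rightarrow> real^2) \<Rightarrow> real set \<Rightarrow> real \<Rightarrow> real^2" where
  "unit_normal X I t = (SOME n. convex_side_normal X I t n)"

text \<open>The derivative of \<open>f\<close> with respect to the arclength \<open>s\<close> of \<open>X\<close>, that is
  \<open>df/ds = (df/dt) / (ds/dt)\<close> with \<open>ds/dt = norm (velocity X t)\<close>.\<close>

definition arclength_deriv :: "(real \<Rightarrow> real^2) \<Rightarrow> (real \<Rightarrow> real^2) \<Rightarrow> real \<Rightarrow> real^2" where
  "arclength_deriv X f t = vector_derivative f (at t) /\<^sub>R norm (velocity X t)"

definition curvature :: "(real \<Rightarrow> real^2) \<Rightarrow> real set \<Rightarrow> real \<Rightarrow> real" where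
  "curvature X I t = arclength_deriv X (arclength_deriv X X) t \<bullet> unit_normal X I t"

definition strictly_convex_curve :: "(real \<Rightarrow> real^2) \<Rightarrow> real set \<Rightarrow> bool" where
  "strictly_convex_curve X I \<longleftrightarrow>
     convex_curve X I \<and> inj_on X I \<and> (\<forall>t\<in>I. curvature X I t > 0)"

definition parallel_line :: "(real \<Rightarrow> real^2) \<Rightarrow> real set \<Rightarrow> real \<Rightarrow> real \<Rightarrow> (real^2) set" where
  "parallel_line X I t h = {X t + h *\<^sub>R unit_normal X I t + c *\<^sub>R velocity X t | c. True}"

text \<open>The parameters \<open>a < b\<close> of the two points \<open>A\<^sub>1 = X a\<close> and \<open>A\<^sub>2 = X b\<close> in which the parallel
  line meets the curve.  On a strictly convex curve they exist and are unique for all sufficiently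
  small \<open>h > 0\<close>, depending on \<open>t\<close>; they then satisfy \<open>a < t < b\<close>.\<close>

definition chord_params :: "(real \<Rightarrow> real^2) \<Rightarrow> real set \<Rightarrow> real \<Rightarrow> real \<Rightarrow> real \<times> real" where
  "chord_params X I t h =
     (THE (a, b). a \<in> I \<and> b \<in> I \<and> a < b \<and> X ` I \<inter> parallel_line X I t h = {X a, X b})"

text \<open>\<open>inside S\<close> is the union of the bounded components of the complement of \<open>S\<close>.\<close>

definition S_area :: "(real \<Rightarrow> real^2) \<Rightarrow> real set \<Rightarrow> real \<Rightarrow> real \<Rightarrow> real" where
  "S_area X I t h =
     (let (a, b) = chord_params X I t h
      in measure lebesgue (inside (X ` {a..b} \<union> closed_segment (X a) (X b))))"

definition V_area :: "(real \<Rightarrow> real^2) \<Rightarrow> real set \<Rightarrow> real \<Rightarrow> real \<Rightarrow> real" where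
  "V_area X I t h =
     (let (a, b) = chord_params X I t h;
          B = (THE B. tangent_line X a \<inter> tangent_line X b = {B})
      in measure lebesgue (convex hull {B, X a, X b}))"

text \<open>A parabola given by its focus \<open>F\<close> and its directrix \<open>L\<close>.\<close>

definition parabola :: "(real^2) set \<Rightarrow> bool" where
  "parabola \<Gamma> \<longleftrightarrow>
     (\<exists>F q v L. v \<noteq> 0 \<and> L = {q + c *\<^sub>R v | c. True} \<and> F \<notin> L \<and>
        \<Gamma> = {x. dist x F = infdist x L})"

definition open_part_of_parabola :: "(real^2) set \<Rightarrow> bool" where
  "open_part_of_parabola A \<longleftrightarrow>
     (\<exists>\<Gamma>. parabola \<Gamma> \<and> A \<noteq> {} \<and> connected A \<and> openin (top_of_set \<Gamma>) A)"

end

theory Submission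
  imports Defs
begin

text \<open>
  At a point \<open>P = X t\<close> let \<open>L(h)\<close> be the length of the chord cut off at height \<open>h\<close> above the
  tangent line.  Slicing the cap parallel to the chord gives \<open>S' = L\<close>
  (\<open>measure_cap_tendsto_0_and_DERIV\<close>), and an elementary computation of the apex of the triangle
  gives \<open>V = L\<^sup>2 / (2 L')\<close> (\<open>tangent_triangle_area\<close>).  All of this is collected in \<open>cap_data\<close>,
  together with \<open>L'(h) sqrt h \<longlonglongrightarrow> sqrt (2 / \<kappa>)\<close> as \<open>h \<rightarrow> 0+\<close>, where \<open>\<kappa>\<close> is the curvature at \<open>P\<close>.

  The asymptotics of \<open>L'\<close> imply \<open>S / V \<longlonglongrightarrow> 2 / 3\<close> on every strictly convex curve, so that a factor
  \<open>\<lambda>(P)\<close> that does not depend on \<open>h\<close> must be \<open>2 / 3\<close> (\<open>proportional_imp_law\<close>).  The law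
  \<open>S = (2 / 3) V\<close> is then the differential equation \<open>3 S S'' = (S')\<^sup>2\<close>, and its solutions with the
  right asymptotics satisfy \<open>L\<^sup>2 = 8 h / \<kappa>\<close> (\<open>square_chord_linear\<close>).  Conversely, \<open>L\<^sup>2 = c h\<close> implies
  the law (\<open>archimedes_ratio\<close>), and on a parabola \<open>L\<^sup>2\<close> is visibly proportional to \<open>h\<close>
  (\<open>parabola_imp_law\<close>).

  It remains to recover the parabola from \<open>L\<^sup>2 = 8 h / \<kappa>\<close> at all points.  The range of admissible
  \<open>h\<close> depends on the point without any uniformity, and a curve of class \<open>C\<^sup>3\<close> need not have
  an affine curvature, so the argument is a comparison principle.  Write the curve locally as
  a graph \<open>y = g(x)\<close> and put \<open>q = (g'')\<^bsup>-2/3\<^esup>\<close>.  A conic has for \<open>q\<close> a quadratic polynomial, and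
  its chords satisfy \<open>L\<^sup>2 = 8 h / \<kappa> + c h\<^sup>2\<close>, where \<open>c\<close> has the sign of the leading coefficient of
  that polynomial.  If \<open>q\<close> were touched from above at some point by a strictly concave quadratic
  polynomial, then \<open>g\<close> would lie above the corresponding conic, its chords would be at most as long
  as those of the conic, and \<open>L\<^sup>2 < 8 h / \<kappa>\<close> would follow; touching from below by a strictly convex
  one is excluded in the same way (\<open>no_conic_touching\<close>).  Hence \<open>q\<close> is an affine function
  of \<open>x\<close> in every chart (\<open>chart_q_affine\<close>).  In terms of the affine arc length \<open>\<sigma>\<close>, the
  derivative of \<open>q\<close> with respect to \<open>x\<close> is twice a component of the affine normal \<open>X\<^sub>\<sigma>\<^sub>\<sigma>\<close>, with a different
  component for each chart; so the affine normal is constant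
  (\<open>affine_normal_constant\<close>) and \<open>X\<close> is quadratic in \<open>\<sigma>\<close> (\<open>law_imp_parabola\<close>).
\<close>

section \<open>Orthonormal frames and areas of caps\<close>

text \<open>An orthonormal basis of the plane, of either orientation.\<close>

definition orthoframe :: "real^2 \<Rightarrow> real^2 \<Rightarrow> bool" where
  "orthoframe T N \<longleftrightarrow> T \<bullet> T = 1 \<and> N \<bullet> N = 1 \<and> T \<bullet> N = 0"

lemma inner2: "(u::real^2) \<bullet> v = u$1 * v$1 + u$2 * v$2"
  by (simp add: inner_vec_def UNIV_2)

lemma orthoframe_expand:
  assumes "orthoframe T N"
  shows "p = (p \<bullet> T) *\<^sub>R T + (p \<bullet> N) *\<^sub>R N"
proof -
  have a: "T$1*T$1+T$2*T$2 = 1" "N$1*N$1+N$2*N$2 = 1" "T$1*N$1+T$2*N$2 = 0"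
    using assms by (auto simp: orthoframe_def inner2)
  have d: "(T$1*N$2-T$2*N$1)^2 = 1"
    using a by algebra
  have "p$1 = (p$1*T$1+p$2*T$2)*T$1 + (p$1*N$1+p$2*N$2)*N$1"
    using a d by algebra
  moreover have "p$2 = (p$1*T$1+p$2*T$2)*T$2 + (p$1*N$1+p$2*N$2)*N$2"
    using a d by algebra
  ultimately show ?thesis by (simp add: vec_eq_iff forall_2 inner2)
qed

lemma orthoframe_eqI:
  assumes "orthoframe T N" "p \<bullet> T = q \<bullet> T" "p \<bullet> N = q \<bullet> N"
  shows "p = q"
  using orthoframe_expand[OF assms(1), of p] orthoframe_expand[OF assms(1), of q] assms by simp

lemma orthoframe_inner:
  assumes "orthoframe T N"
  shows "T \<bullet> T = 1" "N \<bullet> N = 1" "T \<bullet> N = 0" "N \<bullet> T = 0"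
  using assms by (auto simp: orthoframe_def inner_commute)

lemma
  assumes fr: "orthoframe T N" and "l \<le> r" "lo \<le> hi"
  shows rect_lmeasurable:
      "{p. l < (p-Q) \<bullet> T \<and> (p-Q) \<bullet> T < r \<and> lo < (p-Q) \<bullet> N \<and> (p-Q) \<bullet> N < hi} \<in> lmeasurable"
      (is "?B \<in> _")
    and measure_rect: "measure lebesgue {p. l < (p-Q) \<bullet> T \<and> (p-Q) \<bullet> T < r \<and> lo < (p-Q) \<bullet> N \<and> (p-Q) \<bullet> N < hi} = (r-l)*(hi-lo)"
    and crect_compact: "compact {p. l \<le> (p-Q) \<bullet> T \<and> (p-Q) \<bullet> T \<le> r \<and> lo \<le> (p-Q) \<bullet> N \<and> (p-Q) \<bullet> N \<le> hi}"
      (is "compact ?C")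
    and measure_crect: "measure lebesgue {p. l \<le> (p-Q) \<bullet> T \<and> (p-Q) \<bullet> T \<le> r \<and> lo \<le> (p-Q) \<bullet> N \<and> (p-Q) \<bullet> N \<le> hi} = (r-l)*(hi-lo)"
proof -
  define f where "f = (\<lambda>z::real^2. (z$1) *\<^sub>R T + (z$2) *\<^sub>R N)"
  have "linear f"
    unfolding f_def by (auto intro!: linearI simp: algebra_simps)
  moreover have "f v \<bullet> f w = v$1 * w$1 + v$2 * w$2" for v w
    by (simp add: f_def inner_add_left inner_add_right orthoframe_inner[OF fr])
  ultimately have ort: "orthogonal_transformation f"
    by (simp add: orthogonal_transformation_def inner2)
  define u where "u = (vector [l, lo] :: real^2)"
  define v where "v = (vector [r, hi] :: real^2)"
  have key: "f z \<bullet> T = z$1" "f z \<bullet> N = z$2" for z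
    by (simp_all add: f_def inner_add_left orthoframe_inner[OF fr])
  have ex: "\<exists>z. p = Q + f z \<and> z$1 = (p-Q) \<bullet> T \<and> z$2 = (p-Q) \<bullet> N" for p
    by (rule exI[of _ "vector [(p-Q) \<bullet> T, (p-Q) \<bullet> N]"])
      (use orthoframe_expand[OF fr, of "p-Q"] in \<open>simp add: f_def algebra_simps\<close>)
  have B: "?B = (\<lambda>x. Q + x) ` (f ` box u v)"
  proof safe
    fix p assume "l < (p-Q) \<bullet> T" "(p-Q) \<bullet> T < r" "lo < (p-Q) \<bullet> N" "(p-Q) \<bullet> N < hi"
    then show "p \<in> (\<lambda>x. Q + x) ` (f ` box u v)"
      using ex[of p] by (auto simp: u_def v_def mem_box_cart forall_2)
  qed (auto simp: u_def v_def mem_box_cart forall_2 key)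
  have C: "?C = (\<lambda>x. Q + x) ` (f ` cbox u v)"
  proof safe
    fix p assume "l \<le> (p-Q) \<bullet> T" "(p-Q) \<bullet> T \<le> r" "lo \<le> (p-Q) \<bullet> N" "(p-Q) \<bullet> N \<le> hi"
    then show "p \<in> (\<lambda>x. Q + x) ` (f ` cbox u v)"
      using ex[of p] by (auto simp: u_def v_def mem_box_cart forall_2)
  qed (auto simp: u_def v_def mem_box_cart forall_2 key)
  have ct: "measure lebesgue (cbox u v) = (r-l)*(hi-lo)"
  proof -
    have "cbox u v \<noteq> {}"
      using assms(2,3) by (simp add: interval_ne_empty_cart forall_2 u_def v_def)
    then have "measure lborel (cbox u v) = (r-l)*(hi-lo)"
      by (simp add: content_cbox_cart u_def v_def UNIV_2)
    then show ?thesis by simp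
  qed
  have bt: "measure lebesgue (box u v) = (r-l)*(hi-lo)"
    using ct by (simp add: measure_lborel_box_eq measure_lborel_cbox_eq)
  show "?B \<in> lmeasurable"
    unfolding B by (intro measurable_translation measurable_orthogonal_image[OF ort]) auto
  show "measure lebesgue ?B = (r-l)*(hi-lo)"
    unfolding B measure_translation by (subst measure_orthogonal_image[OF ort]) (auto simp: bt)
  show "measure lebesgue ?C = (r-l)*(hi-lo)"
    unfolding C measure_translation by (subst measure_orthogonal_image[OF ort]) (auto simp: ct)
  show "compact ?C"
    unfolding C
    by (intro compact_translation compact_continuous_image linear_continuous_on)
      (use orthogonal_transformation_linear[OF ort] in \<open>auto simp: linear_conv_bounded_linear\<close>)
qed

text \<open>A point from which a whole ray avoids \<open>K\<close> lies in an unbounded component of the complement.\<close>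

lemma ray_notin_inside:
  fixes p d :: "'a::real_normed_vector"
  assumes "d \<noteq> 0" "\<And>c. c \<ge> 0 \<Longrightarrow> p + c *\<^sub>R d \<notin> K"
  shows "p \<notin> inside K"
proof
  assume "p \<in> inside K"
  then have b: "bounded (connected_component_set (- K) p)"
    by (simp add: inside_def)
  define R where "R = (\<lambda>c. p + c *\<^sub>R d) ` {0..}"
  have "connected R" unfolding R_def
    by (intro connected_continuous_image continuous_intros) auto
  moreover have "p \<in> R" unfolding R_def by (rule image_eqI[of _ _ 0]) auto
  moreover have "R \<subseteq> -K" using assms by (auto simp: R_def)
  ultimately have "R \<subseteq> connected_component_set (- K) p"
    by (intro connected_component_maximal)
  then have "bounded R" using b bounded_subset by blast
  then obtain B where B: "\<And>x. x \<in> R \<Longrightarrow> norm x \<le> B" by (auto simp: bounded_iff)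
  define c where "c = (\<bar>B\<bar> + norm p + 1) / norm d"
  have c: "c \<ge> 0" by (simp add: c_def)
  then have "norm (p + c *\<^sub>R d) \<le> B" by (intro B) (auto simp: R_def)
  moreover have "norm (c *\<^sub>R d) = \<bar>B\<bar> + norm p + 1"
    using c assms by (simp add: c_def)
  moreover have "norm (c *\<^sub>R d) \<le> norm (p + c *\<^sub>R d) + norm p"
    by (metis add_diff_cancel_left' norm_triangle_ineq4)
  ultimately show False by linarith
qed

lemma component_in_open_region:
  assumes "open R" "closed (R \<union> K)" "R \<inter> K = {}" "bounded R"
  shows "R \<subseteq> inside K"
proof
  fix p assume p: "p \<in> R"
  let ?C = "connected_component_set (- K) p"
  have "?C \<subseteq> R"
  proof (rule ccontr)
    assume "\<not> ?C \<subseteq> R"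
    then have n: "- (R \<union> K) \<inter> ?C \<noteq> {}"
      using connected_component_subset[of "-K" p] by auto
    have "p \<in> ?C" using p assms by (simp add: connected_component_refl_eq) blast
    then have "R \<inter> ?C \<noteq> {}" using p by auto
    moreover have "open (- (R \<union> K))" using assms(2) by (simp only: open_Compl)
    moreover have "?C \<subseteq> R \<union> - (R \<union> K)"
      using connected_component_subset[of "-K" p] by auto
    ultimately show False
      using connectedD[OF connected_connected_component, of R "-(R\<union>K)" "-K" p] assms(1) n by auto
  qed
  then have "bounded ?C" using assms(4) bounded_subset by blast
  then show "p \<in> inside K" using p assms by (auto simp: inside_def)
qed

text \<open>The open region between the graphs of \<open>\<alpha>\<close> and \<open>\<beta>\<close> over the heights in \<open>(0, h)\<close>, in the coordinate
  system with origin \<open>Q\<close>, horizontal axis \<open>T\<close> and vertical axis \<open>N\<close>.  The functions \<open>\<alpha>\<close> and \<open>\<beta>\<close> give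
  the left and the right end of the horizontal slice at a given height.\<close>

definition cap :: "real^2 \<Rightarrow> real^2 \<Rightarrow> real^2 \<Rightarrow> (real \<Rightarrow> real) \<Rightarrow> (real \<Rightarrow> real) \<Rightarrow> real \<Rightarrow> (real^2) set" where
  "cap Q T N \<alpha> \<beta> h = {p. 0 < (p-Q) \<bullet> N \<and> (p-Q) \<bullet> N < h \<and>
     \<alpha> ((p-Q) \<bullet> N) < (p-Q) \<bullet> T \<and> (p-Q) \<bullet> T < \<beta> ((p-Q) \<bullet> N)}"

text \<open>The two bounding arcs of the cap together with the horizontal segment that closes it at height \<open>h\<close>.\<close>

definition cap_boundary :: "real^2 \<Rightarrow> real^2 \<Rightarrow> real^2 \<Rightarrow> (real \<Rightarrow> real) \<Rightarrow> (real \<Rightarrow> real) \<Rightarrow> real \<Rightarrow> (real^2) set" where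
  "cap_boundary Q T N \<alpha> \<beta> h =
     {p. 0 \<le> (p-Q) \<bullet> N \<and> (p-Q) \<bullet> N \<le> h \<and>
       ((p-Q) \<bullet> T = \<alpha> ((p-Q) \<bullet> N) \<or> (p-Q) \<bullet> T = \<beta> ((p-Q) \<bullet> N))} \<union>
     {p. (p-Q) \<bullet> N = h \<and> \<alpha> h \<le> (p-Q) \<bullet> T \<and> (p-Q) \<bullet> T \<le> \<beta> h}"

lemma cap_0: "cap Q T N \<alpha> \<beta> 0 = {}"
  by (auto simp: cap_def)

lemma cap_open:
  assumes "continuous_on {0..h} \<alpha>" "continuous_on {0..h} \<beta>"
  shows "open (cap Q T N \<alpha> \<beta> h)"
proof -
  define D where "D = {p. 0 < (p-Q) \<bullet> N \<and> (p-Q) \<bullet> N < h}"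
  have "open {p. 0 < (p-Q) \<bullet> N}" "open {p. (p-Q) \<bullet> N < h}"
    by (intro open_Collect_less continuous_intros)+
  then have oD: "open D" unfolding D_def Collect_conj_eq by blast
  have sub: "(\<lambda>p. (p-Q) \<bullet> N) ` D \<subseteq> {0..h}" by (auto simp: D_def)
  have cc: "continuous_on D (\<lambda>p. f ((p-Q) \<bullet> N))" if "continuous_on {0..h} f" for f :: "real \<Rightarrow> real"
    by (rule continuous_on_compose2[OF that _ sub]) (intro continuous_intros)
  have "open (D \<inter> (\<lambda>p. (p-Q) \<bullet> T - \<alpha> ((p-Q) \<bullet> N)) -` {0<..})"
    by (intro continuous_open_preimage oD continuous_intros cc assms)
  moreover have "open (D \<inter> (\<lambda>p. \<beta> ((p-Q) \<bullet> N) - (p-Q) \<bullet> T) -` {0<..})"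
    by (intro continuous_open_preimage oD continuous_intros cc assms)
  moreover have "cap Q T N \<alpha> \<beta> h = (D \<inter> (\<lambda>p. (p-Q) \<bullet> T - \<alpha> ((p-Q) \<bullet> N)) -` {0<..})
      \<inter> (D \<inter> (\<lambda>p. \<beta> ((p-Q) \<bullet> N) - (p-Q) \<bullet> T) -` {0<..})"
    by (auto simp: cap_def D_def)
  ultimately show ?thesis by auto
qed

lemma cap_subset_crect:
  assumes "antimono_on {0..h} \<alpha>" "mono_on {0..h} \<beta>"
  shows "cap Q T N \<alpha> \<beta> h \<subseteq>
    {p. \<alpha> h \<le> (p-Q) \<bullet> T \<and> (p-Q) \<bullet> T \<le> \<beta> h \<and> 0 \<le> (p-Q) \<bullet> N \<and> (p-Q) \<bullet> N \<le> h}"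
proof -
  have "\<alpha> h \<le> \<alpha> y" "\<beta> y \<le> \<beta> h" if "0 < y" "y < h" for y
    using that monotone_onD[OF assms(1), of y h] monotone_onD[OF assms(2), of y h] by auto
  then show ?thesis by (force simp: cap_def)
qed

lemma cap_bounded:
  assumes "orthoframe T N" "0 \<le> h" "antimono_on {0..h} \<alpha>" "mono_on {0..h} \<beta>" "\<alpha> 0 = 0" "\<beta> 0 = 0"
  shows "bounded (cap Q T N \<alpha> \<beta> h)"
proof -
  have "\<alpha> h \<le> \<alpha> 0" "\<beta> 0 \<le> \<beta> h"
    using monotone_onD[OF assms(3), of 0 h] monotone_onD[OF assms(4), of 0 h] assms(2) by auto
  then have "\<alpha> h \<le> \<beta> h" using assms by linarith
  then show ?thesis
    using crect_compact[OF assms(1) _ assms(2), of "\<alpha> h" "\<beta> h" Q]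
      cap_subset_crect[OF assms(3,4), of Q T N] bounded_subset compact_imp_bounded by blast
qed

text \<open>Every point outside the cap and its boundary escapes to infinity along a ray parallel to one of the
  axes, and the cap is open with closed union with its boundary.\<close>

lemma inside_cap_boundary:
  assumes fr: "orthoframe T N" and h: "0 < h"
    and cont: "continuous_on {0..h} \<alpha>" "continuous_on {0..h} \<beta>"
    and mon: "antimono_on {0..h} \<alpha>" "mono_on {0..h} \<beta>"
    and zero: "\<alpha> 0 = 0" "\<beta> 0 = 0"
  shows "inside (cap_boundary Q T N \<alpha> \<beta> h) = cap Q T N \<alpha> \<beta> h"
proof
  let ?K = "cap_boundary Q T N \<alpha> \<beta> h"
  let ?R = "cap Q T N \<alpha> \<beta> h"
  have le: "\<alpha> y \<le> 0" "0 \<le> \<beta> y" if "0 \<le> y" "y \<le> h" for y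
    using that monotone_onD[OF mon(1), of 0 y] monotone_onD[OF mon(2), of 0 y] zero h by auto
  show "?R \<subseteq> inside ?K"
  proof (rule component_in_open_region)
    show "open ?R" by (rule cap_open[OF cont])
    show "bounded ?R" using cap_bounded[OF fr _ mon zero] h by simp
    show "?R \<inter> ?K = {}" by (auto simp: cap_def cap_boundary_def)
    define D where "D = {p. 0 \<le> (p-Q) \<bullet> N \<and> (p-Q) \<bullet> N \<le> h}"
    have "closed {p. 0 \<le> (p-Q) \<bullet> N}" "closed {p. (p-Q) \<bullet> N \<le> h}"
      by (intro closed_Collect_le continuous_intros)+
    then have oD: "closed D" unfolding D_def Collect_conj_eq by blast
    have sub: "(\<lambda>p. (p-Q) \<bullet> N) ` D \<subseteq> {0..h}" by (auto simp: D_def)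
    have cc: "continuous_on D (\<lambda>p. f ((p-Q) \<bullet> N))" if "continuous_on {0..h} f" for f :: "real \<Rightarrow> real"
      by (rule continuous_on_compose2[OF that _ sub]) (intro continuous_intros)
    have "closed (D \<inter> (\<lambda>p. (p-Q) \<bullet> T - \<alpha> ((p-Q) \<bullet> N)) -` {0..})"
      by (intro continuous_closed_preimage oD continuous_intros cc cont)
    moreover have "closed (D \<inter> (\<lambda>p. \<beta> ((p-Q) \<bullet> N) - (p-Q) \<bullet> T) -` {0..})"
      by (intro continuous_closed_preimage oD continuous_intros cc cont)
    moreover have "?R \<union> ?K = (D \<inter> (\<lambda>p. (p-Q) \<bullet> T - \<alpha> ((p-Q) \<bullet> N)) -` {0..})
        \<inter> (D \<inter> (\<lambda>p. \<beta> ((p-Q) \<bullet> N) - (p-Q) \<bullet> T) -` {0..})"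
    proof -
      have "p \<in> ?R \<union> ?K \<longleftrightarrow> p \<in> D \<and> \<alpha> ((p-Q) \<bullet> N) \<le> (p-Q) \<bullet> T \<and> (p-Q) \<bullet> T \<le> \<beta> ((p-Q) \<bullet> N)" for p
      proof -
        define x where "x = (p-Q) \<bullet> T"
        define y where "y = (p-Q) \<bullet> N"
        have "p \<in> ?R \<union> ?K \<longleftrightarrow> (0 < y \<and> y < h \<and> \<alpha> y < x \<and> x < \<beta> y) \<or>
            (0 \<le> y \<and> y \<le> h \<and> (x = \<alpha> y \<or> x = \<beta> y)) \<or> (y = h \<and> \<alpha> h \<le> x \<and> x \<le> \<beta> h)"
          by (simp add: cap_def cap_boundary_def x_def y_def)
        also have "\<dots> \<longleftrightarrow> 0 \<le> y \<and> y \<le> h \<and> \<alpha> y \<le> x \<and> x \<le> \<beta> y"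
        proof (cases "0 \<le> y \<and> y \<le> h")
          case True
          then have "\<alpha> y \<le> \<beta> y" using le[of y] by simp
          then show ?thesis using True zero h by (cases "y = 0"; cases "y = h"; force)
        qed (use h in auto)
        finally show ?thesis by (simp add: D_def x_def y_def)
      qed
      then have "?R \<union> ?K = {p \<in> D. \<alpha> ((p-Q) \<bullet> N) \<le> (p-Q) \<bullet> T \<and> (p-Q) \<bullet> T \<le> \<beta> ((p-Q) \<bullet> N)}"
        by (intro set_eqI) (simp only: mem_Collect_eq)
      also have "\<dots> = (D \<inter> (\<lambda>p. (p-Q) \<bullet> T - \<alpha> ((p-Q) \<bullet> N)) -` {0..})
        \<inter> (D \<inter> (\<lambda>p. \<beta> ((p-Q) \<bullet> N) - (p-Q) \<bullet> T) -` {0..})" by auto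
      finally show ?thesis .
    qed
    ultimately show "closed (?R \<union> ?K)" by (simp only: closed_Int)
  qed
  show "inside ?K \<subseteq> ?R"
  proof
    fix p assume pin: "p \<in> inside ?K"
    have Nn: "N \<noteq> 0" "T \<noteq> 0" using fr by (auto simp: orthoframe_def)
    define x where "x = (p-Q) \<bullet> T"
    define y where "y = (p-Q) \<bullet> N"
    have cx: "(p + c *\<^sub>R T - Q) \<bullet> T = x + c" "(p + c *\<^sub>R T - Q) \<bullet> N = y"
      and cy: "(p + c *\<^sub>R N - Q) \<bullet> T = x" "(p + c *\<^sub>R N - Q) \<bullet> N = y + c" for c
      by (simp_all add: x_def y_def inner_add_left inner_diff_left orthoframe_inner[OF fr])
    have pK: "p \<notin> ?K" using pin by (auto simp: inside_def)
    have m: "d = T \<or> d = -T \<or> d = N \<or> d = -N \<Longrightarrow> \<exists>c\<ge>0. p + c *\<^sub>R d \<in> ?K" for d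
      using ray_notin_inside[of d p ?K] pin Nn by (metis neg_equal_0_iff_equal)
    have 1: "y \<le> h"
      using m[of N] h by (auto simp: cap_boundary_def cy)
    have 2: "y > 0"
    proof (rule ccontr)
      assume y: "\<not> y > 0"
      obtain c where c: "c \<ge> 0" "p + c *\<^sub>R (-N) \<in> ?K" using m[of "-N"] by auto
      have "p - c *\<^sub>R N \<in> ?K" using c by simp
      then have "c = 0" using c y cy[of "-c"] h by (auto simp: cap_boundary_def)
      then show False using c pK by simp
    qed
    have 3: "\<alpha> y < x"
    proof (rule ccontr)
      assume y: "\<not> \<alpha> y < x"
      obtain c where c: "c \<ge> 0" "p + c *\<^sub>R (-T) \<in> ?K" using m[of "-T"] by auto
      have "p - c *\<^sub>R T \<in> ?K" using c by simp
      then have "c = 0" using c y cx[of "-c"] 1 2 le[of y] by (auto simp: cap_boundary_def)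
      then show False using c pK by simp
    qed
    have 4: "x < \<beta> y"
    proof (rule ccontr)
      assume y: "\<not> x < \<beta> y"
      obtain c where c: "c \<ge> 0" "p + c *\<^sub>R T \<in> ?K" using m[of "T"] by auto
      then have "c = 0" using c y cx[of "c"] 1 2 le[of y] by (auto simp: cap_boundary_def)
      then show False using c pK by simp
    qed
    have "y \<noteq> h" using pK 1 2 3 4 by (auto simp: cap_boundary_def x_def y_def)
    then show "p \<in> ?R" using 1 2 3 4 by (auto simp: cap_def x_def y_def)
  qed
qed

lemma cap_lmeasurable:
  assumes fr: "orthoframe T N" and h: "0 \<le> h"
    and cont: "continuous_on {0..h} \<alpha>" "continuous_on {0..h} \<beta>"
    and mon: "antimono_on {0..h} \<alpha>" "mono_on {0..h} \<beta>"
    and zero: "\<alpha> 0 = 0" "\<beta> 0 = 0"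
  shows "cap Q T N \<alpha> \<beta> h \<in> lmeasurable"
  by (intro bounded_set_imp_lmeasurable cap_bounded assms)
    (use cap_open[OF cont, of Q T N] in \<open>simp add: borel_open\<close>)

text \<open>The part of the cap between two heights contains one rectangle and is covered by another.\<close>

lemma measure_cap_growth:
  fixes Q :: "real^2"
  assumes fr: "orthoframe T N" and h: "0 \<le> h" "h < k"
    and cont: "continuous_on {0..k} \<alpha>" "continuous_on {0..k} \<beta>"
    and mon: "antimono_on {0..k} \<alpha>" "mono_on {0..k} \<beta>"
    and zero: "\<alpha> 0 = 0" "\<beta> 0 = 0"
  defines "S \<equiv> \<lambda>h. measure lebesgue (cap Q T N \<alpha> \<beta> h)"
  shows "(k - h) * (\<beta> h - \<alpha> h) \<le> S k - S h" "S k - S h \<le> (k - h) * (\<beta> k - \<alpha> k)"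
proof -
  have h': "{0..h} \<subseteq> {0..k}" using h by auto
  have mh: "cap Q T N \<alpha> \<beta> h \<in> lmeasurable"
    by (rule cap_lmeasurable[OF fr h(1)])
      (use cont mon zero h' in \<open>auto intro: continuous_on_subset monotone_on_subset\<close>)
  have mk: "cap Q T N \<alpha> \<beta> k \<in> lmeasurable"
    by (rule cap_lmeasurable[OF fr]) (use h cont mon zero in auto)
  have mo: "\<alpha> y \<le> \<alpha> x" "\<beta> x \<le> \<beta> y" if "0 \<le> x" "x \<le> y" "y \<le> k" for x y
    using mon that by (auto simp: monotone_on_def)
  have lr: "\<alpha> h \<le> \<beta> h" "\<alpha> k \<le> \<beta> k" using mo[of 0 h] mo[of 0 k] h zero by auto
  let ?B = "{p. \<alpha> h < (p-Q) \<bullet> T \<and> (p-Q) \<bullet> T < \<beta> h \<and> h < (p-Q) \<bullet> N \<and> (p-Q) \<bullet> N < k}"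
  let ?C = "{p. \<alpha> k \<le> (p-Q) \<bullet> T \<and> (p-Q) \<bullet> T \<le> \<beta> k \<and> h \<le> (p-Q) \<bullet> N \<and> (p-Q) \<bullet> N \<le> k}"
  have hk: "h \<le> k" using h by simp
  note B = rect_lmeasurable[OF fr lr(1) hk, of Q] measure_rect[OF fr lr(1) hk, of Q]
  have C: "?C \<in> lmeasurable" "measure lebesgue ?C = (\<beta> k - \<alpha> k) * (k - h)"
    using crect_compact[OF fr lr(2) hk, of Q] measure_crect[OF fr lr(2) hk, of Q]
    by (auto intro: lmeasurable_compact)
  have dis: "cap Q T N \<alpha> \<beta> h \<inter> ?B = {}" by (auto simp: cap_def)
  have "S h + measure lebesgue ?B = measure lebesgue (cap Q T N \<alpha> \<beta> h \<union> ?B)"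
    unfolding S_def using mh B dis by (simp add: measure_Un3)
  also have "\<dots> \<le> S k"
    unfolding S_def
  proof (rule measure_mono_fmeasurable)
    show "cap Q T N \<alpha> \<beta> h \<union> ?B \<subseteq> cap Q T N \<alpha> \<beta> k"
    proof
      fix p assume p: "p \<in> cap Q T N \<alpha> \<beta> h \<union> ?B"
      define x where "x = (p-Q) \<bullet> T"
      define y where "y = (p-Q) \<bullet> N"
      show "p \<in> cap Q T N \<alpha> \<beta> k"
        using p h mo[of h y] unfolding cap_def x_def[symmetric] y_def[symmetric]
        by (auto simp: x_def[symmetric] y_def[symmetric])
    qed
  qed (use mh mk B in \<open>auto intro: fmeasurableD\<close>)
  finally show "(k - h) * (\<beta> h - \<alpha> h) \<le> S k - S h" using B by (simp add: algebra_simps)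
  have "S k \<le> measure lebesgue (cap Q T N \<alpha> \<beta> h \<union> ?C)"
    unfolding S_def
  proof (rule measure_mono_fmeasurable)
    show "cap Q T N \<alpha> \<beta> k \<subseteq> cap Q T N \<alpha> \<beta> h \<union> ?C"
    proof
      fix p assume p: "p \<in> cap Q T N \<alpha> \<beta> k"
      define x where "x = (p-Q) \<bullet> T"
      define y where "y = (p-Q) \<bullet> N"
      show "p \<in> cap Q T N \<alpha> \<beta> h \<union> ?C"
        using p h mo[of y k] unfolding cap_def
        by (auto simp: x_def[symmetric] y_def[symmetric])
    qed
  qed (use mh mk C in \<open>auto intro: fmeasurableD\<close>)
  also have "\<dots> \<le> S h + measure lebesgue ?C"
    unfolding S_def by (rule measure_Un_le) (use mh C in auto)
  finally show "S k - S h \<le> (k - h) * (\<beta> k - \<alpha> k)" using C by (simp add: algebra_simps)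
qed

lemma measure_cap_tendsto_0_and_DERIV:
  assumes fr: "orthoframe T N" and h1: "0 < h1"
    and cont: "continuous_on {0..h1} \<alpha>" "continuous_on {0..h1} \<beta>"
    and mon: "antimono_on {0..h1} \<alpha>" "mono_on {0..h1} \<beta>"
    and zero: "\<alpha> 0 = 0" "\<beta> 0 = 0"
  shows "((\<lambda>h. measure lebesgue (cap Q T N \<alpha> \<beta> h)) \<longlongrightarrow> 0) (at_right 0)"
    and "0 < h \<Longrightarrow> h < h1 \<Longrightarrow>
      ((\<lambda>h. measure lebesgue (cap Q T N \<alpha> \<beta> h)) has_real_derivative \<beta> h - \<alpha> h) (at h)"
proof -
  define S where "S = (\<lambda>h. measure lebesgue (cap Q T N \<alpha> \<beta> h))"
  define L where "L = (\<lambda>h. \<beta> h - \<alpha> h)"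
  have gr: "(k - h) * L h \<le> S k - S h" "S k - S h \<le> (k - h) * L k" if "0 \<le> h" "h < k" "k \<le> h1" for h k
  proof -
    have sub: "{0..k} \<subseteq> {0..h1}" using that by auto
    note g = measure_cap_growth[OF fr that(1,2) continuous_on_subset[OF cont(1) sub]
        continuous_on_subset[OF cont(2) sub] monotone_on_subset[OF mon(1) sub]
        monotone_on_subset[OF mon(2) sub] zero, of Q]
    show "(k - h) * L h \<le> S k - S h" "S k - S h \<le> (k - h) * L k"
      using g by (simp_all add: S_def L_def)
  qed
  have cL: "continuous_on {0..h1} L" unfolding L_def by (intro continuous_intros cont)
  have S0: "S 0 = 0" by (simp add: S_def cap_0)
  have Lm: "L k \<le> L h1" if "0 \<le> k" "k \<le> h1" for k
    using mon that by (auto simp: monotone_on_def L_def intro!: diff_mono)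
  show "(S \<longlongrightarrow> 0) (at_right 0)"
  proof (rule tendsto_sandwich[of "\<lambda>_. 0" _ _ "\<lambda>k. k * L h1"])
    show "\<forall>\<^sub>F n in at_right 0. 0 \<le> S n" by (simp add: S_def)
    show "\<forall>\<^sub>F k in at_right 0. S k \<le> k * L h1"
      using eventually_at_right_real[OF h1]
    proof eventually_elim
      case (elim k)
      then have "S k \<le> k * L k" using gr(2)[of 0 k] S0 by simp
      also have "\<dots> \<le> k * L h1" using elim Lm[of k] by (intro mult_left_mono) auto
      finally show ?case .
    qed
    show "((\<lambda>k. k * L h1) \<longlongrightarrow> 0) (at_right 0)" by (auto intro!: tendsto_eq_intros)
  qed simp
  assume h: "0 < h" "h < h1"
  have isc: "isCont L h" using cL h
    by (metis at_within_Icc_at continuous_on_eq_continuous_within atLeastAtMost_iff less_imp_le)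
  have "((\<lambda>k. (S k - S h) / (k - h)) \<longlongrightarrow> L h) (at h)"
  proof (rule Lim_transform_bound[of "\<lambda>k. (S k - S h) / (k - h) - L h" "\<lambda>k. L k - L h" "at h" , THEN Lim_null[THEN iffD2]])
    have "eventually (\<lambda>k. k \<in> {0<..<h1} \<and> k \<noteq> h) (at h)"
      using h by (intro eventually_conj eventually_at_in_open') (auto simp: eventually_at_filter)
    then show "\<forall>\<^sub>F k in at h. norm ((S k - S h) / (k - h) - L h) \<le> norm (L k - L h)"
    proof eventually_elim
      case (elim k)
      show ?case
      proof (cases "h < k")
        case True
        then have "L h \<le> (S k - S h) / (k-h)" "(S k - S h) / (k-h) \<le> L k"
          using gr[of h k] elim h by (auto simp: field_simps)
        then show ?thesis by auto
      next
        case False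
        then have kh: "k < h" using elim by auto
        have "(S k - S h) / (k - h) = (S h - S k) / (h - k)" using kh by (simp add: field_simps)
        moreover have "L k \<le> (S h - S k) / (h-k)" "(S h - S k) / (h-k) \<le> L h"
          using gr[of k h] elim h kh by (auto simp: field_simps)
        ultimately show ?thesis by auto
      qed
    qed
    show "((\<lambda>k. L k - L h) \<longlongrightarrow> 0) (at h)"
      using isc by (simp add: isCont_def LIM_zero)
  qed
  then show "(S has_real_derivative \<beta> h - \<alpha> h) (at h)"
    by (simp add: has_field_derivative_iff L_def)
qed

section \<open>Calculus of the area and chord functions\<close>

text \<open>The derivative may vanish at the left end point \<open>c\<close>, as that of the height function does at the
  point of tangency.\<close>

lemma increasing_inverse:
  fixes f f' :: "real \<Rightarrow> real"
  assumes cd: "c < d"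
    and der: "\<And>s. s \<in> {c..d} \<Longrightarrow> (f has_real_derivative f' s) (at s)"
    and pos: "\<And>s. c < s \<Longrightarrow> s \<le> d \<Longrightarrow> f' s > 0"
  obtains g where "\<And>h. h \<in> {f c..f d} \<Longrightarrow> g h \<in> {c..d} \<and> f (g h) = h"
    and "\<And>s. s \<in> {c..d} \<Longrightarrow> f s \<in> {f c..f d} \<and> g (f s) = s"
    and "continuous_on {f c..f d} g"
    and "\<And>h. f c < h \<Longrightarrow> h < f d \<Longrightarrow> c < g h \<and> g h < d \<and> (g has_real_derivative 1 / f' (g h)) (at h)"
    and "strict_mono_on {f c..f d} g"
proof -
  have cont: "continuous_on {c..d} f"
    by (meson DERIV_isCont der continuous_at_imp_continuous_on)
  have mono: "f x < f y" if "c \<le> x" "x < y" "y \<le> d" for x y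
  proof (rule DERIV_pos_imp_increasing_open[OF that(2)])
    show "\<exists>D. (f has_real_derivative D) (at z) \<and> 0 < D" if "x < z" "z < y" for z
      using der[of z] pos[of z] that \<open>c \<le> x\<close> \<open>y \<le> d\<close> by auto
    show "continuous_on {x..y} f" using cont by (rule continuous_on_subset) (use that in auto)
  qed
  have inj: "inj_on f {c..d}"
    by (rule linorder_inj_onI) (use mono in \<open>fastforce+\<close>)
  have im: "f ` {c..d} = {f c..f d}"
  proof
    have "f c \<le> f s \<and> f s \<le> f d" if "s \<in> {c..d}" for s
      using mono[of c s] mono[of s d] that by (cases "s = c"; cases "s = d"; force)
    then show "f ` {c..d} \<subseteq> {f c..f d}" by auto
    show "{f c..f d} \<subseteq> f ` {c..d}"
      using IVT'[of f c _ d] cont cd by (fastforce simp: image_iff)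
  qed
  define g where "g = inv_into {c..d} f"
  have 1: "g h \<in> {c..d} \<and> f (g h) = h" if "h \<in> {f c..f d}" for h
  proof -
    have h: "h \<in> f ` {c..d}" using that im by simp
    show ?thesis unfolding g_def using inv_into_into[OF h] f_inv_into_f[OF h] by simp
  qed
  have 2: "f s \<in> {f c..f d} \<and> g (f s) = s" if "s \<in> {c..d}" for s
    using that im inj by (auto simp: g_def)
  have 3: "continuous_on {f c..f d} g"
    unfolding im[symmetric] by (rule continuous_on_inv) (use cont 2 in auto)
  have 4: "c < g h \<and> g h < d \<and> (g has_real_derivative 1 / f' (g h)) (at h)"
    if "f c < h" "h < f d" for h
  proof -
    have g: "g h \<in> {c..d}" "f (g h) = h" using 1[of h] that by auto
    then have g': "c < g h" "g h < d" using that by (auto simp: order.strict_iff_order)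
    have "isCont g h" using 3 that
      by (metis at_within_Icc_at continuous_on_eq_continuous_within atLeastAtMost_iff less_imp_le)
    then have "(g has_real_derivative inverse (f' (g h))) (at h)"
      by (intro DERIV_inverse_function[OF der _ that]) (use g g' pos[of "g h"] 1 in auto)
    then show ?thesis using g' by (simp add: inverse_eq_divide)
  qed
  have 5: "strict_mono_on {f c..f d} g"
  proof (rule strict_mono_onI)
    fix r s assume rs: "r \<in> {f c..f d}" "s \<in> {f c..f d}" "r < s"
    show "g r < g s"
    proof (rule ccontr)
      assume "\<not> g r < g s"
      then have "f (g s) \<le> f (g r)"
        using mono[of "g s" "g r"] 1[OF rs(1)] 1[OF rs(2)] by (cases "g s = g r") auto
      then show False using rs 1 by auto
    qed
  qed
  show ?thesis using that[of g] 1 2 3 4 5 by blast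
qed

lemma constant_on_greaterThanLessThan:
  fixes f :: "real \<Rightarrow> real"
  assumes "\<And>x. a < x \<Longrightarrow> x < b \<Longrightarrow> (f has_real_derivative 0) (at x)"
    and "a < x" "x < b" "a < y" "y < b"
  shows "f x = f y"
  using DERIV_isconst3[of a b x y f] assms by auto

lemma eq_zero_of_derivative_zero_tendsto:
  fixes f :: "real \<Rightarrow> real"
  assumes "\<And>x. 0 < x \<Longrightarrow> x < b \<Longrightarrow> (f has_real_derivative 0) (at x)"
    and lim: "(f \<longlongrightarrow> 0) (at_right 0)" and x: "0 < x" "x < b"
  shows "f x = 0"
proof -
  have "eventually (\<lambda>y. f x = f y) (at_right 0)"
    using eventually_at_right_real[of 0 b] x
    by (auto elim!: eventually_mono intro: constant_on_greaterThanLessThan[of 0 b] assms(1))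
  then have "((\<lambda>_. f x) \<longlongrightarrow> 0) (at_right (0::real))"
    using lim by (simp add: tendsto_cong)
  then show ?thesis by (simp add: tendsto_const_iff)
qed

text \<open>In the lemmas of this section \<open>L\<close> plays the role of the chord length and \<open>S\<close> that of the area of the
  cap, as functions of the height; \<open>L\<^sup>2 / (2 L')\<close> is the area of the tangent triangle.\<close>

lemma chord_area_asymptotics:
  fixes S L L' :: "real \<Rightarrow> real"
  assumes h1: "0 < h1"
    and S: "\<And>h. 0 < h \<Longrightarrow> h < h1 \<Longrightarrow> (S has_real_derivative L h) (at h)" "(S \<longlongrightarrow> 0) (at_right 0)"
    and L: "\<And>h. 0 < h \<Longrightarrow> h < h1 \<Longrightarrow> (L has_real_derivative L' h) (at h)" "(L \<longlongrightarrow> 0) (at_right 0)"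
    and lim: "((\<lambda>h. L' h * sqrt h) \<longlongrightarrow> m) (at_right 0)"
  shows "((\<lambda>h. L h / sqrt h) \<longlongrightarrow> 2 * m) (at_right 0)"
    and "((\<lambda>h. S h / (h * sqrt h)) \<longlongrightarrow> 4 / 3 * m) (at_right 0)"
proof -
  have ev: "eventually (\<lambda>h. 0 < h \<and> h < h1) (at_right 0)"
    using eventually_at_right_real[OF h1] by simp
  have ds: "(sqrt has_real_derivative 1 / (2 * sqrt h)) (at h)" if "0 < h" for h
    using DERIV_real_sqrt[OF that] by (simp add: field_simps)
  have dhs: "((\<lambda>h. h * sqrt h) has_real_derivative 3 / 2 * sqrt h) (at h)" if "0 < h" for h
    using that by (auto intro!: derivative_eq_intros ds simp: field_simps)
  have s0: "(sqrt \<longlongrightarrow> 0) (at_right 0)"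
    using tendsto_real_sqrt[OF tendsto_ident_at, of 0 "{0<..}"] by simp
  show 1: "((\<lambda>h. L h / sqrt h) \<longlongrightarrow> 2 * m) (at_right 0)"
  proof (rule lhopital_right_0[of L sqrt "\<lambda>h. 1 / (2 * sqrt h)" L'])
    show "((\<lambda>h. L' h / (1 / (2 * sqrt h))) \<longlongrightarrow> 2 * m) (at_right 0)"
      using tendsto_mult_left[OF lim, of 2] by (simp add: mult.commute mult.left_commute)
  qed (use ev L ds s0 in \<open>auto elim!: eventually_mono\<close>)
  show "((\<lambda>h. S h / (h * sqrt h)) \<longlongrightarrow> 4 / 3 * m) (at_right 0)"
  proof (rule lhopital_right_0[of S _ "\<lambda>h. 3 / 2 * sqrt h" L])
    show "((\<lambda>h. L h / (3 / 2 * sqrt h)) \<longlongrightarrow> 4 / 3 * m) (at_right 0)"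
      using tendsto_mult_left[OF 1, of "2/3"] by (simp add: mult.commute mult.left_commute)
    show "((\<lambda>h. h * sqrt h) \<longlongrightarrow> 0) (at_right 0)"
      using tendsto_mult[OF tendsto_ident_at s0] by simp
  qed (use ev S dhs in \<open>auto elim!: eventually_mono\<close>)
qed

lemma area_ratio_tendsto:
  fixes S L L' :: "real \<Rightarrow> real"
  assumes "0 < h1"
    and "\<And>h. 0 < h \<Longrightarrow> h < h1 \<Longrightarrow> (S has_real_derivative L h) (at h)" "(S \<longlongrightarrow> 0) (at_right 0)"
    and "\<And>h. 0 < h \<Longrightarrow> h < h1 \<Longrightarrow> (L has_real_derivative L' h) (at h)" "(L \<longlongrightarrow> 0) (at_right 0)"
    and "((\<lambda>h. L' h * sqrt h) \<longlongrightarrow> m) (at_right 0)" "m > 0"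
  shows "((\<lambda>h. S h / ((L h)\<^sup>2 / (2 * L' h))) \<longlongrightarrow> 2 / 3) (at_right 0)"
proof -
  note a = chord_area_asymptotics[OF assms(1-6)]
  have lim: "((\<lambda>h. 2 * (S h / (h * sqrt h)) * (L' h * sqrt h) / (L h / sqrt h)\<^sup>2) \<longlongrightarrow>
      2 * (4/3*m) * m / (2*m)\<^sup>2) (at_right 0)"
    by (intro tendsto_intros a assms) (use assms in auto)
  have m: "2 * (4/3*m) * m / (2*m)\<^sup>2 = 2/3"
    using assms(7) by (simp add: power2_eq_square field_simps)
  have "eventually (\<lambda>h. 2 * (S h / (h * sqrt h)) * (L' h * sqrt h) / (L h / sqrt h)\<^sup>2
      = S h / ((L h)\<^sup>2 / (2 * L' h))) (at_right 0)"
    using eventually_at_right_real[OF assms(1)]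
    by eventually_elim (auto simp: field_simps power2_eq_square)
  with lim show ?thesis unfolding m by (rule Lim_transform_eventually)
qed

text \<open>If the area of the cap is two thirds of the area of the triangle, then \<open>3 S L' = L\<^sup>2\<close>.  Hence
  \<open>S / L\<^sup>3\<close> and then \<open>2 L L'\<close> are constant, and the constant is read off from the limit at \<open>0\<close>.\<close>

lemma square_chord_linear:
  fixes S L L' :: "real \<Rightarrow> real"
  assumes h1: "0 < h1"
    and S: "\<And>h. 0 < h \<Longrightarrow> h < h1 \<Longrightarrow> (S has_real_derivative L h) (at h)" "(S \<longlongrightarrow> 0) (at_right 0)"
    and L: "\<And>h. 0 < h \<Longrightarrow> h < h1 \<Longrightarrow> (L has_real_derivative L' h) (at h)" "(L \<longlongrightarrow> 0) (at_right 0)"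
    and lim: "((\<lambda>h. L' h * sqrt h) \<longlongrightarrow> m) (at_right 0)"
    and pos: "\<And>h. 0 < h \<Longrightarrow> h < h1 \<Longrightarrow> L h > 0" "\<And>h. 0 < h \<Longrightarrow> h < h1 \<Longrightarrow> L' h > 0"
    and eq: "\<And>h. 0 < h \<Longrightarrow> h < h1 \<Longrightarrow> S h = 2 / 3 * ((L h)\<^sup>2 / (2 * L' h))"
    and h: "0 < h" "h < h1"
  shows "(L h)\<^sup>2 = 4 * m\<^sup>2 * h"
proof -
  have eq': "3 * S h * L' h = (L h)\<^sup>2" if "0 < h" "h < h1" for h
    using eq[OF that] pos[OF that] by (simp add: field_simps)
  have d: "((\<lambda>h. S h / (L h)^3) has_real_derivative 0) (at h)" if "0 < h" "h < h1" for h
  proof -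
    have "L h * L h ^ 3 - S h * (3 * (L h)\<^sup>2 * L' h) = 0"
      using eq'[OF that] by algebra
    then show ?thesis
      using DERIV_divide[OF S(1)[OF that] DERIV_power[OF L(1)[OF that], of 3]] pos(1)[OF that]
      by (simp add: algebra_simps)
  qed
  define K where "K = S (h1/2) / (L (h1/2))^3"
  have K: "S h / (L h)^3 = K" if "0 < h" "h < h1" for h
    unfolding K_def
    by (rule constant_on_greaterThanLessThan[of 0 h1 "\<lambda>h. S h / (L h)^3"]) (use that h1 d in auto)
  have K: "S h = K * (L h)^3" if "0 < h" "h < h1" for h
    using K[OF that] pos(1)[OF that] by (auto simp: field_simps)
  define c where "c = 2 / (3 * K)"
  have K0: "K > 0"
  proof -
    have "S h > 0" using eq[OF h] pos[OF h] by simp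
    then show ?thesis using K[OF h] pos(1)[OF h] by (simp add: zero_less_mult_iff)
  qed
  have c: "2 * L h * L' h = c" if "0 < h" "h < h1" for h
  proof -
    have "3 * (K * L h ^ 3) * L' h = (L h)\<^sup>2" using eq'[OF that] K[OF that] by simp
    then have "(L h)\<^sup>2 * (3 * K * (L h * L' h)) = (L h)\<^sup>2 * 1" by algebra
    then have "3 * K * (L h * L' h) = 1" using pos(1)[OF that] by simp
    then show ?thesis using K0 by (simp add: c_def field_simps)
  qed
  have L2: "(L h)\<^sup>2 = c * h" if "0 < h" "h < h1" for h
  proof -
    have "(L h)\<^sup>2 - c * h = 0"
    proof (rule eq_zero_of_derivative_zero_tendsto[OF _ _ that])
      show "((\<lambda>h. (L h)\<^sup>2 - c * h) has_real_derivative 0) (at h)" if "0 < h" "h < h1" for h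
        using DERIV_diff[OF DERIV_power[OF L(1)[OF that], of 2] DERIV_cmult_Id[of c]] c[OF that]
        by (simp add: algebra_simps)
      show "((\<lambda>h. (L h)\<^sup>2 - c * h) \<longlongrightarrow> 0) (at_right 0)"
        using L(2) by (auto intro!: tendsto_eq_intros)
    qed
    then show ?thesis by simp
  qed
  have "((\<lambda>h. (L h / sqrt h)\<^sup>2) \<longlongrightarrow> (2 * m)\<^sup>2) (at_right 0)"
    by (intro tendsto_power chord_area_asymptotics(1)[OF h1 S L lim]) auto
  moreover have "eventually (\<lambda>h. (L h / sqrt h)\<^sup>2 = c) (at_right 0)"
    using eventually_at_right_real[OF h1]
    by eventually_elim (use L2 in \<open>auto simp: power_divide\<close>)
  ultimately have "((\<lambda>_. c) \<longlongrightarrow> (2 * m)\<^sup>2) (at_right (0::real))"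
    by (simp add: tendsto_cong)
  then have "c = (2 * m)\<^sup>2" by (simp add: tendsto_const_iff)
  then show ?thesis using L2[OF h] by (simp add: power_mult_distrib)
qed

text \<open>The converse: from \<open>L\<^sup>2 = C h\<close> follows \<open>2 h L' = L\<close>, so that \<open>S\<close> and \<open>(2 / 3) h L\<close> have the same
  derivative, while the triangle has area \<open>h L\<close>.\<close>

lemma archimedes_ratio:
  fixes S L L' :: "real \<Rightarrow> real"
  assumes h1: "0 < h1"
    and S: "\<And>h. 0 < h \<Longrightarrow> h < h1 \<Longrightarrow> (S has_real_derivative L h) (at h)" "(S \<longlongrightarrow> 0) (at_right 0)"
    and L: "\<And>h. 0 < h \<Longrightarrow> h < h1 \<Longrightarrow> (L has_real_derivative L' h) (at h)" "(L \<longlongrightarrow> 0) (at_right 0)"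
    and pos: "\<And>h. 0 < h \<Longrightarrow> h < h1 \<Longrightarrow> L h > 0"
    and eq: "\<And>h. 0 < h \<Longrightarrow> h < h1 \<Longrightarrow> (L h)\<^sup>2 = C * h"
    and h: "0 < h" "h < h1"
  shows "S h = 2 / 3 * ((L h)\<^sup>2 / (2 * L' h))"
proof -
  have LL: "2 * L h * L' h = C" if h: "0 < h" "h < h1" for h
  proof -
    have "((\<lambda>h. (L h)\<^sup>2) has_real_derivative 2 * L h * L' h) (at h)"
      using DERIV_power[OF L(1)[OF h], of 2] by (simp add: algebra_simps)
    moreover have "((\<lambda>h. (L h)\<^sup>2) has_real_derivative C) (at h)"
    proof (rule has_field_derivative_transform_within_open[of "\<lambda>h. C * h" _ _ "{0<..<h1}"])
      show "((\<lambda>h. C * h) has_real_derivative C) (at h)" by (auto intro!: derivative_eq_intros)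
    qed (use h eq in auto)
    ultimately show ?thesis by (rule DERIV_unique)
  qed
  have hL: "2 * h * L' h = L h" if h: "0 < h" "h < h1" for h
  proof -
    have "L h * (2 * h * L' h) = L h * L h"
      using LL[OF h] eq[OF h] by (simp add: power2_eq_square algebra_simps)
    then show ?thesis using pos[OF h] by simp
  qed
  have "S h - 2 / 3 * (h * L h) = 0"
  proof (rule eq_zero_of_derivative_zero_tendsto[OF _ _ h])
    show "((\<lambda>h. S h - 2 / 3 * (h * L h)) has_real_derivative 0) (at h)" if "0 < h" "h < h1" for h
      using DERIV_diff[OF S(1)[OF that] DERIV_cmult[OF DERIV_mult[OF DERIV_ident L(1)[OF that]], of "2/3"]]
        hL[OF that] by (simp add: algebra_simps)
    have "((\<lambda>h. S h - 2 / 3 * (h * L h)) \<longlongrightarrow> 0 - 2 / 3 * (0 * 0)) (at_right 0)"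
      by (intro tendsto_intros S(2) L(2))
    then show "((\<lambda>h. S h - 2 / 3 * (h * L h)) \<longlongrightarrow> 0) (at_right 0)" by simp
  qed
  moreover have "(L h)\<^sup>2 / (2 * L' h) = h * L h"
  proof -
    have "L' h \<noteq> 0" using hL[OF h] pos[OF h] by auto
    moreover have "L h * (2 * h * L' h) = L h * L h" using hL[OF h] by simp
    ultimately show ?thesis by (auto simp: field_simps power2_eq_square)
  qed
  ultimately show ?thesis by simp
qed

section \<open>Parametrization of parabolas\<close>

text \<open>The determinant of two plane vectors.\<close>

definition cross2 :: "real^2 \<Rightarrow> real^2 \<Rightarrow> real" where
  "cross2 u v = u$1 * v$2 - u$2 * v$1"

text \<open>The parabola with focus at distance \<open>\<bar>g\<bar> * norm n\<close> from the directrix, where \<open>n\<close> is \<open>v\<close> turned by a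
  right angle.\<close>

lemma focus_directrix_parametrization:
  fixes v n q :: "real^2"
  assumes v: "v \<noteq> 0" and n: "n = vector [- v$2, v$1]" and g: "g \<noteq> 0"
  shows "{x. dist x (q + f *\<^sub>R v + g *\<^sub>R n) = infdist x {q + c *\<^sub>R v | c. True}} =
    {(q + f *\<^sub>R v + (g/2) *\<^sub>R n) + u *\<^sub>R v + u\<^sup>2 *\<^sub>R ((1 / (2 * g)) *\<^sub>R n) | u. True}"
proof -
  have nc: "n$1 = - v$2" "n$2 = v$1" by (simp_all add: n)
  define V where "V = v \<bullet> v"
  have V: "V > 0" using v by (simp add: V_def)
  have Vc: "V = v$1 * v$1 + v$2 * v$2" by (simp add: V_def inner2)
  have sq: "(norm (a *\<^sub>R v + b *\<^sub>R n))\<^sup>2 = (a\<^sup>2 + b\<^sup>2) * V" for a b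
    by (simp add: power2_norm_eq_inner inner2 nc Vc) (simp add: power2_eq_square algebra_simps)
  have inf: "infdist (q + a *\<^sub>R v + b *\<^sub>R n) {q + c *\<^sub>R v | c. True} = norm (b *\<^sub>R n)" for a b
  proof (rule antisym)
    have "infdist (q + a *\<^sub>R v + b *\<^sub>R n) {q + c *\<^sub>R v | c. True} \<le>
        dist (q + a *\<^sub>R v + b *\<^sub>R n) (q + a *\<^sub>R v)"
      by (rule infdist_le) auto
    then show "infdist (q + a *\<^sub>R v + b *\<^sub>R n) {q + c *\<^sub>R v | c. True} \<le> norm (b *\<^sub>R n)"
      by (simp add: dist_norm)
    show "norm (b *\<^sub>R n) \<le> infdist (q + a *\<^sub>R v + b *\<^sub>R n) {q + c *\<^sub>R v | c. True}"
    proof (subst infdist_notempty, force, rule cINF_greatest)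
      show "{q + c *\<^sub>R v | c. True} \<noteq> {}" by blast
      fix y assume "y \<in> {q + c *\<^sub>R v | c. True}"
      then obtain c where "y = q + c *\<^sub>R v" by auto
      then have d: "dist (q + a *\<^sub>R v + b *\<^sub>R n) y = norm ((a - c) *\<^sub>R v + b *\<^sub>R n)"
        by (simp add: dist_norm algebra_simps)
      have "(norm (b *\<^sub>R n))\<^sup>2 \<le> (norm ((a - c) *\<^sub>R v + b *\<^sub>R n))\<^sup>2"
        using sq[of 0 b] sq[of "a - c" b] V by (simp add: mult_right_mono)
      then show "norm (b *\<^sub>R n) \<le> dist (q + a *\<^sub>R v + b *\<^sub>R n) y"
        unfolding d by (rule power2_le_imp_le) simp
    qed
  qed
  have iff: "dist (q + a *\<^sub>R v + b *\<^sub>R n) (q + f *\<^sub>R v + g *\<^sub>R n) =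
      infdist (q + a *\<^sub>R v + b *\<^sub>R n) {q + c *\<^sub>R v | c. True} \<longleftrightarrow>
      b = g/2 + (a - f)\<^sup>2 * (1 / (2 * g))" for a b
  proof -
    have "dist (q + a *\<^sub>R v + b *\<^sub>R n) (q + f *\<^sub>R v + g *\<^sub>R n) = norm ((a-f) *\<^sub>R v + (b-g) *\<^sub>R n)"
      by (simp add: dist_norm algebra_simps)
    then have "dist (q + a *\<^sub>R v + b *\<^sub>R n) (q + f *\<^sub>R v + g *\<^sub>R n) =
      infdist (q + a *\<^sub>R v + b *\<^sub>R n) {q + c *\<^sub>R v | c. True} \<longleftrightarrow>
      (norm ((a-f) *\<^sub>R v + (b-g) *\<^sub>R n))\<^sup>2 = (norm (b *\<^sub>R n))\<^sup>2"
      unfolding inf by (simp add: power2_eq_iff_nonneg)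
    also have "\<dots> \<longleftrightarrow> (a-f)\<^sup>2 + (b-g)\<^sup>2 = b\<^sup>2"
      using sq[of 0 b] sq[of "a-f" "b-g"] V by simp
    also have "\<dots> \<longleftrightarrow> b = g/2 + (a - f)\<^sup>2 * (1 / (2 * g))"
      using g by (simp add: field_simps power2_eq_square) (auto simp: algebra_simps)
    finally show ?thesis .
  qed
  have coord: "\<exists>a b. x = q + a *\<^sub>R v + b *\<^sub>R n" for x
  proof (intro exI)
    show "x = q + (((x-q) \<bullet> v) / V) *\<^sub>R v + (((x-q) \<bullet> n) / V) *\<^sub>R n"
      using V by (simp add: vec_eq_iff forall_2 nc inner2 field_simps) (simp add: Vc algebra_simps)
  qed
  show ?thesis
  proof safe
    fix x assume x: "dist x (q + f *\<^sub>R v + g *\<^sub>R n) = infdist x {q + c *\<^sub>R v | c. True}"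
    obtain a b where ab: "x = q + a *\<^sub>R v + b *\<^sub>R n" using coord by blast
    then have "b = g/2 + (a - f)\<^sup>2 * (1 / (2 * g))" using x iff by blast
    then show "\<exists>u. x = (q + f *\<^sub>R v + (g/2) *\<^sub>R n) + u *\<^sub>R v + u\<^sup>2 *\<^sub>R ((1 / (2 * g)) *\<^sub>R n) \<and> True"
      using ab by (intro exI[of _ "a - f"]) (simp add: algebra_simps)
  next
    fix u
    have e: "(q + f *\<^sub>R v + (g/2) *\<^sub>R n) + u *\<^sub>R v + u\<^sup>2 *\<^sub>R ((1 / (2 * g)) *\<^sub>R n) =
       q + (u + f) *\<^sub>R v + (g/2 + u\<^sup>2 * (1 / (2 * g))) *\<^sub>R n"
      by (simp add: algebra_simps)
    show "dist (q + f *\<^sub>R v + (g/2) *\<^sub>R n + u *\<^sub>R v + u\<^sup>2 *\<^sub>R (1 / (2 * g)) *\<^sub>R n) (q + f *\<^sub>R v + g *\<^sub>R n) =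
         infdist (q + f *\<^sub>R v + (g/2) *\<^sub>R n + u *\<^sub>R v + u\<^sup>2 *\<^sub>R (1 / (2 * g)) *\<^sub>R n) {q + c *\<^sub>R v |c. True}"
      unfolding e iff by simp
  qed
qed

lemma parabola_imp_parametrization:
  assumes "parabola \<Gamma>"
  obtains p v e where "cross2 v e \<noteq> 0" "\<Gamma> = {p + u *\<^sub>R v + u\<^sup>2 *\<^sub>R e | u. True}"
proof -
  obtain F q v L where v: "v \<noteq> 0" and L: "L = {q + c *\<^sub>R v | c. True}" and "F \<notin> L"
    and "\<Gamma> = {x. dist x F = infdist x L}"
    using assms unfolding parabola_def by (elim exE conjE)
  then have F: "F \<notin> {q + c *\<^sub>R v | c. True}"
    and G: "\<Gamma> = {x. dist x F = infdist x {q + c *\<^sub>R v | c. True}}"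
    by simp_all
  define n :: "real^2" where "n = vector [- v$2, v$1]"
  have nc: "n$1 = - v$2" "n$2 = v$1" by (simp_all add: n_def)
  define V where "V = v \<bullet> v"
  have V: "V > 0" using v by (simp add: V_def)
  have Vc: "V = v$1 * v$1 + v$2 * v$2" by (simp add: V_def inner2)
  define f where "f = ((F-q) \<bullet> v) / V"
  define g where "g = ((F-q) \<bullet> n) / V"
  have Fe: "F = q + f *\<^sub>R v + g *\<^sub>R n"
    unfolding f_def g_def
    using V by (simp add: vec_eq_iff forall_2 nc inner2 field_simps) (simp add: Vc algebra_simps)
  have g: "g \<noteq> 0" using F Fe by auto
  have "cross2 v ((1 / (2 * g)) *\<^sub>R n) = V / (2 * g)"
    using g by (simp add: cross2_def nc Vc field_simps)
  then have "cross2 v ((1 / (2 * g)) *\<^sub>R n) \<noteq> 0" using V g by simp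
  then show ?thesis
    by (rule that[OF _ G[unfolded Fe focus_directrix_parametrization[OF v n_def g, of q f]]])
qed

text \<open>A quadratic parametrization is brought to its vertex by a shift of the parameter that makes the
  linear coefficient \<open>w\<close> orthogonal to \<open>e\<close>.\<close>

lemma parametrization_imp_parabola:
  assumes ve: "cross2 v e \<noteq> 0"
  shows "parabola {p + u *\<^sub>R v + u\<^sup>2 *\<^sub>R e | u. True}"
proof -
  define E where "E = e \<bullet> e"
  have e0: "E > 0" using ve by (auto simp: E_def cross2_def)
  define t where "t = - (v \<bullet> e) / (2 * E)"
  define w where "w = v + (2 * t) *\<^sub>R e"
  have we: "w \<bullet> e = 0"
    using e0 unfolding w_def t_def inner_add_left inner_scaleR_left E_def[symmetric] by simp
  have w: "w \<noteq> 0"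
  proof
    assume "w = 0"
    then have "v = (- (2 * t)) *\<^sub>R e" by (simp add: w_def eq_neg_iff_add_eq_0)
    then show False using ve by (simp add: cross2_def)
  qed
  define n :: "real^2" where "n = vector [- w$2, w$1]"
  have nc: "n$1 = - w$2" "n$2 = w$1" by (simp_all add: n_def)
  define W where "W = w \<bullet> w"
  have W: "W > 0" using w by (simp add: W_def)
  have Wc: "W = w$1 * w$1 + w$2 * w$2" by (simp add: W_def inner2)
  define k where "k = (e \<bullet> n) / W"
  have we': "w$1 * e$1 + w$2 * e$2 = 0" using we by (simp add: inner2)
  have ek: "e = k *\<^sub>R n"
  proof -
    have "e$1 * W = (e$1 * n$1 + e$2 * n$2) * n$1" "e$2 * W = (e$1 * n$1 + e$2 * n$2) * n$2"
      unfolding nc Wc using we' by algebra+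
    then show ?thesis using W by (simp add: vec_eq_iff forall_2 k_def inner2 field_simps)
  qed
  then have k: "k \<noteq> 0" using e0 by (auto simp: E_def)
  define g where "g = 1 / (2 * k)"
  have g: "g \<noteq> 0" "1 / (2 * g) = k" using k by (simp_all add: g_def)
  define p' where "p' = p + t *\<^sub>R v + t\<^sup>2 *\<^sub>R e"
  define q where "q = p' - (g/2) *\<^sub>R n"
  have "{p + u *\<^sub>R v + u\<^sup>2 *\<^sub>R e | u. True} = {p' + u *\<^sub>R w + u\<^sup>2 *\<^sub>R e | u. True}"
  proof safe
    fix u
    show "\<exists>ua. p + u *\<^sub>R v + u\<^sup>2 *\<^sub>R e = p' + ua *\<^sub>R w + ua\<^sup>2 *\<^sub>R e \<and> True"
      by (rule exI[of _ "u - t"]) (simp add: p'_def w_def vec_eq_iff forall_2 power2_eq_square algebra_simps)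
    show "\<exists>ua. p' + u *\<^sub>R w + u\<^sup>2 *\<^sub>R e = p + ua *\<^sub>R v + ua\<^sup>2 *\<^sub>R e \<and> True"
      by (rule exI[of _ "u + t"]) (simp add: p'_def w_def vec_eq_iff forall_2 power2_eq_square algebra_simps)
  qed
  also have "\<dots> = {x. dist x (q + 0 *\<^sub>R w + g *\<^sub>R n) = infdist x {q + c *\<^sub>R w | c. True}}"
    unfolding focus_directrix_parametrization[OF w n_def g(1), of q 0]
    by (simp add: q_def g(2) ek[symmetric])
  finally have eq: "{p + u *\<^sub>R v + u\<^sup>2 *\<^sub>R e | u. True} =
    {x. dist x (q + g *\<^sub>R n) = infdist x {q + c *\<^sub>R w | c. True}}" by simp
  have "q + g *\<^sub>R n \<notin> {q + c *\<^sub>R w | c. True}"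
  proof
    assume "q + g *\<^sub>R n \<in> {q + c *\<^sub>R w | c. True}"
    then obtain c where "g *\<^sub>R n = c *\<^sub>R w" by auto
    then have "g * (n \<bullet> n) = c * (w \<bullet> n)" by (metis inner_scaleR_left)
    moreover have "n \<bullet> n = W" "w \<bullet> n = 0" by (simp_all add: inner2 nc Wc)
    ultimately show False using g W by simp
  qed
  then show ?thesis
    unfolding eq parabola_def using w
    by (intro exI[of _ "q + g *\<^sub>R n"] exI[of _ q] exI[of _ w] exI[of _ "{q + c *\<^sub>R w | c. True}"] conjI refl)
qed

section \<open>Conics tangent to a line\<close>

text \<open>Two points at which a monic quadratic polynomial with roots of opposite signs is nonpositive are at
  most as far apart as the roots; if it is nonnegative at points on both sides of zero, these are at
  least as far apart.  The sign \<open>\<tau>\<close> covers both cases.\<close>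

lemma monic_quadratic_gap:
  fixes u v \<beta> \<gamma> \<tau> :: real
  assumes \<tau>: "\<tau> = 1 \<or> \<tau> = -1" and uv: "u < 0" "0 < v" and \<gamma>: "\<gamma> > 0"
    and u: "\<tau> * (u\<^sup>2 - \<beta> * u - \<gamma>) \<le> 0" and v: "\<tau> * (v\<^sup>2 - \<beta> * v - \<gamma>) \<le> 0"
  shows "\<tau> * ((v - u)\<^sup>2 - (\<beta>\<^sup>2 + 4 * \<gamma>)) \<le> 0"
proof -
  define d where "d = sqrt (\<beta>\<^sup>2 + 4 * \<gamma>)"
  have d2: "d\<^sup>2 = \<beta>\<^sup>2 + 4 * \<gamma>" using \<gamma> by (simp add: d_def)
  have d0: "d > 0" using \<gamma> by (simp add: d_def add_nonneg_pos)
  have db: "\<bar>\<beta>\<bar> < d"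
  proof -
    have "\<beta>\<^sup>2 < d\<^sup>2" using d2 \<gamma> by simp
    then have "\<bar>\<beta>\<bar>\<^sup>2 < d\<^sup>2" by simp
    then show ?thesis by (rule power2_less_imp_less) (use d0 in simp)
  qed
  have sq: "(2 * w - \<beta>)\<^sup>2 = 4 * (w\<^sup>2 - \<beta> * w - \<gamma>) + d\<^sup>2" for w
    unfolding d2 by (simp add: power2_eq_square algebra_simps)
  from \<tau> show ?thesis
  proof
    assume 1: "\<tau> = 1"
    have "(2 * u - \<beta>)\<^sup>2 \<le> d\<^sup>2" "(2 * v - \<beta>)\<^sup>2 \<le> d\<^sup>2" using u v sq[of u] sq[of v] 1 by auto
    then have "\<bar>2 * u - \<beta>\<bar> \<le> d" "\<bar>2 * v - \<beta>\<bar> \<le> d"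
      using d0 by (metis abs_le_square_iff abs_of_pos)+
    then have "\<bar>v - u\<bar> \<le> \<bar>d\<bar>" using d0 by linarith
    then show ?thesis using 1 d2 by (simp add: abs_le_square_iff)
  next
    assume 1: "\<tau> = -1"
    have "d\<^sup>2 \<le> (2 * u - \<beta>)\<^sup>2" "d\<^sup>2 \<le> (2 * v - \<beta>)\<^sup>2" using u v sq[of u] sq[of v] 1 by auto
    then have "d \<le> \<bar>2 * u - \<beta>\<bar>" "d \<le> \<bar>2 * v - \<beta>\<bar>"
      using d0 by (metis abs_le_square_iff abs_of_pos)+
    then have "\<bar>d\<bar> \<le> \<bar>v - u\<bar>" using d0 db uv by linarith
    then show ?thesis using 1 d2 by (simp add: abs_le_square_iff)
  qed
qed

text \<open>The quadratic form whose zero set is the conic that touches the axis \<open>y = 0\<close> at the origin and is,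
  near the origin, the graph of a function with second derivative \<open>(A + B u + C u\<^sup>2)\<^bsup>-3/2\<^esup>\<close>, for \<open>A > 0\<close>.  At a fixed
  height \<open>y\<close> it is a monic polynomial in \<open>u\<close> with discriminant \<open>8 A\<^bsup>3/2\<^esup> y + 4 A\<^sup>2 C y\<^sup>2\<close>, the square of the
  length of the horizontal chord.\<close>

definition conic_form :: "real \<Rightarrow> real \<Rightarrow> real \<Rightarrow> real \<Rightarrow> real \<Rightarrow> real" where
  "conic_form A B C u y =
     u\<^sup>2 - B * sqrt A * y * u - A * y * ((4 * A * C - B\<^sup>2) * y / 4 + 2 * sqrt A)"

text \<open>The conic as a graph near the origin.  This closed form requires \<open>4 A C \<noteq> B\<^sup>2\<close>; in the
  excluded case the default value of the division makes the function zero.\<close>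

definition conic_graph :: "real \<Rightarrow> real \<Rightarrow> real \<Rightarrow> real \<Rightarrow> real" where
  "conic_graph A B C u =
     4 / (4 * A * C - B\<^sup>2) * (sqrt (A + B * u + C * u\<^sup>2) - sqrt A - B * u / (2 * sqrt A))"

text \<open>The derivative of \<open>conic_graph\<close>.\<close>

definition conic_slope :: "real \<Rightarrow> real \<Rightarrow> real \<Rightarrow> real \<Rightarrow> real" where
  "conic_slope A B C u =
     2 / (4 * A * C - B\<^sup>2) * ((B + 2 * C * u) / sqrt (A + B * u + C * u\<^sup>2) - B / sqrt A)"

lemma conic_graph_0: "conic_graph A B C 0 = 0" and conic_slope_0: "conic_slope A B C 0 = 0"
  by (simp_all add: conic_graph_def conic_slope_def)

lemma quadratic_deriv:
  fixes A B C u :: real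
  shows "((\<lambda>u. A + B * u + C * u\<^sup>2) has_real_derivative B + 2 * C * u) (at u)"
proof -
  have "((\<lambda>u. A + B * u + C * u\<^sup>2) has_real_derivative 0 + B + C * (of_nat 2 * (1 * u ^ (2 - Suc 0)))) (at u)"
    by (intro DERIV_add DERIV_const DERIV_cmult_Id DERIV_cmult DERIV_power DERIV_ident)
  moreover have "0 + B + C * (of_nat 2 * (1 * u ^ (2 - Suc 0))) = B + 2 * C * u" by simp
  ultimately show ?thesis by (simp only:)
qed

lemma conic_graph_deriv:
  assumes "A + B * u + C * u\<^sup>2 > 0"
  shows "(conic_graph A B C has_real_derivative conic_slope A B C u) (at u)"
proof -
  have d: "((\<lambda>u. A + B * u + C * u\<^sup>2) has_real_derivative B + 2 * C * u) (at u)"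
    by (rule quadratic_deriv)
  have "((\<lambda>u. sqrt (A + B * u + C * u\<^sup>2)) has_real_derivative
      (B + 2 * C * u) / (2 * sqrt (A + B * u + C * u\<^sup>2))) (at u)"
  proof -
    have "inverse s / 2 * (B + 2 * C * u) = (B + 2 * C * u) / (2 * s)" for s :: real
      by (simp add: inverse_eq_divide)
    moreover have "((\<lambda>u. sqrt (A + B * u + C * u\<^sup>2)) has_real_derivative
        inverse (sqrt (A + B * u + C * u\<^sup>2)) / 2 * (B + 2 * C * u)) (at u)"
      by (rule DERIV_chain2[where f = sqrt and g = "\<lambda>u. A + B * u + C * u\<^sup>2", OF _ d])
        (rule DERIV_real_sqrt[OF assms])
    ultimately show ?thesis by (simp only:)
  qed
  moreover have "((\<lambda>u. B * u / (2 * sqrt A)) has_real_derivative B / (2 * sqrt A)) (at u)"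
    using DERIV_cdivide[OF DERIV_cmult_Id[of B], of "2 * sqrt A"] by simp
  ultimately have "((\<lambda>u. 4 / (4 * A * C - B\<^sup>2) * (sqrt (A + B * u + C * u\<^sup>2) - sqrt A - B * u / (2 * sqrt A)))
      has_real_derivative 4 / (4 * A * C - B\<^sup>2) *
        ((B + 2 * C * u) / (2 * sqrt (A + B * u + C * u\<^sup>2)) - 0 - B / (2 * sqrt A))) (at u)"
    by (intro DERIV_cmult DERIV_diff DERIV_const)
  moreover have "4 / (4 * A * C - B\<^sup>2) *
        ((B + 2 * C * u) / (2 * sqrt (A + B * u + C * u\<^sup>2)) - 0 - B / (2 * sqrt A)) = conic_slope A B C u"
  proof -
    have "4 / d * (n / (2 * s) - 0 - B / (2 * r)) = 2 / d * (n / s - B / r)" for d n s r :: real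
      by (cases "d = 0"; cases "s = 0"; cases "r = 0"; simp add: field_simps)
    then show ?thesis unfolding conic_slope_def .
  qed
  ultimately show ?thesis unfolding conic_graph_def[abs_def] by (simp only:)
qed

lemma conic_slope_deriv:
  assumes p: "A + B * u + C * u\<^sup>2 > 0" and D: "4 * A * C - B\<^sup>2 \<noteq> 0"
  shows "(conic_slope A B C has_real_derivative (A + B * u + C * u\<^sup>2) powr (-3/2)) (at u)"
proof -
  define \<psi> where "\<psi> = (\<lambda>u. A + B * u + C * u\<^sup>2)"
  define s where "s = sqrt (\<psi> u)"
  have s: "s > 0" "s * s = \<psi> u" using p by (simp_all add: s_def \<psi>_def)
  have d: "(\<psi> has_real_derivative B + 2 * C * u) (at u)"
    unfolding \<psi>_def by (rule quadratic_deriv)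
  have ds: "((\<lambda>u. sqrt (\<psi> u)) has_real_derivative (B + 2 * C * u) / (2 * s)) (at u)"
  proof -
    have "\<psi> u > 0" using p by (simp add: \<psi>_def)
    from DERIV_chain2[OF DERIV_real_sqrt[OF this] d] show ?thesis
      by (simp add: s_def field_simps)
  qed
  have dn: "((\<lambda>u. B + 2 * C * u) has_real_derivative 2 * C) (at u)"
    using quadratic_deriv[of B "2 * C" 0 u] by simp
  have "((\<lambda>u. (B + 2 * C * u) / sqrt (\<psi> u)) has_real_derivative
      (2 * C * s - (B + 2 * C * u) * ((B + 2 * C * u) / (2 * s))) / (s * s)) (at u)"
    using DERIV_divide[OF dn ds] s(1) by (simp add: s_def)
  moreover have "(2 * C * s - (B + 2 * C * u) * ((B + 2 * C * u) / (2 * s))) / (s * s) =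
      (4 * A * C - B\<^sup>2) / 2 / (s * s * s)"
  proof -
    have "2 * C * s * (2 * s) - (B + 2 * C * u) * (B + 2 * C * u) = 4 * A * C - B\<^sup>2"
      using s(2) unfolding \<psi>_def by algebra
    then have "2 * C * s - (B + 2 * C * u) * ((B + 2 * C * u) / (2 * s)) = (4 * A * C - B\<^sup>2) / (2 * s)"
      using s(1) by (simp add: field_simps)
    then show ?thesis by simp
  qed
  moreover have "s * s * s = \<psi> u powr (3/2)"
  proof -
    have "\<psi> u powr (3/2) = \<psi> u powr (1 + 1/2)" by simp
    also have "\<dots> = \<psi> u * sqrt (\<psi> u)" using p unfolding powr_add by (simp add: powr_half_sqrt \<psi>_def)
    finally show ?thesis using s by (simp add: s_def)
  qed
  ultimately have "((\<lambda>u. (B + 2 * C * u) / sqrt (\<psi> u)) has_real_derivative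
      (4 * A * C - B\<^sup>2) / 2 * \<psi> u powr (-3/2)) (at u)"
    by (simp add: powr_minus_divide)
  from DERIV_cmult[OF DERIV_diff[OF this DERIV_const[of "B / sqrt A"]], of "2 / (4 * A * C - B\<^sup>2)"]
  show ?thesis using D by (simp add: conic_slope_def[abs_def] \<psi>_def)
qed

lemma conic_form_graph:
  assumes A: "A > 0" and D: "4 * A * C - B\<^sup>2 \<noteq> 0" and p: "A + B * u + C * u\<^sup>2 > 0"
  shows "conic_form A B C u (conic_graph A B C u) = 0"
proof -
  define r where "r = sqrt A"
  define s where "s = sqrt (A + B * u + C * u\<^sup>2)"
  define D where "D = 4 * A * C - B\<^sup>2"
  define y where "y = conic_graph A B C u"
  have r: "r > 0" "A = r * r" using A by (simp_all add: r_def)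
  have s: "s * s = A + B * u + C * u\<^sup>2" using p by (simp add: s_def)
  have D0: "D \<noteq> 0" using D by (simp add: D_def)
  have "y = 4 / D * (s - r - B * u / (2 * r))"
    unfolding y_def conic_graph_def D_def r_def s_def ..
  then have "D * y * r = 4 * (s * r - r * r - B * u / 2)"
    using D0 r(1) by (simp add: field_simps)
  then have y: "D * y * r + 4 * (r * r) + 2 * B * u = 4 * s * r" by (simp add: algebra_simps)
  have "D * (4 * conic_form A B C u y) = 0"
  proof -
    have "4 * conic_form A B C u y = 4 * u\<^sup>2 - 4 * B * r * y * u - A * y * (D * y + 8 * r)"
      by (simp add: conic_form_def r_def D_def field_simps)
    moreover have "(D * y * r + 4 * (r * r) + 2 * B * u)\<^sup>2 = 16 * (s * s) * A"
      unfolding y r(2) by (simp add: power2_eq_square)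
    ultimately show ?thesis unfolding s r(2) D_def by algebra
  qed
  then show ?thesis using D by (simp add: D_def y_def)
qed

lemma conic_form_diff:
  "conic_form A B C u y - conic_form A B C u z =
    - (y - z) * (B * sqrt A * u + A * (4 * A * C - B\<^sup>2) * (y + z) / 4 + 2 * A * sqrt A)"
  by (simp add: conic_form_def power2_eq_square field_simps)

section \<open>Strictly convex curves in parametric form\<close>

lemma cross2_simps:
  "cross2 (u + v) w = cross2 u w + cross2 v w" "cross2 u (v + w) = cross2 u v + cross2 u w"
  "cross2 (u - v) w = cross2 u w - cross2 v w" "cross2 u (v - w) = cross2 u v - cross2 u w"
  "cross2 (c *\<^sub>R u) w = c * cross2 u w" "cross2 u (c *\<^sub>R w) = c * cross2 u w"
  "cross2 u u = 0" "cross2 0 u = 0" "cross2 u 0 = 0"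
  "cross2 (- u) w = - cross2 u w" "cross2 u (- w) = - cross2 u w"
  by (simp_all add: cross2_def algebra_simps)

text \<open>A regular parametrized curve with its first three derivatives.  The number \<open>sg\<close> is the orientation:
  it is \<open>1\<close> if the curve turns left and \<open>-1\<close> if it turns right, so that \<open>sg\<close> times the determinant of
  velocity and acceleration is positive and the convex side is the one where \<open>sg\<close> times the
  determinant with the velocity is nonnegative.\<close>

locale strictly_convex_param =
  fixes X X1 X2 X3 :: "real \<Rightarrow> real^2" and I :: "real set" and sg :: real
  assumes open_I: "open I" and interval_I: "is_interval I" and I_ne: "I \<noteq> {}"
    and sg: "sg = 1 \<or> sg = -1"
    and X_deriv: "t \<in> I \<Longrightarrow> (X has_vector_derivative X1 t) (at t)"
    and X1_deriv: "t \<in> I \<Longrightarrow> (X1 has_vector_derivative X2 t) (at t)"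
    and X2_deriv: "t \<in> I \<Longrightarrow> (X2 has_vector_derivative X3 t) (at t)"
    and curved: "t \<in> I \<Longrightarrow> sg * cross2 (X1 t) (X2 t) > 0"
    and conv: "t \<in> I \<Longrightarrow> s \<in> I \<Longrightarrow> sg * cross2 (X1 t) (X s - X t) \<ge> 0"
    and inj_X: "inj_on X I"
    and normal_eq: "t \<in> I \<Longrightarrow>
      unit_normal X I t = (sg / norm (X1 t)) *\<^sub>R vector [- (X1 t)$2, (X1 t)$1]"
begin

text \<open>The determinant with the orientation of the curve; with it both orientations are treated at once.\<close>

definition dt :: "real^2 \<Rightarrow> real^2 \<Rightarrow> real" where "dt u v = sg * cross2 u v"

lemma dt_simps [simp]:
  "dt (u + v) w = dt u w + dt v w" "dt u (v + w) = dt u v + dt u w"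
  "dt (u - v) w = dt u w - dt v w" "dt u (v - w) = dt u v - dt u w"
  "dt (c *\<^sub>R u) w = c * dt u w" "dt u (c *\<^sub>R w) = c * dt u w"
  "dt u u = 0" "dt 0 u = 0" "dt u 0 = 0" "dt (- u) w = - dt u w" "dt u (- w) = - dt u w"
  by (simp_all add: dt_def cross2_simps algebra_simps)

lemma dt_swap: "dt u v = - dt v u"
  by (simp add: dt_def cross2_def algebra_simps)

lemma bounded_bilinear_dt: "bounded_bilinear dt"
proof
  show "\<exists>K. \<forall>a b. norm (dt a b) \<le> norm a * norm b * K"
  proof (intro exI allI)
    fix a b :: "real^2"
    have "\<bar>a$1\<bar> * \<bar>b$2\<bar> \<le> norm a * norm b" "\<bar>a$2\<bar> * \<bar>b$1\<bar> \<le> norm a * norm b"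
      by (intro mult_mono component_le_norm_cart; simp)+
    then have "\<bar>a$1 * b$2 - a$2 * b$1\<bar> \<le> norm a * norm b * 2"
      using abs_triangle_ineq4[of "a$1 * b$2" "a$2 * b$1"] by (simp add: abs_mult)
    then show "norm (dt a b) \<le> norm a * norm b * 2"
      using sg by (auto simp: dt_def cross2_def)
  qed
qed auto

lemma dt_has_derivative:
  assumes "(f has_vector_derivative f') (at s)" "(g has_vector_derivative g') (at s)"
  shows "((\<lambda>s. dt (f s) (g s)) has_real_derivative dt (f s) g' + dt f' (g s)) (at s)"
  using bounded_bilinear.has_vector_derivative[OF bounded_bilinear_dt assms]
  by (simp add: has_real_derivative_iff_has_vector_derivative)

lemma dt_left_derivative:
  "(f has_vector_derivative f') (at s) \<Longrightarrow> ((\<lambda>s. dt (f s) e) has_real_derivative dt f' e) (at s)"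
  using dt_has_derivative[of f f' s "\<lambda>_. e" 0] by simp

lemma X_diff_deriv: "s \<in> I \<Longrightarrow> ((\<lambda>s. X s - p) has_vector_derivative X1 s) (at s)"
  using X_deriv by (auto intro!: derivative_eq_intros)

lemma inner_has_derivative:
  "(f has_vector_derivative f') (at s) \<Longrightarrow> ((\<lambda>s. f s \<bullet> e) has_real_derivative f' \<bullet> e) (at s)"
  using bounded_linear.has_vector_derivative[OF bounded_linear_inner_left]
  by (force simp: has_real_derivative_iff_has_vector_derivative)

lemma X1_nz: "t \<in> I \<Longrightarrow> X1 t \<noteq> 0"
  using curved[of t] by (auto simp: cross2_simps)

lemma cont_X: "t \<in> I \<Longrightarrow> isCont X t" and cont_X1: "t \<in> I \<Longrightarrow> isCont X1 t" and cont_X2: "t \<in> I \<Longrightarrow> isCont X2 t"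
  using X_deriv X1_deriv X2_deriv has_vector_derivative_continuous by blast+

text \<open>The unit tangent vector.  The definition of \<open>normal\<close> below is the unit normal vector pointing to the convex side.\<close>

definition tangent :: "real \<Rightarrow> real^2" where "tangent t = X1 t /\<^sub>R norm (X1 t)"
definition normal :: "real \<Rightarrow> real^2" where
  "normal t = (sg / norm (X1 t)) *\<^sub>R vector [- (X1 t)$2, (X1 t)$1]"

lemma frame: "t \<in> I \<Longrightarrow> orthoframe (tangent t) (normal t)"
  and inner_normal: "v \<bullet> normal t = dt (X1 t) v / norm (X1 t)"
  and dt_normal: "t \<in> I \<Longrightarrow> dt v (normal t) = v \<bullet> tangent t"
proof -
  show "v \<bullet> normal t = dt (X1 t) v / norm (X1 t)"
    by (simp add: normal_def dt_def cross2_def inner2 divide_inverse algebra_simps)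
  assume t: "t \<in> I"
  define r where "r = norm (X1 t)"
  have r: "r > 0" "r * r = X1 t $ 1 * X1 t $ 1 + X1 t $ 2 * X1 t $ 2"
    using X1_nz[OF t] power2_norm_eq_inner[of "X1 t"]
    by (simp_all add: r_def inner2 flip: power2_eq_square)
  have s2: "sg * sg = 1" using sg by auto
  define a b where "a = X1 t $ 1 / r" and "b = X1 t $ 2 / r"
  have "a * a + b * b = (X1 t $ 1 * X1 t $ 1 + X1 t $ 2 * X1 t $ 2) / (r * r)"
    by (simp add: a_def b_def add_divide_distrib)
  then have ab: "a * a + b * b = 1" unfolding r(2)[symmetric] using r(1) by simp
  have comps: "tangent t $ 1 = a" "tangent t $ 2 = b" "normal t $ 1 = - sg * b" "normal t $ 2 = sg * a"
    by (simp_all add: tangent_def normal_def a_def b_def r_def divide_inverse)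
  show "orthoframe (tangent t) (normal t)"
    unfolding orthoframe_def inner2 comps
    by (intro conjI) (use ab s2 in \<open>algebra | simp\<close>)+
  show "dt v (normal t) = v \<bullet> tangent t"
    unfolding dt_def cross2_def inner2 comps using s2 by algebra
qed

lemma dt_tangent: "dt (tangent t) v = v \<bullet> normal t"
  by (simp add: inner_normal tangent_def divide_inverse mult.commute)

lemma tangent_inner_X1: "t \<in> I \<Longrightarrow> X1 t \<bullet> tangent t = norm (X1 t)"
  by (simp add: tangent_def divide_inverse flip: power2_norm_eq_inner)
    (simp add: power2_eq_square X1_nz)

lemma normal_inner_X1: "X1 t \<bullet> normal t = 0"
  by (simp add: inner_normal)

text \<open>Coordinates with respect to the frame at \<open>X t\<close>: \<open>wd t s\<close> is the horizontal position of \<open>X s\<close> along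
  the tangent line at \<open>X t\<close>, and \<open>ht t s\<close> is the height above that line.\<close>

definition wd :: "real \<Rightarrow> real \<Rightarrow> real" where "wd t s = (X s - X t) \<bullet> tangent t"
definition ht :: "real \<Rightarrow> real \<Rightarrow> real" where "ht t s = (X s - X t) \<bullet> normal t"

lemma ht_self [simp]: "ht t t = 0" and wd_self [simp]: "wd t t = 0"
  by (simp_all add: ht_def wd_def)

lemma wd_deriv: "s \<in> I \<Longrightarrow> (wd t has_real_derivative X1 s \<bullet> tangent t) (at s)"
  unfolding wd_def by (rule inner_has_derivative[OF X_diff_deriv])

lemma ht_deriv: "s \<in> I \<Longrightarrow> (ht t has_real_derivative X1 s \<bullet> normal t) (at s)"
  unfolding ht_def by (rule inner_has_derivative[OF X_diff_deriv])

section \<open>The chords parallel to a tangent line\<close>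

lemma local_chart:
  assumes t: "t \<in> I"
  obtains a0 b0 where "a0 < t" "t < b0" "{a0..b0} \<subseteq> I"
    and "\<And>s. s \<in> {a0..b0} \<Longrightarrow> X1 s \<bullet> tangent t > 0"
    and "\<And>s. t < s \<Longrightarrow> s \<le> b0 \<Longrightarrow> X1 s \<bullet> normal t > 0"
    and "\<And>s. a0 \<le> s \<Longrightarrow> s < t \<Longrightarrow> X1 s \<bullet> normal t < 0"
proof -
  have c: "isCont (\<lambda>s. X1 s \<bullet> tangent t) t" "isCont (\<lambda>s. X2 s \<bullet> normal t) t"
    by (intro continuous_intros cont_X1 cont_X2 t)+
  have p: "X1 t \<bullet> tangent t > 0" "X2 t \<bullet> normal t > 0"
    using t X1_nz curved[OF t] by (simp_all add: tangent_inner_X1 inner_normal dt_def)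
  have "\<forall>\<^sub>F s in nhds t. X1 s \<bullet> tangent t > 0" "\<forall>\<^sub>F s in nhds t. X2 s \<bullet> normal t > 0"
    using order_tendstoD(1)[OF c(1)[unfolded isCont_def] p(1)]
      order_tendstoD(1)[OF c(2)[unfolded isCont_def] p(2)] p
    by (simp_all add: eventually_nhds_conv_at)
  moreover have "\<forall>\<^sub>F s in nhds t. s \<in> I" using open_I t by (rule eventually_nhds_in_open)
  ultimately have "\<forall>\<^sub>F s in nhds t. X1 s \<bullet> tangent t > 0 \<and> X2 s \<bullet> normal t > 0 \<and> s \<in> I"
    by eventually_elim auto
  then obtain e where e: "e > 0" "\<And>s. dist s t < e \<Longrightarrow> X1 s \<bullet> tangent t > 0 \<and> X2 s \<bullet> normal t > 0 \<and> s \<in> I"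
    unfolding eventually_nhds_metric by blast
  define a0 b0 where "a0 = t - e/2" and "b0 = t + e/2"
  have in_e: "dist s t < e" if "s \<in> {a0..b0}" for s
    using that e(1) by (auto simp: a0_def b0_def dist_real_def)
  have mono: "X1 r \<bullet> normal t < X1 s \<bullet> normal t" if "a0 \<le> r" "r < s" "s \<le> b0" for r s
  proof (rule DERIV_pos_imp_increasing[OF that(2)])
    fix z assume z: "r \<le> z" "z \<le> s"
    have "z \<in> {a0..b0}" using that z by auto
    then show "\<exists>D. ((\<lambda>s. X1 s \<bullet> normal t) has_real_derivative D) (at z) \<and> 0 < D"
      using e(2)[OF in_e] X1_deriv inner_has_derivative by blast
  qed
  show ?thesis
  proof (rule that[of a0 b0])
    show "a0 < t" "t < b0" using e by (auto simp: a0_def b0_def)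
    then show "X1 s \<bullet> normal t > 0" if "t < s" "s \<le> b0" for s
      using mono[of t s] that normal_inner_X1[of t] by auto
    show "X1 s \<bullet> normal t < 0" if "a0 \<le> s" "s < t" for s
      using mono[of s t] that normal_inner_X1[of t] \<open>t < b0\<close> by auto
  qed (use e(2)[OF in_e] in auto)
qed

lemma dt_coords:
  assumes t: "t \<in> I"
  shows "dt u v = (u \<bullet> tangent t) * (v \<bullet> normal t) - (u \<bullet> normal t) * (v \<bullet> tangent t)"
proof -
  have "dt u v = dt ((u \<bullet> tangent t) *\<^sub>R tangent t + (u \<bullet> normal t) *\<^sub>R normal t) v"
    using orthoframe_expand[OF frame[OF t], of u] by simp
  also have "\<dots> = (u \<bullet> tangent t) * (v \<bullet> normal t) - (u \<bullet> normal t) * (v \<bullet> tangent t)"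
    using dt_swap[of "normal t" v] dt_normal[OF t, of v] by (simp add: dt_tangent)
  finally show ?thesis .
qed

text \<open>The remainder of the curve does not come back to a height below that of the end points of a chart,
  so that low parallel lines meet the curve in the chart only.  A lower point beside the chart would
  lie on the wrong side of a tangent line at an end point.  A lower point in the vertical strip over the chart would lie
  strictly between the arc and its chord, and no line through such a point has the curve on one side.\<close>

lemma ht_outside_chart:
  assumes t: "t \<in> I" and ab: "a0 < t" "t < b0" "{a0..b0} \<subseteq> I"
    and Tpos: "\<And>s. s \<in> {a0..b0} \<Longrightarrow> X1 s \<bullet> tangent t > 0"
    and Npos: "X1 b0 \<bullet> normal t > 0" and Nneg: "X1 a0 \<bullet> normal t < 0"
    and s: "s \<in> I" "s \<notin> {a0..b0}"
  shows "min (ht t a0) (ht t b0) \<le> ht t s"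
proof (rule ccontr)
  assume "\<not> ?thesis"
  then have low: "ht t s < ht t a0" "ht t s < ht t b0" by auto
  note fr = frame[OF t]
  have half: "(X1 r \<bullet> tangent t) * (ht t q - ht t r) \<ge> (X1 r \<bullet> normal t) * (wd t q - wd t r)"
    if "r \<in> I" "q \<in> I" for r q
    using conv[OF that] unfolding dt_def[symmetric] dt_coords[OF t]
    by (simp add: ht_def wd_def inner_diff_left algebra_simps)
  have I: "a0 \<in> I" "b0 \<in> I" using ab by auto
  \<comment> \<open>The point cannot lie beside the chart because of the tangent lines at its ends.\<close>
  have ra: "wd t a0 < wd t s"
  proof (rule ccontr)
    assume "\<not> ?thesis"
    then have "(X1 a0 \<bullet> normal t) * (wd t s - wd t a0) \<ge> 0"
      using Nneg by (simp add: mult_nonpos_nonpos)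
    moreover have "(X1 a0 \<bullet> tangent t) * (ht t s - ht t a0) < 0"
      using Tpos[of a0] ab low by (simp add: mult_pos_neg)
    ultimately show False using half[OF I(1) s(1)] by linarith
  qed
  have rb: "wd t s < wd t b0"
  proof (rule ccontr)
    assume "\<not> ?thesis"
    then have "(X1 b0 \<bullet> normal t) * (wd t s - wd t b0) \<ge> 0"
      using Npos by simp
    moreover have "(X1 b0 \<bullet> tangent t) * (ht t s - ht t b0) < 0"
      using Tpos[of b0] ab low by (simp add: mult_pos_neg)
    ultimately show False using half[OF I(2) s(1)] by linarith
  qed
  have "continuous_on {a0..b0} (wd t)"
    using wd_deriv ab by (meson DERIV_isCont continuous_at_imp_continuous_on subsetD)
  \<comment> \<open>\<open>X u\<close> is the point of the chart vertically below \<open>X s\<close>.\<close>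
  then obtain u where u: "u \<in> {a0..b0}" "wd t u = wd t s"
    using IVT'[of "wd t" a0 "wd t s" b0] ra rb ab by auto
  then have uI: "u \<in> I" using ab by auto
  have "ht t u < ht t s"
  proof -
    have "(X1 u \<bullet> tangent t) * (ht t s - ht t u) \<ge> 0" using half[OF uI s(1)] u by simp
    then have "ht t u \<le> ht t s" using Tpos[OF u(1)] by (simp add: zero_le_mult_iff)
    moreover have "ht t u \<noteq> ht t s"
    proof
      assume "ht t u = ht t s"
      then have "X u - X t = X s - X t"
        using u by (intro orthoframe_eqI[OF fr]) (auto simp: ht_def wd_def)
      then show False using inj_X uI s u by (auto simp: inj_on_def)
    qed
    ultimately show ?thesis by simp
  qed
  \<comment> \<open>The point \<open>X u\<close> and both end points of the chart lie on the same side of the tangent line at \<open>X s\<close>.\<close>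
  define A B where "A = X1 s \<bullet> tangent t" and "B = X1 s \<bullet> normal t"
  have "A * (ht t u - ht t s) \<ge> 0" using half[OF s(1) uI] u by (simp add: A_def)
  then have A: "A \<le> 0" using \<open>ht t u < ht t s\<close> by (simp add: zero_le_mult_iff)
  have pa: "A * (ht t a0 - ht t s) \<ge> B * (wd t a0 - wd t s)"
    using half[OF s(1) I(1)] by (simp add: A_def B_def)
  have pb: "A * (ht t b0 - ht t s) \<ge> B * (wd t b0 - wd t s)"
    using half[OF s(1) I(2)] by (simp add: A_def B_def)
  have na: "A * (ht t a0 - ht t s) \<le> 0" "A * (ht t b0 - ht t s) \<le> 0"
    using A low by (simp_all add: mult_nonpos_nonneg)
  have "B \<ge> 0" using pa na ra by (smt (verit) mult_neg_neg)
  moreover have "B \<le> 0" using pb na rb by (smt (verit) mult_pos_pos)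
  ultimately have B: "B = 0" by simp
  then have "A = 0" using pa A low by (simp add: zero_le_mult_iff)
  then have "X1 s = 0" using B by (intro orthoframe_eqI[OF fr]) (auto simp: A_def B_def)
  then show False using X1_nz s by auto
qed

text \<open>The end points \<open>X (a h)\<close> and \<open>X (b h)\<close> of the chord at height \<open>h\<close>, as functions of \<open>h\<close>.\<close>

lemma chord_functions:
  assumes t: "t \<in> I"
  obtains h1 a b where "0 < h1"
    and "a 0 = t" "b 0 = t"
    and "continuous_on {0..h1} a" "continuous_on {0..h1} b"
    and "strict_antimono_on {0..h1} a" "strict_mono_on {0..h1} b"
    and "\<And>h. h \<in> {0..h1} \<Longrightarrow> ht t (a h) = h \<and> ht t (b h) = h"
    and "\<And>h. 0 < h \<Longrightarrow> h < h1 \<Longrightarrow> (a has_real_derivative 1 / (X1 (a h) \<bullet> normal t)) (at h)"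
    and "\<And>h. 0 < h \<Longrightarrow> h < h1 \<Longrightarrow> (b has_real_derivative 1 / (X1 (b h) \<bullet> normal t)) (at h)"
    and "{a h1..b h1} \<subseteq> I"
    and "\<And>s. s \<in> {a h1..b h1} \<Longrightarrow> X1 s \<bullet> tangent t > 0"
    and "\<And>s. t < s \<Longrightarrow> s \<le> b h1 \<Longrightarrow> X1 s \<bullet> normal t > 0"
    and "\<And>s. a h1 \<le> s \<Longrightarrow> s < t \<Longrightarrow> X1 s \<bullet> normal t < 0"
    and "\<And>h s. s \<in> I \<Longrightarrow> 0 \<le> h \<Longrightarrow> h < h1 \<Longrightarrow> ht t s = h \<Longrightarrow> s = a h \<or> s = b h"
proof -
  obtain a0 b0 where ab: "a0 < t" "t < b0" "{a0..b0} \<subseteq> I"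
    and Tpos: "\<And>s. s \<in> {a0..b0} \<Longrightarrow> X1 s \<bullet> tangent t > 0"
    and Npos: "\<And>s. t < s \<Longrightarrow> s \<le> b0 \<Longrightarrow> X1 s \<bullet> normal t > 0"
    and Nneg: "\<And>s. a0 \<le> s \<Longrightarrow> s < t \<Longrightarrow> X1 s \<bullet> normal t < 0"
    using local_chart[OF t] by blast
  obtain b where b1: "\<And>h. h \<in> {ht t t..ht t b0} \<Longrightarrow> b h \<in> {t..b0} \<and> ht t (b h) = h"
    and b2: "\<And>s. s \<in> {t..b0} \<Longrightarrow> ht t s \<in> {ht t t..ht t b0} \<and> b (ht t s) = s"
    and b3: "continuous_on {ht t t..ht t b0} b"
    and b4: "\<And>h. ht t t < h \<Longrightarrow> h < ht t b0 \<Longrightarrow> t < b h \<and> b h < b0 \<and>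
       (b has_real_derivative 1 / (X1 (b h) \<bullet> normal t)) (at h)"
    and b5: "strict_mono_on {ht t t..ht t b0} b"
  proof (rule increasing_inverse[OF ab(2), of "ht t" "\<lambda>s. X1 s \<bullet> normal t"])
    show "(ht t has_real_derivative X1 s \<bullet> normal t) (at s)" if "s \<in> {t..b0}" for s
    proof -
      have "s \<in> {a0..b0}" using that ab by auto
      then show ?thesis using ht_deriv ab by blast
    qed
  qed (use Npos in auto)
  have dm: "((\<lambda>s. ht t (- s)) has_real_derivative - (X1 (-s) \<bullet> normal t)) (at s)" if "-s \<in> I" for s
    using ht_deriv[OF that] by (simp add: DERIV_mirror)
  obtain c where c1: "\<And>h. h \<in> {ht t t..ht t a0} \<Longrightarrow> c h \<in> {-t..-a0} \<and> ht t (-c h) = h"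
    and c2: "\<And>s. s \<in> {-t..-a0} \<Longrightarrow> ht t (-s) \<in> {ht t t..ht t a0} \<and> c (ht t (-s)) = s"
    and c3: "continuous_on {ht t t..ht t a0} c"
    and c4: "\<And>h. ht t t < h \<Longrightarrow> h < ht t a0 \<Longrightarrow> -t < c h \<and> c h < -a0 \<and>
       (c has_real_derivative 1 / - (X1 (- c h) \<bullet> normal t)) (at h)"
    and c5: "strict_mono_on {ht t t..ht t a0} c"
  proof (rule increasing_inverse[of "-t" "-a0" "\<lambda>s. ht t (-s)" "\<lambda>s. - (X1 (-s) \<bullet> normal t)"])
    show "((\<lambda>s. ht t (- s)) has_real_derivative - (X1 (- s) \<bullet> normal t)) (at s)" if "s \<in> {- t..- a0}" for s
    proof -
      have "-s \<in> {a0..b0}" using that ab by auto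
      then show ?thesis using dm ab by blast
    qed
    show "0 < - (X1 (- s) \<bullet> normal t)" if "-t < s" "s \<le> - a0" for s
      using Nneg[of "-s"] that by auto
  qed (use ab in auto)
  define a where "a = (\<lambda>h. - c h)"
  define h1 where "h1 = min (ht t a0) (ht t b0)"
  have "ht t t \<le> ht t b0" "b (ht t t) = t" "b (ht t b0) = b0"
    "ht t t \<le> ht t a0" "c (ht t t) = -t" "c (ht t a0) = -a0"
    using b2[of b0] b2[of t] c2[of "-a0"] c2[of "-t"] ab by simp_all
  then have "ht t t < ht t b0" "ht t t < ht t a0"
    using ab by (auto simp: order.strict_iff_order)
  then have h1: "0 < h1" by (simp add: h1_def)
  have sub: "{0..h1} \<subseteq> {ht t t..ht t b0}" "{0..h1} \<subseteq> {ht t t..ht t a0}" by (auto simp: h1_def)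
  have rng: "{a h1..b h1} \<subseteq> {a0..b0}"
    using b1[of h1] c1[of h1] h1 by (auto simp: a_def h1_def)
  show ?thesis
  proof (rule that[of h1 a b])
    show "0 < h1" by fact
    show "a 0 = t" "b 0 = t" using b2[of t] c2[of "-t"] ab by (auto simp: a_def)
    show "continuous_on {0..h1} a" "continuous_on {0..h1} b"
      unfolding a_def using continuous_on_subset[OF b3 sub(1)] continuous_on_subset[OF c3 sub(2)]
      by (auto intro: continuous_intros)
    show "strict_mono_on {0..h1} b" using b5 sub(1) by (rule monotone_on_subset)
    show "strict_antimono_on {0..h1} a"
      using monotone_on_subset[OF c5 sub(2)] by (auto simp: monotone_on_def a_def)
    show "ht t (a h) = h \<and> ht t (b h) = h" if "h \<in> {0..h1}" for h
      using b1 c1 that sub by (auto simp: a_def)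
    show "(b has_real_derivative 1 / (X1 (b h) \<bullet> normal t)) (at h)" if "0 < h" "h < h1" for h
      using b4[of h] that by (auto simp: h1_def)
    show "(a has_real_derivative 1 / (X1 (a h) \<bullet> normal t)) (at h)" if "0 < h" "h < h1" for h
      using c4[of h] that by (auto simp: h1_def a_def intro!: derivative_eq_intros)
    show "{a h1..b h1} \<subseteq> I" using rng ab by auto
    show "s \<in> {a h1..b h1} \<Longrightarrow> X1 s \<bullet> tangent t > 0" for s using rng Tpos by auto
    have "a h1 \<le> t" "t \<le> b h1" using b1[of h1] c1[of h1] h1 by (auto simp: a_def h1_def)
    then show "t < s \<Longrightarrow> s \<le> b h1 \<Longrightarrow> X1 s \<bullet> normal t > 0"
       "a h1 \<le> s \<Longrightarrow> s < t \<Longrightarrow> X1 s \<bullet> normal t < 0" for s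
      using rng Npos[of s] Nneg[of s] by force+
    show "s = a h \<or> s = b h" if s: "s \<in> I" "0 \<le> h" "h < h1" "ht t s = h" for h s
    proof -
      have "s \<in> {a0..b0}"
      proof (rule ccontr)
        assume "s \<notin> {a0..b0}"
        then have "min (ht t a0) (ht t b0) \<le> ht t s"
          by (intro ht_outside_chart[OF t ab Tpos Npos Nneg s(1)]) (use ab in auto)
        then show False using s unfolding h1_def by linarith
      qed
      then show ?thesis
        using b2[of s] c2[of "-s"] s by (cases "s \<le> t") (auto simp: a_def)
    qed
  qed
qed

lemma velocity_eq: "t \<in> I \<Longrightarrow> velocity X t = X1 t"
  using X_deriv vector_derivative_at by blast

lemma mem_parallel_line:
  assumes t: "t \<in> I"
  shows "p \<in> parallel_line X I t h \<longleftrightarrow> (p - X t) \<bullet> normal t = h"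
proof
  note o = orthoframe_inner[OF frame[OF t]]
  assume "p \<in> parallel_line X I t h"
  then obtain c where "p = X t + h *\<^sub>R normal t + c *\<^sub>R X1 t"
    using velocity_eq[OF t] normal_eq[OF t] by (auto simp: parallel_line_def normal_def)
  then have "p - X t = h *\<^sub>R normal t + c *\<^sub>R X1 t" by simp
  then show "(p - X t) \<bullet> normal t = h" by (simp add: inner_add_left o normal_inner_X1)
next
  assume h: "(p - X t) \<bullet> normal t = h"
  have "p = X t + h *\<^sub>R normal t + ((p - X t) \<bullet> tangent t / norm (X1 t)) *\<^sub>R X1 t"
    using orthoframe_expand[OF frame[OF t], of "p - X t"] h
    by (simp add: tangent_def algebra_simps divide_inverse)
  then show "p \<in> parallel_line X I t h"
    using velocity_eq[OF t] normal_eq[OF t] unfolding parallel_line_def normal_def by auto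
qed

lemma chord_params_eq:
  assumes t: "t \<in> I" and "a \<in> I" "b \<in> I" "a < b"
    and ht: "\<And>s. s \<in> I \<Longrightarrow> ht t s = h \<longleftrightarrow> s = a \<or> s = b"
  shows "chord_params X I t h = (a, b)"
proof -
  have eq: "X ` I \<inter> parallel_line X I t h = {X a, X b}"
    using ht assms(2,3) unfolding mem_parallel_line[OF t] ht_def
    by (auto simp: mem_parallel_line[OF t])
  show ?thesis
    unfolding chord_params_def
  proof (rule the_equality)
    show "case (a, b) of (a, b) \<Rightarrow> a \<in> I \<and> b \<in> I \<and> a < b \<and> X ` I \<inter> parallel_line X I t h = {X a, X b}"
      using assms eq by auto
    fix z
    assume z: "case z of (a, b) \<Rightarrow> a \<in> I \<and> b \<in> I \<and> a < b \<and> X ` I \<inter> parallel_line X I t h = {X a, X b}"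
    obtain a' b' where ab': "z = (a', b')" by (cases z)
    then have z': "a' \<in> I" "b' \<in> I" "a' < b'" "{X a', X b'} = {X a, X b}" using z eq by auto
    then have "a' = a \<and> b' = b \<or> a' = b \<and> b' = a"
      using inj_X assms(2,3) unfolding doubleton_eq_iff inj_on_def by metis
    then show "z = (a, b)" using ab' z' assms by auto
  qed
qed

lemma cap_boundary_eq_curve_chord:
  assumes t: "t \<in> I" and h: "0 < h" "h \<le> h1"
    and ab0: "a 0 = t" "b 0 = t"
    and cont: "continuous_on {0..h1} a" "continuous_on {0..h1} b"
    and mono: "strict_antimono_on {0..h1} a" "strict_mono_on {0..h1} b"
    and ht: "\<And>h. h \<in> {0..h1} \<Longrightarrow> ht t (a h) = h \<and> ht t (b h) = h"
    and wd: "wd t (a h) < wd t (b h)"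
  shows "X ` {a h..b h} \<union> closed_segment (X (a h)) (X (b h)) =
    cap_boundary (X t) (tangent t) (normal t) (\<lambda>y. wd t (a y)) (\<lambda>y. wd t (b y)) h"
    (is "_ \<union> ?seg = ?C")
proof -
  note fr = frame[OF t]
  have mono': "a k \<le> a j" "b j \<le> b k" if "0 \<le> j" "j \<le> k" "k \<le> h1" for j k
  proof -
    show "a k \<le> a j"
      using monotone_onD[OF mono(1), of j k] that by (cases "j = k") auto
    show "b j \<le> b k"
      using monotone_onD[OF mono(2), of j k] that by (cases "j = k") auto
  qed
  have hh: "ht t (a h) = h" "ht t (b h) = h" using ht[of h] h by auto
  have seg: "?seg = {p. (p - X t) \<bullet> normal t = h \<and>
      wd t (a h) \<le> (p - X t) \<bullet> tangent t \<and> (p - X t) \<bullet> tangent t \<le> wd t (b h)}"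
    (is "_ = ?S")
  proof (intro subset_antisym subsetI)
    fix p assume "p \<in> ?seg"
    then obtain u where u: "0 \<le> u" "u \<le> 1" "p = (1 - u) *\<^sub>R X (a h) + u *\<^sub>R X (b h)"
      by (auto simp: in_segment)
    then have p: "p - X t = (1 - u) *\<^sub>R (X (a h) - X t) + u *\<^sub>R (X (b h) - X t)"
      by (simp add: algebra_simps)
    have y: "(p - X t) \<bullet> normal t = h"
      using hh unfolding p inner_add_left inner_scaleR_left ht_def by (simp add: algebra_simps)
    have x: "(p - X t) \<bullet> tangent t = (1 - u) * wd t (a h) + u * wd t (b h)"
      unfolding p inner_add_left inner_scaleR_left wd_def ..
    have "u * (wd t (b h) - wd t (a h)) \<ge> 0" "(1 - u) * (wd t (b h) - wd t (a h)) \<ge> 0"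
      using u wd by auto
    then have "wd t (a h) \<le> (p - X t) \<bullet> tangent t" "(p - X t) \<bullet> tangent t \<le> wd t (b h)"
      unfolding x by (auto simp: algebra_simps)
    then show "p \<in> ?S" using y by simp
  next
    fix p assume "p \<in> ?S"
    then have y: "h = (p - X t) \<bullet> normal t"
      and x: "wd t (a h) \<le> (p - X t) \<bullet> tangent t" "(p - X t) \<bullet> tangent t \<le> wd t (b h)"
      by simp_all
    define u where "u = ((p - X t) \<bullet> tangent t - wd t (a h)) / (wd t (b h) - wd t (a h))"
    have u: "0 \<le> u" "u \<le> 1" using x wd by (auto simp: u_def)
    have ux: "u * (wd t (b h) - wd t (a h)) = (p - X t) \<bullet> tangent t - wd t (a h)"
      using wd by (simp add: u_def)
    have "p - X t = (1 - u) *\<^sub>R (X (a h) - X t) + u *\<^sub>R (X (b h) - X t)"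
    proof (rule orthoframe_eqI[OF fr])
      show "(p - X t) \<bullet> tangent t = ((1 - u) *\<^sub>R (X (a h) - X t) + u *\<^sub>R (X (b h) - X t)) \<bullet> tangent t"
        using ux unfolding inner_add_left inner_scaleR_left wd_def[symmetric] by (simp add: algebra_simps)
      show "(p - X t) \<bullet> normal t = ((1 - u) *\<^sub>R (X (a h) - X t) + u *\<^sub>R (X (b h) - X t)) \<bullet> normal t"
        using hh y[symmetric] unfolding inner_add_left inner_scaleR_left ht_def by (simp add: algebra_simps)
    qed
    then have "p = (1 - u) *\<^sub>R X (a h) + u *\<^sub>R X (b h)" by (simp add: algebra_simps)
    then show "p \<in> ?seg" using u by (auto simp: in_segment)
  qed
  have curve: "X ` {a h..b h} = {p. 0 \<le> (p - X t) \<bullet> normal t \<and> (p - X t) \<bullet> normal t \<le> h \<and>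
     ((p - X t) \<bullet> tangent t = wd t (a ((p - X t) \<bullet> normal t)) \<or>
      (p - X t) \<bullet> tangent t = wd t (b ((p - X t) \<bullet> normal t)))}"
    (is "_ = ?R")
  proof (intro subset_antisym subsetI)
    fix p assume "p \<in> X ` {a h..b h}"
    then obtain s where s: "s \<in> {a h..b h}" and p: "p = X s" by blast
    have "\<exists>y\<in>{0..h}. s = a y \<or> s = b y"
    proof (cases "s \<le> t")
      case True
      then obtain y where "0 \<le> y" "y \<le> h" "a y = s"
        using IVT2'[of a h s 0] s ab0 h continuous_on_subset[OF cont(1), of "{0..h}"] by auto
      then show ?thesis by auto
    next
      case False
      then obtain y where "0 \<le> y" "y \<le> h" "b y = s"
        using IVT'[of b 0 s h] s ab0 h continuous_on_subset[OF cont(2), of "{0..h}"] by auto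
      then show ?thesis by auto
    qed
    then obtain y where y: "y \<in> {0..h}" "s = a y \<or> s = b y" by blast
    then have "ht t s = y" using ht[of y] h by auto
    then have e: "(X s - X t) \<bullet> normal t = y" by (simp add: ht_def)
    have "(X s - X t) \<bullet> tangent t = wd t (a y) \<or> (X s - X t) \<bullet> tangent t = wd t (b y)"
      using y(2) by (auto simp: wd_def)
    then show "p \<in> ?R" using y(1) unfolding p mem_Collect_eq e by simp
  next
    fix p assume "p \<in> ?R"
    then have p: "0 \<le> (p - X t) \<bullet> normal t" "(p - X t) \<bullet> normal t \<le> h"
      and disj: "(p - X t) \<bullet> tangent t = wd t (a ((p - X t) \<bullet> normal t)) \<or>
        (p - X t) \<bullet> tangent t = wd t (b ((p - X t) \<bullet> normal t))" by simp_all
    define y where "y = (p - X t) \<bullet> normal t"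
    have y: "0 \<le> y" "y \<le> h" "y \<in> {0..h1}" using p h by (auto simp: y_def)
    have ord: "a h \<le> a y" "a y \<le> t" "t \<le> b y" "b y \<le> b h"
      using mono'[of y h] mono'[of 0 y] y h ab0 by auto
    have in_curve: "p \<in> X ` {a h..b h}" if s: "s \<in> {a h..b h}" "ht t s = y" "(p - X t) \<bullet> tangent t = wd t s" for s
    proof -
      have "p - X t = X s - X t"
        by (rule orthoframe_eqI[OF fr]) (use s in \<open>auto simp: wd_def ht_def y_def\<close>)
      then show ?thesis using s by auto
    qed
    from disj show "p \<in> X ` {a h..b h}"
      unfolding y_def[symmetric]
      using in_curve[of "a y"] in_curve[of "b y"] ht[OF y(3)] ord by auto
  qed
  show ?thesis unfolding cap_boundary_def seg curve ..
qed

text \<open>The apex \<open>B\<close> lies at distance \<open>L / L'\<close> from the chord of length \<open>L\<close>, because \<open>L'\<close> is the difference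
  of the reciprocal slopes of the two tangent lines.\<close>

lemma tangent_triangle_area:
  assumes t: "t \<in> I" and I: "a \<in> I" "b \<in> I"
    and ht: "ht t a = ht t b" and wd: "wd t a < wd t b"
    and na: "X1 a \<bullet> normal t < 0" and nb: "X1 b \<bullet> normal t > 0"
    and ta: "X1 a \<bullet> tangent t > 0" and tb: "X1 b \<bullet> tangent t > 0"
  shows "measure lebesgue (convex hull {THE B. tangent_line X a \<inter> tangent_line X b = {B}, X a, X b}) =
    (wd t b - wd t a)\<^sup>2 /
      (2 * (X1 b \<bullet> tangent t / (X1 b \<bullet> normal t) - X1 a \<bullet> tangent t / (X1 a \<bullet> normal t)))"
proof -
  note fr = frame[OF t]
  define L where "L = wd t b - wd t a"
  define D where "D = X1 b \<bullet> tangent t / (X1 b \<bullet> normal t) - X1 a \<bullet> tangent t / (X1 a \<bullet> normal t)"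
  have "X1 a \<bullet> tangent t / (X1 a \<bullet> normal t) < 0" "X1 b \<bullet> tangent t / (X1 b \<bullet> normal t) > 0"
    using na nb ta tb by (auto simp: divide_pos_neg)
  then have D: "D > 0" unfolding D_def by linarith
  define c where "c = - L / (D * (X1 a \<bullet> normal t))"
  define d where "d = - L / (D * (X1 b \<bullet> normal t))"
  have chord: "X b - X a = L *\<^sub>R tangent t"
  proof (rule orthoframe_eqI[OF fr])
    show "(X b - X a) \<bullet> tangent t = (L *\<^sub>R tangent t) \<bullet> tangent t"
      by (simp add: orthoframe_inner[OF fr] L_def wd_def inner_diff_left)
    show "(X b - X a) \<bullet> normal t = (L *\<^sub>R tangent t) \<bullet> normal t"
      using ht by (simp add: orthoframe_inner[OF fr] ht_def inner_diff_left)
  qed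
  have meet: "c *\<^sub>R X1 a = L *\<^sub>R tangent t + d *\<^sub>R X1 b"
  proof (rule orthoframe_eqI[OF fr])
    show "(c *\<^sub>R X1 a) \<bullet> normal t = (L *\<^sub>R tangent t + d *\<^sub>R X1 b) \<bullet> normal t"
      using na nb D
      by (simp add: inner_add_left inner_diff_left orthoframe_inner[OF fr] c_def d_def)
    have "L = (L / D) * D" using D by simp
    also have "\<dots> = (c *\<^sub>R X1 a) \<bullet> tangent t - (d *\<^sub>R X1 b) \<bullet> tangent t"
      using na nb D by (subst (2) D_def) (simp add: c_def d_def field_simps)
    finally show "(c *\<^sub>R X1 a) \<bullet> tangent t = (L *\<^sub>R tangent t + d *\<^sub>R X1 b) \<bullet> tangent t"
      by (simp add: inner_add_left inner_diff_left orthoframe_inner[OF fr])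
  qed
  define B where "B = X a + c *\<^sub>R X1 a"
  have B2: "B = X b + d *\<^sub>R X1 b" using meet chord by (simp add: B_def algebra_simps)
  have dab: "dt (X1 a) (X1 b) > 0"
    unfolding dt_coords[OF t] using na nb ta tb by (simp add: mult_neg_pos less_trans[of _ 0])
  have "tangent_line X a \<inter> tangent_line X b = {B}"
  proof
    show "{B} \<subseteq> tangent_line X a \<inter> tangent_line X b"
      unfolding tangent_line_def velocity_eq[OF I(1)] velocity_eq[OF I(2)] using B2 B_def by blast
    show "tangent_line X a \<inter> tangent_line X b \<subseteq> {B}"
    proof
      fix p assume "p \<in> tangent_line X a \<inter> tangent_line X b"
      then obtain c' d' where p: "p = X a + c' *\<^sub>R X1 a" "p = X b + d' *\<^sub>R X1 b"
        unfolding tangent_line_def velocity_eq[OF I(1)] velocity_eq[OF I(2)] by blast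
      then have "p - B = (c' - c) *\<^sub>R X1 a" "p - B = (d' - d) *\<^sub>R X1 b"
        by (simp add: B_def algebra_simps, simp add: p(2) B2 algebra_simps)
      then have "(c' - c) * dt (X1 a) (X1 b) = dt ((d' - d) *\<^sub>R X1 b) (X1 b)"
        by (metis dt_simps(5))
      then have "c' = c" using dab by simp
      then show "p \<in> {B}" using p by (simp add: B_def)
    qed
  qed
  then have the: "(THE B. tangent_line X a \<inter> tangent_line X b = {B}) = B"
    by (simp add: the_equality)
  have "dt (X a - B) (X b - B) = dt (- c *\<^sub>R X1 a) (L *\<^sub>R tangent t - c *\<^sub>R X1 a)"
    using chord by (simp add: B_def algebra_simps)
  also have "\<dots> = - c * L * dt (X1 a) (tangent t)" by (simp add: algebra_simps)
  also have "dt (X1 a) (tangent t) = - (X1 a \<bullet> normal t)"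
    using dt_swap[of "X1 a" "tangent t"] by (simp add: dt_tangent)
  finally have area: "dt (X a - B) (X b - B) = - (L\<^sup>2 / D)"
    using na D by (simp add: c_def power2_eq_square)
  have "compact (convex hull {B, X a, X b})"
    by (intro finite_imp_compact_convex_hull) auto
  then have "measure lebesgue (convex hull {B, X a, X b}) = measure lborel (convex hull {B, X a, X b})"
    by (simp add: borel_compact)
  also have "\<dots> = \<bar>dt (X a - B) (X b - B)\<bar> / 2"
    using content_triangle[of B "X a" "X b"] sg
    by (auto simp: dt_def cross2_def abs_minus_commute algebra_simps)
  also have "\<dots> = L\<^sup>2 / (2 * D)" unfolding area using D by (simp add: abs_mult)
  finally show ?thesis unfolding the L_def D_def .
qed

section \<open>The two areas as functions of the height\<close>

lemma X2_inner_normal: "X2 t \<bullet> normal t = dt (X1 t) (X2 t) / norm (X1 t)"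
  by (simp add: inner_normal)

text \<open>To second order the height is \<open>\<kappa> x\<^sup>2 / 2\<close> and the slope is \<open>\<kappa> x\<close>; the limit is \<open>1 / (2 \<kappa>)\<close> with
  \<open>\<kappa> = dt X' X'' / (norm X')\<^sup>3\<close>.\<close>

lemma height_over_slope_squared:
  assumes t: "t \<in> I"
  shows "((\<lambda>s. ht t s / (X1 s \<bullet> normal t / (X1 s \<bullet> tangent t))\<^sup>2) \<longlongrightarrow>
    norm (X1 t) ^ 3 / (2 * dt (X1 t) (X2 t))) (at t)"
proof -
  define p where "p = (\<lambda>s. X1 s \<bullet> normal t / (X1 s \<bullet> tangent t))"
  define p' where "p' = (\<lambda>s. ((X2 s \<bullet> normal t) * (X1 s \<bullet> tangent t) -
     (X1 s \<bullet> normal t) * (X2 s \<bullet> tangent t)) / ((X1 s \<bullet> tangent t) * (X1 s \<bullet> tangent t)))"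
  obtain a0 b0 where ab: "a0 < t" "t < b0" "{a0..b0} \<subseteq> I"
    and Tpos: "\<And>s. s \<in> {a0..b0} \<Longrightarrow> X1 s \<bullet> tangent t > 0"
    and Npos: "\<And>s. t < s \<Longrightarrow> s \<le> b0 \<Longrightarrow> X1 s \<bullet> normal t > 0"
    and Nneg: "\<And>s. a0 \<le> s \<Longrightarrow> s < t \<Longrightarrow> X1 s \<bullet> normal t < 0"
    using local_chart[OF t] by blast
  have ev: "\<forall>\<^sub>F s in at t. s \<in> {a0<..<b0} \<and> s \<noteq> t"
    using ab by (intro eventually_conj eventually_at_in_open') (auto simp: eventually_at_filter)
  have nT: "X1 t \<bullet> tangent t = norm (X1 t)" and pos: "norm (X1 t) > 0"
    using t X1_nz by (simp_all add: tangent_inner_X1)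
  define w where "w = dt (X1 t) (X2 t)"
  have w: "w > 0" using curved[OF t] by (simp add: w_def dt_def)
  have cX: "((\<lambda>s. X1 s \<bullet> v) \<longlongrightarrow> X1 t \<bullet> v) (at t)" "((\<lambda>s. X2 s \<bullet> v) \<longlongrightarrow> X2 t \<bullet> v) (at t)" for v
    using cont_X1[OF t] cont_X2[OF t] by (auto simp: isCont_def intro!: tendsto_intros)
  have limp': "(p' \<longlongrightarrow> w / (norm (X1 t))\<^sup>2) (at t)"
  proof -
    have "(p' \<longlongrightarrow> ((X2 t \<bullet> normal t) * (X1 t \<bullet> tangent t) -
       (X1 t \<bullet> normal t) * (X2 t \<bullet> tangent t)) / ((X1 t \<bullet> tangent t) * (X1 t \<bullet> tangent t))) (at t)"
      unfolding p'_def by (intro tendsto_intros cX) (use nT pos in auto)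
    then show ?thesis
      using pos by (simp add: normal_inner_X1 nT X2_inner_normal w_def power2_eq_square)
  qed
  have p_ne: "p s \<noteq> 0" and dp: "(p has_real_derivative p' s) (at s)"
    and dh: "(ht t has_real_derivative X1 s \<bullet> normal t) (at s)"
    if "s \<in> {a0<..<b0}" "s \<noteq> t" for s
  proof -
    have s: "s \<in> {a0..b0}" "s \<in> I" using that ab by auto
    show "p s \<noteq> 0"
      using Npos[of s] Nneg[of s] Tpos[OF s(1)] that by (auto simp: p_def neq_iff)
    show "(p has_real_derivative p' s) (at s)"
      unfolding p_def p'_def
      by (rule DERIV_divide[OF inner_has_derivative[OF X1_deriv[OF s(2)]] inner_has_derivative[OF X1_deriv[OF s(2)]]])
        (use Tpos[OF s(1)] in auto)
    show "(ht t has_real_derivative X1 s \<bullet> normal t) (at s)" by (rule ht_deriv[OF s(2)])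
  qed
  have "w / (norm (X1 t))\<^sup>2 > 0" using w pos by simp
  then have evp': "\<forall>\<^sub>F s in at t. p' s > 0" using order_tendstoD(1)[OF limp'] by blast
  have "((\<lambda>s. ht t s / (p s)\<^sup>2) \<longlongrightarrow> norm (X1 t) / (2 * (w / (norm (X1 t))\<^sup>2))) (at t)"
  proof (rule lhopital[of "ht t" t "\<lambda>s. (p s)\<^sup>2" "\<lambda>s. 2 * p s * p' s" "\<lambda>s. X1 s \<bullet> normal t"])
    show "(ht t \<longlongrightarrow> 0) (at t)"
      using DERIV_isCont[OF ht_deriv[OF t, of t]] by (simp add: isCont_def)
    have "(p \<longlongrightarrow> X1 t \<bullet> normal t / (X1 t \<bullet> tangent t)) (at t)"
      unfolding p_def by (intro tendsto_intros cX) (use nT pos in auto)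
    then have "(p \<longlongrightarrow> 0) (at t)" by (simp add: normal_inner_X1)
    then show "((\<lambda>s. (p s)\<^sup>2) \<longlongrightarrow> 0) (at t)" using tendsto_power[of p 0 _ 2] by simp
    show "\<forall>\<^sub>F s in at t. (p s)\<^sup>2 \<noteq> 0" using ev by eventually_elim (use p_ne in auto)
    show "\<forall>\<^sub>F s in at t. 2 * p s * p' s \<noteq> 0" using ev evp' by eventually_elim (use p_ne in auto)
    show "\<forall>\<^sub>F s in at t. (ht t has_real_derivative X1 s \<bullet> normal t) (at s)"
      using ev by eventually_elim (use dh in auto)
    show "\<forall>\<^sub>F s in at t. ((\<lambda>s. (p s)\<^sup>2) has_real_derivative 2 * p s * p' s) (at s)"
      using ev
    proof eventually_elim
      case (elim s)
      then show ?case using DERIV_power[OF dp, of s 2] by (simp add: algebra_simps)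
    qed
    have "((\<lambda>s. (X1 s \<bullet> tangent t) / (2 * p' s)) \<longlongrightarrow> norm (X1 t) / (2 * (w / (norm (X1 t))\<^sup>2))) (at t)"
      using cX(1)[of "tangent t"] limp' w pos unfolding nT by (intro tendsto_intros) auto
    moreover have "\<forall>\<^sub>F s in at t. (X1 s \<bullet> tangent t) / (2 * p' s) = (X1 s \<bullet> normal t) / (2 * p s * p' s)"
      using ev evp'
    proof eventually_elim
      case (elim s)
      then have "X1 s \<bullet> tangent t > 0" using Tpos[of s] by auto
      then show ?case using p_ne[of s] elim by (simp add: p_def field_simps)
    qed
    ultimately show "((\<lambda>s. (X1 s \<bullet> normal t) / (2 * p s * p' s)) \<longlongrightarrow> norm (X1 t) / (2 * (w / (norm (X1 t))\<^sup>2))) (at t)"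
      by (rule Lim_transform_eventually)
  qed
  moreover have "norm (X1 t) / (2 * (w / (norm (X1 t))\<^sup>2)) = norm (X1 t) ^ 3 / (2 * w)"
    by (simp add: power2_eq_square power3_eq_cube)
  ultimately show ?thesis unfolding p_def w_def by (simp only:)
qed

text \<open>The chord length \<open>L\<close> as a function of the height, with its derivative \<open>L'\<close>, and the two areas
  expressed by them.\<close>

lemma cap_data:
  assumes t: "t \<in> I"
  obtains h1 a b L L' where "0 < h1"
    and "\<And>h. 0 < h \<Longrightarrow> h < h1 \<Longrightarrow> a h \<in> I \<and> b h \<in> I \<and> a h < t \<and> t < b h \<and> ht t (a h) = h \<and> ht t (b h) = h"
    and "(a \<longlongrightarrow> t) (at_right 0)" "(b \<longlongrightarrow> t) (at_right 0)"
    and "\<And>h. 0 < h \<Longrightarrow> h < h1 \<Longrightarrow> L h = wd t (b h) - wd t (a h) \<and> L h > 0 \<and> L' h > 0"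
    and "\<And>h. 0 < h \<Longrightarrow> h < h1 \<Longrightarrow> (S_area X I t has_real_derivative L h) (at h)"
    and "(S_area X I t \<longlongrightarrow> 0) (at_right 0)"
    and "\<And>h. 0 < h \<Longrightarrow> h < h1 \<Longrightarrow> (L has_real_derivative L' h) (at h)"
    and "(L \<longlongrightarrow> 0) (at_right 0)"
    and "\<And>h. 0 < h \<Longrightarrow> h < h1 \<Longrightarrow> V_area X I t h = (L h)\<^sup>2 / (2 * L' h)"
    and "((\<lambda>h. L' h * sqrt h) \<longlongrightarrow> 2 * sqrt (norm (X1 t) ^ 3 / (2 * dt (X1 t) (X2 t)))) (at_right 0)"
proof -
  show ?thesis
  proof (rule chord_functions[OF t])
    fix h1 :: real and a b :: "real \<Rightarrow> real"
    assume h1: "0 < h1"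
      and ab0: "a 0 = t" "b 0 = t"
      and cont: "continuous_on {0..h1} a" "continuous_on {0..h1} b"
      and mono: "strict_antimono_on {0..h1} a" "strict_mono_on {0..h1} b"
      and ht: "\<And>h. h \<in> {0..h1} \<Longrightarrow> ht t (a h) = h \<and> ht t (b h) = h"
      and da: "\<And>h. 0 < h \<Longrightarrow> h < h1 \<Longrightarrow> (a has_real_derivative 1 / (X1 (a h) \<bullet> normal t)) (at h)"
      and db: "\<And>h. 0 < h \<Longrightarrow> h < h1 \<Longrightarrow> (b has_real_derivative 1 / (X1 (b h) \<bullet> normal t)) (at h)"
      and sub: "{a h1..b h1} \<subseteq> I"
      and Tpos: "\<And>s. s \<in> {a h1..b h1} \<Longrightarrow> X1 s \<bullet> tangent t > 0"
      and Npos: "\<And>s. t < s \<Longrightarrow> s \<le> b h1 \<Longrightarrow> X1 s \<bullet> normal t > 0"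
      and Nneg: "\<And>s. a h1 \<le> s \<Longrightarrow> s < t \<Longrightarrow> X1 s \<bullet> normal t < 0"
      and only: "\<And>h s. s \<in> I \<Longrightarrow> 0 \<le> h \<Longrightarrow> h < h1 \<Longrightarrow> ht t s = h \<Longrightarrow> s = a h \<or> s = b h"
    note fr = frame[OF t]
    have mono': "a k \<le> a j" "b j \<le> b k" if "0 \<le> j" "j \<le> k" "k \<le> h1" for j k
      using monotone_onD[OF mono(1), of j k] monotone_onD[OF mono(2), of j k] that
      by (cases "j = k"; simp)+
    have lt: "a h < t" "t < b h" if "0 < h" "h \<le> h1" for h
      using monotone_onD[OF mono(1), of 0 h] monotone_onD[OF mono(2), of 0 h] that ab0 by auto
    have rng: "a h \<in> {a h1..b h1}" "b h \<in> {a h1..b h1}" if "0 \<le> h" "h \<le> h1" for h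
      using mono'[of h h1] mono'[of 0 h] that ab0 by auto
    then have inI: "a h \<in> I" "b h \<in> I" if "0 \<le> h" "h \<le> h1" for h using sub that by blast+
    have wdcont: "continuous_on {a h1..b h1} (wd t)"
      using wd_deriv sub by (meson DERIV_isCont continuous_at_imp_continuous_on subsetD)
    have wdmono: "wd t r < wd t s" if "r < s" "r \<in> {a h1..b h1}" "s \<in> {a h1..b h1}" for r s
    proof (rule DERIV_pos_imp_increasing[OF that(1)])
      fix z assume "r \<le> z" "z \<le> s"
      then have "z \<in> {a h1..b h1}" using that by auto
      then show "\<exists>D. (wd t has_real_derivative D) (at z) \<and> 0 < D"
        using wd_deriv[of z t] sub Tpos[of z] by blast
    qed
    define \<alpha> where "\<alpha> = (\<lambda>y. wd t (a y))"
    define \<beta> where "\<beta> = (\<lambda>y. wd t (b y))"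
    define L where "L = (\<lambda>h. \<beta> h - \<alpha> h)"
    define L' where "L' = (\<lambda>h. X1 (b h) \<bullet> tangent t / (X1 (b h) \<bullet> normal t) - X1 (a h) \<bullet> tangent t / (X1 (a h) \<bullet> normal t))"
    have c\<alpha>: "continuous_on {0..h1} \<alpha>" and c\<beta>: "continuous_on {0..h1} \<beta>"
      unfolding \<alpha>_def \<beta>_def
      by (rule continuous_on_compose2[OF wdcont]; use cont rng in force)+
    have zero: "\<alpha> 0 = 0" "\<beta> 0 = 0" by (simp_all add: \<alpha>_def \<beta>_def ab0)
    have wdle: "wd t r \<le> wd t s" if "r \<le> s" "r \<in> {a h1..b h1}" "s \<in> {a h1..b h1}" for r s
      using wdmono[of r s] that by (cases "r = s") auto
    have m\<alpha>: "antimono_on {0..h1} \<alpha>" and m\<beta>: "mono_on {0..h1} \<beta>"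
      unfolding \<alpha>_def \<beta>_def by (intro monotone_onI wdle mono' rng; simp)+
    have Lpos: "L h > 0" if "0 < h" "h \<le> h1" for h
      using wdmono[of "a h" "b h"] lt[OF that] rng[of h] that by (simp add: L_def \<alpha>_def \<beta>_def)
    have Nb: "X1 (b h) \<bullet> normal t > 0" and Na: "X1 (a h) \<bullet> normal t < 0"
      and Tb: "X1 (b h) \<bullet> tangent t > 0" and Ta: "X1 (a h) \<bullet> tangent t > 0"
      if "0 < h" "h \<le> h1" for h
      using Npos[of "b h"] Nneg[of "a h"] Tpos[of "a h"] Tpos[of "b h"] lt[OF that] rng[of h] that by auto
    have L'pos: "L' h > 0" if "0 < h" "h \<le> h1" for h
    proof -
      have "X1 (a h) \<bullet> tangent t / (X1 (a h) \<bullet> normal t) < 0" "X1 (b h) \<bullet> tangent t / (X1 (b h) \<bullet> normal t) > 0"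
        using Na[OF that] Nb[OF that] Ta[OF that] Tb[OF that] by (auto simp: divide_pos_neg)
      then show ?thesis unfolding L'_def by linarith
    qed
    have d\<alpha>: "(\<alpha> has_real_derivative X1 (a h) \<bullet> tangent t / (X1 (a h) \<bullet> normal t)) (at h)"
      and d\<beta>: "(\<beta> has_real_derivative X1 (b h) \<bullet> tangent t / (X1 (b h) \<bullet> normal t)) (at h)"
      if h: "0 < h" "h < h1" for h
      using DERIV_chain2[OF wd_deriv[OF inI(1)] da[OF h], of t] DERIV_chain2[OF wd_deriv[OF inI(2)] db[OF h], of t] h
      by (simp_all add: \<alpha>_def \<beta>_def)
    have lim0: "(f \<longlongrightarrow> f 0) (at_right 0)" if "continuous_on {0..h1} f" for f :: "real \<Rightarrow> real"
      using that h1 continuous_on_Icc_at_rightD by blast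
    have chord: "chord_params X I t h = (a h, b h)" if h: "0 < h" "h < h1" for h
    proof (rule chord_params_eq[OF t])
      show "a h \<in> I" "b h \<in> I" "a h < b h" using inI[of h] lt[of h] h by auto
      show "ht t s = h \<longleftrightarrow> s = a h \<or> s = b h" if "s \<in> I" for s
        using only[OF that, of h] ht[of h] h by auto
    qed
    have S: "S_area X I t h = measure lebesgue (cap (X t) (tangent t) (normal t) \<alpha> \<beta> h)"
      if h: "0 < h" "h < h1" for h
    proof -
      have bd: "X ` {a h..b h} \<union> closed_segment (X (a h)) (X (b h)) =
         cap_boundary (X t) (tangent t) (normal t) \<alpha> \<beta> h"
        unfolding \<alpha>_def \<beta>_def
        by (rule cap_boundary_eq_curve_chord[OF t _ _ ab0 cont mono ht])
          (use h Lpos[of h] in \<open>auto simp: L_def \<alpha>_def \<beta>_def\<close>)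
      have sub: "{0..h} \<subseteq> {0..h1}" using h by auto
      have "inside (cap_boundary (X t) (tangent t) (normal t) \<alpha> \<beta> h) =
        cap (X t) (tangent t) (normal t) \<alpha> \<beta> h"
        by (rule inside_cap_boundary[OF fr h(1) continuous_on_subset[OF c\<alpha> sub]
            continuous_on_subset[OF c\<beta> sub] monotone_on_subset[OF m\<alpha> sub]
            monotone_on_subset[OF m\<beta> sub] zero])
      then show ?thesis by (simp add: S_area_def chord[OF h] bd)
    qed
    note capS = measure_cap_tendsto_0_and_DERIV[where Q = "X t", OF fr h1 c\<alpha> c\<beta> m\<alpha> m\<beta> zero]
    have ev: "\<forall>\<^sub>F h in at_right 0. h \<in> {0<..<h1}" using eventually_at_right_real[OF h1] .
    show ?thesis
    proof (rule that[of h1 a b L L'])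
      show "0 < h1" by fact
      show "a h \<in> I \<and> b h \<in> I \<and> a h < t \<and> t < b h \<and> ht t (a h) = h \<and> ht t (b h) = h"
        if "0 < h" "h < h1" for h
        using inI[of h] lt[of h] ht[of h] that by auto
      show la: "(a \<longlongrightarrow> t) (at_right 0)" and lb: "(b \<longlongrightarrow> t) (at_right 0)"
        using lim0[OF cont(1)] lim0[OF cont(2)] ab0 by simp_all
      show "L h = wd t (b h) - wd t (a h) \<and> L h > 0 \<and> L' h > 0" if "0 < h" "h < h1" for h
        using Lpos[of h] L'pos[of h] that by (auto simp: L_def \<alpha>_def \<beta>_def)
      show "(S_area X I t has_real_derivative L h) (at h)" if h: "0 < h" "h < h1" for h
      proof -
        have "((\<lambda>h. measure lebesgue (cap (X t) (tangent t) (normal t) \<alpha> \<beta> h)) has_real_derivative L h) (at h)"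
          using capS(2)[OF h] by (simp add: L_def)
        then show ?thesis
          by (rule has_field_derivative_transform_within_open[of _ _ _ "{0<..<h1}"]) (use h S in auto)
      qed
      have "\<forall>\<^sub>F h in at_right 0. measure lebesgue (cap (X t) (tangent t) (normal t) \<alpha> \<beta> h) = S_area X I t h"
        using ev by eventually_elim (use S in auto)
      with capS(1) show "(S_area X I t \<longlongrightarrow> 0) (at_right 0)" by (rule Lim_transform_eventually)
      show "(L has_real_derivative L' h) (at h)" if h: "0 < h" "h < h1" for h
        unfolding L_def L'_def by (rule DERIV_diff[OF d\<beta>[OF h] d\<alpha>[OF h]])
      show "(L \<longlongrightarrow> 0) (at_right 0)"
        using tendsto_diff[OF lim0[OF c\<beta>] lim0[OF c\<alpha>]] zero by (simp add: L_def)
      show "V_area X I t h = (L h)\<^sup>2 / (2 * L' h)" if h: "0 < h" "h < h1" for h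
      proof -
        have h': "0 \<le> h" "h \<le> h1" "h \<in> {0..h1}" using h by auto
        have "wd t (a h) < wd t (b h)" using Lpos[of h] h by (simp add: L_def \<alpha>_def \<beta>_def)
        then show ?thesis
          using tangent_triangle_area[OF t inI(1)[OF h'(1,2)] inI(2)[OF h'(1,2)] _ _
              Na[OF h(1) h'(2)] Nb[OF h(1) h'(2)] Ta[OF h(1) h'(2)] Tb[OF h(1) h'(2)]] ht[OF h'(3)]
          by (simp add: V_area_def chord[OF h] Let_def L_def L'_def \<alpha>_def \<beta>_def)
      qed
      define M where "M = norm (X1 t) ^ 3 / (2 * dt (X1 t) (X2 t))"
      define p where "p = (\<lambda>s. X1 s \<bullet> normal t / (X1 s \<bullet> tangent t))"
      have hs: "((\<lambda>s. ht t s / (p s)\<^sup>2) \<longlongrightarrow> M) (at t)"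
        using height_over_slope_squared[OF t] by (simp add: M_def p_def)
      have fa: "filterlim a (at t) (at_right 0)" and fb: "filterlim b (at t) (at_right 0)"
      proof -
        have "\<forall>\<^sub>F h in at_right 0. a h \<noteq> t" "\<forall>\<^sub>F h in at_right 0. b h \<noteq> t"
          using ev by (eventually_elim, use lt in force)+
        then show "filterlim a (at t) (at_right 0)" "filterlim b (at t) (at_right 0)"
          using la lb by (simp_all add: filterlim_at)
      qed
      have sa: "((\<lambda>h. sqrt (ht t (a h) / (p (a h))\<^sup>2)) \<longlongrightarrow> sqrt M) (at_right 0)"
        and sb: "((\<lambda>h. sqrt (ht t (b h) / (p (b h))\<^sup>2)) \<longlongrightarrow> sqrt M) (at_right 0)"
        using tendsto_real_sqrt[OF filterlim_compose[OF hs fa]]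
          tendsto_real_sqrt[OF filterlim_compose[OF hs fb]] by simp_all
      have "\<forall>\<^sub>F h in at_right 0. sqrt (ht t (b h) / (p (b h))\<^sup>2) + sqrt (ht t (a h) / (p (a h))\<^sup>2) = L' h * sqrt h"
        using ev
      proof eventually_elim
        case (elim h)
        then have h: "0 < h" "h \<le> h1" "h \<in> {0..h1}" by auto
        have "p (b h) > 0" "p (a h) < 0"
          using Na[OF h(1,2)] Nb[OF h(1,2)] Ta[OF h(1,2)] Tb[OF h(1,2)] by (auto simp: p_def divide_neg_pos)
        then have "sqrt (h / (p (b h))\<^sup>2) + sqrt (h / (p (a h))\<^sup>2) = (1 / p (b h) - 1 / p (a h)) * sqrt h"
          by (simp add: real_sqrt_divide algebra_simps)
        then show ?case using ht[OF h(3)] by (simp add: L'_def p_def)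
      qed
      with tendsto_add[OF sb sa] have "((\<lambda>h. L' h * sqrt h) \<longlongrightarrow> sqrt M + sqrt M) (at_right 0)"
        by (rule Lim_transform_eventually)
      then show "((\<lambda>h. L' h * sqrt h) \<longlongrightarrow> 2 * sqrt (norm (X1 t) ^ 3 / (2 * dt (X1 t) (X2 t)))) (at_right 0)"
        by (simp add: M_def)
    qed
  qed
qed

section \<open>From proportional areas to the factor two thirds\<close>

text \<open>The area law with factor two thirds at every point, for heights below a bound that depends on the point.\<close>

definition two_thirds_law :: bool where
  "two_thirds_law \<longleftrightarrow> (\<forall>t\<in>I. \<exists>h0>0. \<forall>h. 0 < h \<and> h < h0 \<longrightarrow> S_area X I t h = 2 / 3 * V_area X I t h)"

lemma dt12_pos: "s \<in> I \<Longrightarrow> dt (X1 s) (X2 s) > 0"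
  using curved by (simp add: dt_def)

text \<open>The ratio of the two areas tends to \<open>2 / 3\<close> at every point, so no other factor is possible.\<close>

lemma proportional_imp_law:
  assumes "\<forall>t\<in>I. \<exists>h0>0. \<forall>h. 0 < h \<and> h < h0 \<longrightarrow> S_area X I t h = lam (X t) * V_area X I t h"
  shows two_thirds_law
  unfolding two_thirds_law_def
proof
  fix t assume t: "t \<in> I"
  then obtain h0 where h0: "h0 > 0" "\<And>h. 0 < h \<Longrightarrow> h < h0 \<Longrightarrow> S_area X I t h = lam (X t) * V_area X I t h"
    using assms by meson
  have "lam (X t) = 2 / 3"
  proof (rule cap_data[OF t])
    fix h1 a b L L'
    assume h1: "(0::real) < h1"
      and L: "\<And>h. 0 < h \<Longrightarrow> h < h1 \<Longrightarrow> L h = wd t (b h) - wd t (a h) \<and> L h > 0 \<and> L' h > 0"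
      and S: "\<And>h. 0 < h \<Longrightarrow> h < h1 \<Longrightarrow> (S_area X I t has_real_derivative L h) (at h)"
         "(S_area X I t \<longlongrightarrow> 0) (at_right 0)"
      and dL: "\<And>h. 0 < h \<Longrightarrow> h < h1 \<Longrightarrow> (L has_real_derivative L' h) (at h)" "(L \<longlongrightarrow> 0) (at_right 0)"
      and V: "\<And>h. 0 < h \<Longrightarrow> h < h1 \<Longrightarrow> V_area X I t h = (L h)\<^sup>2 / (2 * L' h)"
      and lim: "((\<lambda>h. L' h * sqrt h) \<longlongrightarrow> 2 * sqrt (norm (X1 t) ^ 3 / (2 * dt (X1 t) (X2 t)))) (at_right 0)"
    have "norm (X1 t) ^ 3 / (2 * dt (X1 t) (X2 t)) > 0"
      using X1_nz[OF t] dt12_pos[OF t] by simp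
    then have m: "2 * sqrt (norm (X1 t) ^ 3 / (2 * dt (X1 t) (X2 t))) > 0" by simp
    have "((\<lambda>h. S_area X I t h / ((L h)\<^sup>2 / (2 * L' h))) \<longlongrightarrow> 2 / 3) (at_right 0)"
      by (rule area_ratio_tendsto[OF h1 _ S(2) _ dL(2) lim m]) (use S(1) dL(1) in auto)
    moreover have "\<forall>\<^sub>F h in at_right 0. S_area X I t h / ((L h)\<^sup>2 / (2 * L' h)) = lam (X t)"
    proof -
      have "0 < min h0 h1" using h0 h1 by simp
      from eventually_at_right_real[OF this] show ?thesis
      proof eventually_elim
        case (elim h)
        then have h: "0 < h" "h < h0" "h < h1" by auto
        have "(L h)\<^sup>2 / (2 * L' h) \<noteq> 0" using L[OF h(1,3)] by simp
        then show ?case using h0(2)[OF h(1,2)] V[OF h(1,3)] by simp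
      qed
    qed
    ultimately have "((\<lambda>_. lam (X t)) \<longlongrightarrow> 2 / 3) (at_right (0::real))"
      by (rule Lim_transform_eventually)
    then show ?thesis by (simp add: tendsto_const_iff)
  qed
  then show "\<exists>h0>0. \<forall>h. 0 < h \<and> h < h0 \<longrightarrow> S_area X I t h = 2 / 3 * V_area X I t h"
    using h0 by auto
qed

section \<open>Parabolas satisfy the area law\<close>

text \<open>On a parabola the height above a tangent line is a multiple of the square of the parameter
  difference, so that the end points of a chord have opposite parameter differences.\<close>

lemma parabola_imp_law:
  assumes "open_part_of_parabola (X ` I)"
  shows two_thirds_law
proof -
  obtain \<Gamma> where G: "parabola \<Gamma>" "openin (top_of_set \<Gamma>) (X ` I)"
    using assms unfolding open_part_of_parabola_def by blast
  obtain p v e where ve: "cross2 v e \<noteq> 0" and \<Gamma>: "\<Gamma> = {p + u *\<^sub>R v + u\<^sup>2 *\<^sub>R e | u. True}"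
    by (rule parabola_imp_parametrization[OF G(1)])
  have dve: "dt v e \<noteq> 0" using ve sg by (auto simp: dt_def)
  define u where "u = (\<lambda>s. dt (X s - p) e / dt v e)"
  have X_eq: "X s = p + u s *\<^sub>R v + (u s)\<^sup>2 *\<^sub>R e" if "s \<in> I" for s
  proof -
    have "X s \<in> \<Gamma>" using openin_imp_subset[OF G(2)] that by blast
    then obtain c where c: "X s = p + c *\<^sub>R v + c\<^sup>2 *\<^sub>R e" unfolding \<Gamma> by blast
    then have "dt (X s - p) e = c * dt v e" by simp
    then have "u s = c" using dve by (simp add: u_def)
    then show ?thesis using c by simp
  qed
  show ?thesis
    unfolding two_thirds_law_def
  proof
    fix t assume t: "t \<in> I"
    define u' where "u' = dt (X1 t) e / dt v e"
    define w where "w = v + (2 * u t) *\<^sub>R e"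
    have du: "(u has_real_derivative u') (at t)"
      unfolding u_def u'_def by (intro DERIV_cdivide dt_left_derivative X_diff_deriv t)
    have "((\<lambda>s. p + (u s *\<^sub>R v + (u s * u s) *\<^sub>R e)) has_vector_derivative
        0 + ((u t *\<^sub>R 0 + u' *\<^sub>R v) + ((u t * u t) *\<^sub>R 0 + (u t * u' + u' * u t) *\<^sub>R e))) (at t)"
      by (intro has_vector_derivative_add has_vector_derivative_scaleR du
          has_vector_derivative_const DERIV_mult')
    moreover have "0 + ((u t *\<^sub>R 0 + u' *\<^sub>R v) + ((u t * u t) *\<^sub>R 0 + (u t * u' + u' * u t) *\<^sub>R e)) = u' *\<^sub>R w"
      by (simp add: w_def algebra_simps)
    ultimately have "((\<lambda>s. p + (u s *\<^sub>R v + (u s * u s) *\<^sub>R e)) has_vector_derivative u' *\<^sub>R w) (at t)"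
      by (simp only:)
    then have "(X has_vector_derivative u' *\<^sub>R w) (at t)"
      by (rule has_vector_derivative_transform_within_open[OF _ open_I t])
        (use X_eq in \<open>simp add: power2_eq_square add.assoc\<close>)
    then have X1w: "X1 t = u' *\<^sub>R w" using X_deriv[OF t] vector_derivative_unique_at by blast
    have wn: "w \<bullet> normal t = 0"
    proof -
      have "u' * (w \<bullet> normal t) = 0" using normal_inner_X1[of t] X1w by simp
      moreover have "u' \<noteq> 0" using X1w X1_nz[OF t] by auto
      ultimately show ?thesis by simp
    qed
    have Xd: "X s - X t = (u s - u t) *\<^sub>R w + (u s - u t)\<^sup>2 *\<^sub>R e" if "s \<in> I" for s
      unfolding X_eq[OF that] X_eq[OF t] w_def
      by (simp add: vec_eq_iff power2_eq_square algebra_simps)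
    define m where "m = e \<bullet> normal t"
    have hts: "ht t s = (u s - u t)\<^sup>2 * m" if "s \<in> I" for s
      unfolding ht_def Xd[OF that] by (simp add: inner_add_left wn m_def)
    have wds: "wd t s = (u s - u t) * (w \<bullet> tangent t) + (u s - u t)\<^sup>2 * (e \<bullet> tangent t)" if "s \<in> I" for s
      unfolding wd_def Xd[OF that] by (simp add: inner_add_left)
    show "\<exists>h0>0. \<forall>h. 0 < h \<and> h < h0 \<longrightarrow> S_area X I t h = 2 / 3 * V_area X I t h"
    proof (rule cap_data[OF t])
      fix h1 a b L L'
      assume h1: "(0::real) < h1"
        and ab: "\<And>h. 0 < h \<Longrightarrow> h < h1 \<Longrightarrow> a h \<in> I \<and> b h \<in> I \<and> a h < t \<and> t < b h \<and> ht t (a h) = h \<and> ht t (b h) = h"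
        and L: "\<And>h. 0 < h \<Longrightarrow> h < h1 \<Longrightarrow> L h = wd t (b h) - wd t (a h) \<and> L h > 0 \<and> L' h > 0"
        and S: "\<And>h. 0 < h \<Longrightarrow> h < h1 \<Longrightarrow> (S_area X I t has_real_derivative L h) (at h)"
           "(S_area X I t \<longlongrightarrow> 0) (at_right 0)"
        and dL: "\<And>h. 0 < h \<Longrightarrow> h < h1 \<Longrightarrow> (L has_real_derivative L' h) (at h)" "(L \<longlongrightarrow> 0) (at_right 0)"
        and V: "\<And>h. 0 < h \<Longrightarrow> h < h1 \<Longrightarrow> V_area X I t h = (L h)\<^sup>2 / (2 * L' h)"
      have L2: "(L h)\<^sup>2 = (4 * (w \<bullet> tangent t)\<^sup>2 / m) * h" if h: "0 < h" "h < h1" for h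
      proof -
        note abh = ab[OF h]
        define x where "x = u (a h) - u t"
        define y where "y = u (b h) - u t"
        have xm: "x\<^sup>2 * m = h" and ym: "y\<^sup>2 * m = h" using abh hts by (auto simp: x_def y_def)
        have m: "m \<noteq> 0" using xm h by auto
        have xy2: "x\<^sup>2 = y\<^sup>2" using xm ym m mult_right_cancel[of m "x\<^sup>2" "y\<^sup>2"] by simp
        have "x \<noteq> y"
        proof
          assume "x = y"
          then have "X (a h) = X (b h)" using X_eq abh by (simp add: x_def y_def)
          then have "a h = b h" using abh by (intro inj_onD[OF inj_X]) simp_all
          then show False using abh by simp
        qed
        \<comment> \<open>The terms quadratic in the parameter difference cancel in the chord length.\<close>
        then have "x = - y" using xy2 by (simp add: power2_eq_iff)
        then have "L h = 2 * y * (w \<bullet> tangent t)"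
          using L[OF h] wds[of "a h"] wds[of "b h"] abh xy2 unfolding x_def[symmetric] y_def[symmetric]
          by (simp add: x_def[symmetric] y_def[symmetric] algebra_simps)
        then have "(L h)\<^sup>2 = 4 * (w \<bullet> tangent t)\<^sup>2 * y\<^sup>2" by (simp add: power_mult_distrib)
        also have "y\<^sup>2 = h / m" using ym m by (simp add: field_simps)
        finally show ?thesis by simp
      qed
      have "S_area X I t h = 2 / 3 * V_area X I t h" if h: "0 < h" "h < h1" for h
        unfolding V[OF h]
      proof (rule archimedes_ratio[OF h1 _ S(2) _ dL(2) _ _ h])
        fix k assume k: "0 < k" "k < h1"
        show "(S_area X I t has_real_derivative L k) (at k)" "(L has_real_derivative L' k) (at k)"
          "0 < L k" "(L k)\<^sup>2 = (4 * (w \<bullet> tangent t)\<^sup>2 / m) * k"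
          using S(1)[OF k] dL(1)[OF k] L[OF k] L2[OF k] by simp_all
      qed
      then show ?thesis using h1 by blast
    qed
  qed
qed

section \<open>Comparison with conics\<close>

lemma area_law_imp_chord_square_law:
  assumes t: "t \<in> I" and "h0 > 0"
    and eq: "\<And>h. 0 < h \<Longrightarrow> h < h0 \<Longrightarrow> S_area X I t h = 2 / 3 * V_area X I t h"
  obtains h1 a b where "0 < h1"
    "\<And>h. 0 < h \<Longrightarrow> h < h1 \<Longrightarrow> a h \<in> I \<and> b h \<in> I \<and> a h < t \<and> t < b h \<and> ht t (a h) = h \<and> ht t (b h) = h \<and>
      (wd t (b h) - wd t (a h))\<^sup>2 = 8 * (norm (X1 t) ^ 3 / dt (X1 t) (X2 t)) * h"
    "(a \<longlongrightarrow> t) (at_right 0)" "(b \<longlongrightarrow> t) (at_right 0)"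
proof (rule cap_data[OF t])
  fix h1 a b L L'
  assume h1: "(0::real) < h1"
    and ab: "\<And>h. 0 < h \<Longrightarrow> h < h1 \<Longrightarrow> a h \<in> I \<and> b h \<in> I \<and> a h < t \<and> t < b h \<and> ht t (a h) = h \<and> ht t (b h) = h"
    and lims: "(a \<longlongrightarrow> t) (at_right 0)" "(b \<longlongrightarrow> t) (at_right 0)"
    and L: "\<And>h. 0 < h \<Longrightarrow> h < h1 \<Longrightarrow> L h = wd t (b h) - wd t (a h) \<and> L h > 0 \<and> L' h > 0"
    and S: "\<And>h. 0 < h \<Longrightarrow> h < h1 \<Longrightarrow> (S_area X I t has_real_derivative L h) (at h)"
       "(S_area X I t \<longlongrightarrow> 0) (at_right 0)"
    and dL: "\<And>h. 0 < h \<Longrightarrow> h < h1 \<Longrightarrow> (L has_real_derivative L' h) (at h)" "(L \<longlongrightarrow> 0) (at_right 0)"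
    and V: "\<And>h. 0 < h \<Longrightarrow> h < h1 \<Longrightarrow> V_area X I t h = (L h)\<^sup>2 / (2 * L' h)"
    and lim: "((\<lambda>h. L' h * sqrt h) \<longlongrightarrow> 2 * sqrt (norm (X1 t) ^ 3 / (2 * dt (X1 t) (X2 t)))) (at_right 0)"
  define k where "k = min h0 h1"
  have k: "0 < k" "k \<le> h1" "k \<le> h0" using h1 assms(2) by (auto simp: k_def)
  have w: "dt (X1 t) (X2 t) > 0" using curved[OF t] by (simp add: dt_def)
  have "(L h)\<^sup>2 = 8 * (norm (X1 t) ^ 3 / dt (X1 t) (X2 t)) * h" if h: "0 < h" "h < k" for h
  proof -
    have "(L h)\<^sup>2 = 4 * (2 * sqrt (norm (X1 t) ^ 3 / (2 * dt (X1 t) (X2 t))))\<^sup>2 * h"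
    proof (rule square_chord_linear[of k "S_area X I t" L L', OF k(1) _ S(2) _ dL(2) lim _ _ _ h])
      fix h assume "0 < h" "h < k"
      then have h: "0 < h" "h < h1" "h < h0" using k by auto
      show "(S_area X I t has_real_derivative L h) (at h)" "(L has_real_derivative L' h) (at h)"
        "0 < L h" "0 < L' h" "S_area X I t h = 2 / 3 * ((L h)\<^sup>2 / (2 * L' h))"
        using S(1)[OF h(1,2)] dL(1)[OF h(1,2)] L[OF h(1,2)] V[OF h(1,2)] eq[OF h(1,3)] by auto
    qed
    then show ?thesis using w by (simp add: power_mult_distrib)
  qed
  then show ?thesis
    by (intro that[of k a b] lims k(1)) (use ab L k in force)
qed

text \<open>For a vector \<open>e\<close> transversal to the curve, the curve is locally a graph over the coordinate
  \<open>x = dt X e\<close> in the direction of \<open>e\<close>.  This is the value of \<open>(g'')\<^bsup>-2/3\<^esup>\<close> for the graph \<open>g\<close>, expressed by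
  the parameter of the curve.\<close>

definition chart_q :: "real^2 \<Rightarrow> real \<Rightarrow> real" where
  "chart_q e s = (dt (X1 s) e)\<^sup>2 * dt (X1 s) (X2 s) powr (-2/3)"

lemma chart_q_pos: "s \<in> I \<Longrightarrow> dt (X1 s) e > 0 \<Longrightarrow> chart_q e s > 0"
  using dt12_pos[of s] by (simp add: chart_q_def)

text \<open>With \<open>\<tau> = 1\<close>, the function \<open>chart_q e\<close> is not touched from above by a strictly concave quadratic
  polynomial of \<open>x\<close>; with \<open>\<tau> = -1\<close> it is not touched from below by a strictly convex one.\<close>

lemma no_conic_touching:
  assumes t: "t \<in> I" and "h0 > 0"
    and eq: "\<And>h. 0 < h \<Longrightarrow> h < h0 \<Longrightarrow> S_area X I t h = 2 / 3 * V_area X I t h"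
    and e: "dt (X1 t) e > 0" and \<tau>: "\<tau> = 1 \<or> \<tau> = -1" and C: "\<tau> * C < 0"
    and A: "A = chart_q e t" and D: "4 * A * C - B\<^sup>2 \<noteq> 0"
    and touch: "\<forall>\<^sub>F s in nhds t. \<tau> * (chart_q e s - (A + B * dt (X s - X t) e + C * (dt (X s - X t) e)\<^sup>2)) \<le> 0"
  shows False
proof -
  define u where "u = (\<lambda>s. dt (X s - X t) e)"
  define \<eta> where "\<eta> = (\<lambda>s. dt (X1 t) (X s - X t) / dt (X1 t) e)"
  define \<psi> where "\<psi> = (\<lambda>u. A + B * u + C * u\<^sup>2)"
  define xd where "xd = (\<lambda>s. dt (X1 s) e)"
  define \<omega> where "\<omega> = (\<lambda>s. dt (X1 s) (X2 s))"
  define p where "p = (\<lambda>s. dt (X1 t) (X1 s) / xd s / xd t)"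
  have \<omega>: "\<omega> s > 0" if "s \<in> I" for s using curved[OF that] by (simp add: \<omega>_def dt_def)
  have A0: "A > 0" using e \<omega>[OF t] by (simp add: A chart_q_def \<omega>_def)
  have xt: "xd t > 0" using e by (simp add: xd_def)
  have ut: "u t = 0" "\<eta> t = 0" "p t = 0" by (simp_all add: u_def \<eta>_def p_def)
  have du: "(u has_real_derivative xd s) (at s)" if "s \<in> I" for s
    unfolding u_def xd_def by (rule dt_left_derivative[OF X_diff_deriv[OF that]])
  have d\<eta>: "(\<eta> has_real_derivative p s * xd s) (at s)" if "s \<in> I" "xd s > 0" for s
  proof -
    have "((\<lambda>s. dt (X1 t) (X s - X t)) has_real_derivative dt (X1 t) (X1 s)) (at s)"
      using dt_has_derivative[of "\<lambda>_. X1 t" 0 s, OF _ X_diff_deriv[OF that(1)]] by simp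
    from DERIV_cdivide[OF this, of "dt (X1 t) e"] show ?thesis
      using that xt by (simp add: \<eta>_def p_def xd_def)
  qed
  have dp: "(p has_real_derivative xd s * chart_q e s powr (-3/2)) (at s)" if s: "s \<in> I" "xd s > 0" for s
  proof -
    have 1: "((\<lambda>s. dt (X1 t) (X1 s)) has_real_derivative dt (X1 t) (X2 s)) (at s)"
      using dt_has_derivative[of "\<lambda>_. X1 t" 0 s, OF _ X1_deriv[OF s(1)]] by simp
    have 2: "(xd has_real_derivative dt (X2 s) e) (at s)"
      unfolding xd_def by (rule dt_left_derivative[OF X1_deriv[OF s(1)]])
    have "(p has_real_derivative
      (dt (X1 t) (X2 s) * xd s - dt (X1 t) (X1 s) * dt (X2 s) e) / (xd s * xd s) / xd t) (at s)"
      unfolding p_def by (rule DERIV_cdivide[OF DERIV_divide[OF 1 2]]) (use s in auto)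
    moreover have "dt (X1 t) (X2 s) * xd s - dt (X1 t) (X1 s) * dt (X2 s) e = xd t * \<omega> s"
      unfolding xd_def \<omega>_def dt_def cross2_def by (simp add: algebra_simps)
    moreover have "xd t * \<omega> s / (xd s * xd s) / xd t = xd s * chart_q e s powr (-3/2)"
    proof -
      have "chart_q e s powr (-3/2) = ((xd s)\<^sup>2) powr (-3/2) * (\<omega> s powr (-2/3)) powr (-3/2)"
        unfolding chart_q_def xd_def \<omega>_def by (rule powr_mult)
      also have "((xd s)\<^sup>2) powr (-3/2) = xd s powr (-3)"
        using s by (simp add: powr_powr flip: powr_numeral)
      also have "(\<omega> s powr (-2/3)) powr (-3/2) = \<omega> s" using \<omega>[OF s(1)] by (simp add: powr_powr)
      finally have "chart_q e s powr (-3/2) = \<omega> s / (xd s) ^ 3"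
        using s by (simp add: powr_minus_divide)
      then show ?thesis using s xt by (simp add: power3_eq_cube)
    qed
    ultimately show ?thesis by simp
  qed
  have cu: "isCont u t" using DERIV_isCont[OF du[OF t]] .
  have c\<eta>: "isCont \<eta> t" using DERIV_isCont[OF d\<eta>[OF t xt]] .
  have cx: "isCont xd t" using DERIV_isCont[OF dt_left_derivative[OF X1_deriv[OF t]]] by (simp add: xd_def)
  have ev_pos: "\<forall>\<^sub>F s in nhds t. f s > 0" if "isCont f t" "f t > 0" for f :: "real \<Rightarrow> real"
    using order_tendstoD(1)[OF that(1)[unfolded isCont_def] that(2)] that(2) by (simp add: eventually_nhds_conv_at)
  have cG: "isCont (\<lambda>s. conic_graph A B C (u s)) t"
    using isCont_o2[OF cu, of "conic_graph A B C"] DERIV_isCont[OF conic_graph_deriv[of A B "u t" C]] A0 ut by simp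
  \<comment> \<open>Where \<open>M\<close> is positive, the conic form at height \<open>\<eta>\<close> and the height of the curve above the conic have opposite signs.\<close>
  define M where "M = (\<lambda>s. B * sqrt A * u s + A * (4 * A * C - B\<^sup>2) * (\<eta> s + conic_graph A B C (u s)) / 4 + 2 * A * sqrt A)"
  have "isCont M t" unfolding M_def by (intro continuous_intros cu c\<eta> cG) auto
  moreover have "M t > 0" using A0 by (simp add: M_def ut conic_graph_0)
  ultimately have "\<forall>\<^sub>F s in nhds t. M s > 0" by (rule ev_pos)
  moreover have "\<forall>\<^sub>F s in nhds t. \<psi> (u s) > 0"
    by (rule ev_pos) (use A0 ut in \<open>auto simp: \<psi>_def intro!: continuous_intros cu\<close>)
  moreover have "\<forall>\<^sub>F s in nhds t. xd s > 0" by (rule ev_pos[OF cx xt])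
  moreover have "\<forall>\<^sub>F s in nhds t. s \<in> I" using open_I t by (rule eventually_nhds_in_open)
  moreover have "\<forall>\<^sub>F s in nhds t. \<tau> * (chart_q e s - \<psi> (u s)) \<le> 0"
    using touch by (simp add: \<psi>_def u_def)
  ultimately have "\<forall>\<^sub>F s in nhds t. M s > 0 \<and> \<psi> (u s) > 0 \<and> xd s > 0 \<and> s \<in> I \<and>
      \<tau> * (chart_q e s - \<psi> (u s)) \<le> 0"
    by eventually_elim auto
  then obtain \<delta> where \<delta>: "\<delta> > 0" "\<And>s. dist s t < \<delta> \<Longrightarrow> M s > 0 \<and> \<psi> (u s) > 0 \<and> xd s > 0 \<and> s \<in> I \<and>
      \<tau> * (chart_q e s - \<psi> (u s)) \<le> 0"
    unfolding eventually_nhds_metric by blast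
  define U where "U = {t-\<delta><..<t+\<delta>}"
  have U: "M s > 0" "\<psi> (u s) > 0" "xd s > 0" "s \<in> I" "\<tau> * (chart_q e s - \<psi> (u s)) \<le> 0" if "s \<in> U" for s
    using \<delta>(2)[of s] that by (auto simp: U_def dist_real_def)
  have tU: "t \<in> U" using \<delta>(1) by (simp add: U_def)
  define g where "g = (\<lambda>s. \<tau> * (p s - conic_slope A B C (u s)))"
  define f where "f = (\<lambda>s. \<tau> * (\<eta> s - conic_graph A B C (u s)))"
  \<comment> \<open>The second derivatives are compared first; two integrations from \<open>t\<close> compare the curve with the conic.\<close>
  have dg: "\<exists>d. (g has_real_derivative d) (at s) \<and> d \<ge> 0" if s: "s \<in> U" for s
  proof -
    note Us = U[OF s]
    have "((\<lambda>s. conic_slope A B C (u s)) has_real_derivative \<psi> (u s) powr (-3/2) * xd s) (at s)"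
      using DERIV_chain2[OF conic_slope_deriv[OF _ D] du[OF Us(4)]] Us(2) by (simp add: \<psi>_def)
    then have "(g has_real_derivative \<tau> * (xd s * chart_q e s powr (-3/2) - \<psi> (u s) powr (-3/2) * xd s)) (at s)"
      unfolding g_def by (intro DERIV_cmult DERIV_diff dp Us)
    moreover have "\<tau> * (xd s * chart_q e s powr (-3/2) - \<psi> (u s) powr (-3/2) * xd s) \<ge> 0"
    proof -
      have q: "chart_q e s > 0" using Us \<omega>[OF Us(4)] by (simp add: chart_q_def xd_def \<omega>_def)
      have "\<tau> * (chart_q e s powr (-3/2) - \<psi> (u s) powr (-3/2)) \<ge> 0"
        using \<tau> Us(5) q Us(2) powr_mono2'[of "-3/2" "chart_q e s" "\<psi> (u s)"]
          powr_mono2'[of "-3/2" "\<psi> (u s)" "chart_q e s"] by auto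
      then have "xd s * (\<tau> * (chart_q e s powr (-3/2) - \<psi> (u s) powr (-3/2))) \<ge> 0"
        using Us(3) by simp
      then show ?thesis by (simp add: algebra_simps)
    qed
    ultimately show ?thesis by blast
  qed
  have gt: "g t = 0" and ft: "f t = 0" by (simp_all add: g_def f_def ut conic_slope_0 conic_graph_0)
  have g_ge: "g s \<ge> 0" if "t \<le> s" "s \<in> U" for s
    using DERIV_nonneg_imp_nondecreasing[OF that(1), of g] dg that gt by (force simp: U_def)
  have g_le: "g s \<le> 0" if "s \<le> t" "s \<in> U" for s
    using DERIV_nonneg_imp_nondecreasing[OF that(1), of g] dg that gt by (force simp: U_def)
  have df: "(f has_real_derivative g s * xd s) (at s)" if s: "s \<in> U" for s
  proof -
    note Us = U[OF s]
    have "((\<lambda>s. conic_graph A B C (u s)) has_real_derivative conic_slope A B C (u s) * xd s) (at s)"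
      using DERIV_chain2[OF conic_graph_deriv du[OF Us(4)]] Us(2) by (simp add: \<psi>_def)
    then have "(f has_real_derivative \<tau> * (p s * xd s - conic_slope A B C (u s) * xd s)) (at s)"
      unfolding f_def by (intro DERIV_cmult DERIV_diff d\<eta> Us)
    then show ?thesis by (simp add: g_def algebra_simps)
  qed
  have f_ge: "f s \<ge> 0" if s: "s \<in> U" for s
  proof (cases "t \<le> s")
    case True
    have "f t \<le> f s"
    proof (rule DERIV_nonneg_imp_nondecreasing[OF True])
      fix z assume z: "t \<le> z" "z \<le> s"
      then have "z \<in> U" using s tU by (auto simp: U_def)
      then show "\<exists>d. (f has_real_derivative d) (at z) \<and> 0 \<le> d"
        using df[of z] g_ge[of z] U(3)[of z] z by (intro exI[of _ "g z * xd z"]) auto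
    qed
    then show ?thesis using ft by simp
  next
    case False
    have "f t \<le> f s"
    proof (rule DERIV_nonpos_imp_nonincreasing[of s t])
      show "s \<le> t" using False by simp
      fix z assume z: "s \<le> z" "z \<le> t"
      then have "z \<in> U" using s tU by (auto simp: U_def)
      then show "\<exists>d. (f has_real_derivative d) (at z) \<and> d \<le> 0"
        using df[of z] g_le[of z] U(3)[of z] z
        by (intro exI[of _ "g z * xd z"]) (auto simp: mult_nonpos_nonneg)
    qed
    then show ?thesis using ft by simp
  qed
  have form: "\<tau> * conic_form A B C (u s) (\<eta> s) \<le> 0" if s: "s \<in> U" for s
  proof -
    have "conic_form A B C (u s) (conic_graph A B C (u s)) = 0"
      using conic_form_graph[OF A0 D] U(2)[OF s] by (simp add: \<psi>_def)
    then have "conic_form A B C (u s) (\<eta> s) = - (\<eta> s - conic_graph A B C (u s)) * M s"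
      using conic_form_diff[of A B C "u s" "\<eta> s" "conic_graph A B C (u s)"] by (simp add: M_def)
    then have "\<tau> * conic_form A B C (u s) (\<eta> s) = - (f s * M s)" unfolding f_def by (simp only: mult_minus_left mult_minus_right mult.assoc)
    then show ?thesis using f_ge[OF s] U(1)[OF s] by simp
  qed
  \<comment> \<open>The chart measures heights along \<open>e\<close>, which are the true heights divided by \<open>\<nu>\<close>.\<close>
  define \<nu> where "\<nu> = xd t / norm (X1 t)"
  have nX: "norm (X1 t) > 0" using X1_nz[OF t] by simp
  have \<nu>: "\<nu> > 0" using xt nX by (simp add: \<nu>_def)
  have \<eta>_ht: "\<eta> s = ht t s / \<nu>" for s
    using nX by (simp add: \<eta>_def ht_def inner_normal \<nu>_def xd_def)
  show False
  proof (rule area_law_imp_chord_square_law[OF t assms(2) eq])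
    fix h1 a b
    assume h1: "(0::real) < h1"
      and ab: "\<And>h. 0 < h \<Longrightarrow> h < h1 \<Longrightarrow> a h \<in> I \<and> b h \<in> I \<and> a h < t \<and> t < b h \<and> ht t (a h) = h \<and> ht t (b h) = h \<and>
        (wd t (b h) - wd t (a h))\<^sup>2 = 8 * (norm (X1 t) ^ 3 / dt (X1 t) (X2 t)) * h"
      and lims: "(a \<longlongrightarrow> t) (at_right 0)" "(b \<longlongrightarrow> t) (at_right 0)"
    define P where "P = (\<lambda>y. (4 * A * C - B\<^sup>2) * y / 4 + 2 * sqrt A)"
    have "\<forall>\<^sub>F h in at_right 0. a h \<in> U" "\<forall>\<^sub>F h in at_right 0. b h \<in> U"
      using topological_tendstoD[OF lims(1), of U] topological_tendstoD[OF lims(2), of U] tU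
      by (simp_all add: U_def)
    moreover have "\<forall>\<^sub>F h in at_right 0. h \<in> {0<..<h1}" by (rule eventually_at_right_real[OF h1])
    moreover have "\<forall>\<^sub>F h in at_right 0. P (h / \<nu>) > 0"
    proof -
      have "((\<lambda>h. P (h / \<nu>)) \<longlongrightarrow> P (0 / \<nu>)) (at_right 0)"
        unfolding P_def by (intro tendsto_intros) (use \<nu> in auto)
      moreover have "P (0 / \<nu>) > 0" using A0 by (simp add: P_def)
      ultimately show ?thesis by (rule order_tendstoD(1))
    qed
    ultimately have "\<forall>\<^sub>F h in at_right 0. a h \<in> U \<and> b h \<in> U \<and> h \<in> {0<..<h1} \<and> P (h / \<nu>) > 0"
      by eventually_elim auto
    then obtain h where h: "a h \<in> U" "b h \<in> U" "0 < h" "h < h1" "P (h / \<nu>) > 0"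
      using eventually_happens[of _ "at_right (0::real)"] by (auto simp: trivial_limit_at_right_real)
    note abh = ab[OF h(3,4)]
    define y where "y = h / \<nu>"
    have y: "y > 0" using h \<nu> by (simp add: y_def)
    have umono: "u r < u s" if "r < s" "r \<in> U" "s \<in> U" for r s
    proof (rule DERIV_pos_imp_increasing[OF that(1)])
      fix z assume "r \<le> z" "z \<le> s"
      then have "z \<in> U" using that by (auto simp: U_def)
      then show "\<exists>d. (u has_real_derivative d) (at z) \<and> 0 < d" using du U by blast
    qed
    have uab: "u (a h) < 0" "0 < u (b h)"
      using umono[of "a h" t] umono[of t "b h"] h abh tU ut by auto
    have \<eta>ab: "\<eta> (a h) = y" "\<eta> (b h) = y" using abh by (simp_all add: \<eta>_ht y_def)
    have gap: "\<tau> * ((u (b h) - u (a h))\<^sup>2 - ((B * sqrt A * y)\<^sup>2 + 4 * (A * y * P y))) \<le> 0"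
    proof (rule monic_quadratic_gap[OF \<tau> uab])
      show "A * y * P y > 0" using A0 y h(5)[folded y_def] by simp
      show "\<tau> * ((u (a h))\<^sup>2 - B * sqrt A * y * u (a h) - A * y * P y) \<le> 0"
        using form[OF h(1)] by (simp add: \<eta>ab conic_form_def P_def)
      show "\<tau> * ((u (b h))\<^sup>2 - B * sqrt A * y * u (b h) - A * y * P y) \<le> 0"
        using form[OF h(2)] by (simp add: \<eta>ab conic_form_def P_def)
    qed
    have disc: "(B * sqrt A * y)\<^sup>2 + 4 * (A * y * P y) = 8 * A * sqrt A * y + 4 * A\<^sup>2 * C * y\<^sup>2"
    proof -
      have e: "(B * sqrt A * y)\<^sup>2 = B\<^sup>2 * A * y\<^sup>2" using A0 by (simp add: power_mult_distrib)
      show ?thesis unfolding e P_def by (simp add: power2_eq_square field_simps)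
    qed
    have width: "(u (b h) - u (a h))\<^sup>2 = 8 * A * sqrt A * y"
    proof -
      have "u (b h) - u (a h) = dt (X (b h) - X (a h)) e" by (simp add: u_def)
      also have "X (b h) - X (a h) = (wd t (b h) - wd t (a h)) *\<^sub>R tangent t"
        using abh by (intro orthoframe_eqI[OF frame[OF t]])
          (auto simp: orthoframe_inner[OF frame[OF t]] wd_def ht_def inner_diff_left)
      also have "dt \<dots> e = (wd t (b h) - wd t (a h)) * \<nu>"
        by (simp add: tangent_def \<nu>_def xd_def divide_inverse mult.commute)
      finally have "(u (b h) - u (a h))\<^sup>2 = 8 * (norm (X1 t) ^ 3 / \<omega> t) * h * \<nu>\<^sup>2"
        using abh by (simp add: power_mult_distrib \<omega>_def)
      also have "8 * (norm (X1 t) ^ 3 / \<omega> t) * h * \<nu>\<^sup>2 = 8 * ((norm (X1 t) * \<nu>) ^ 3 / \<omega> t) * y"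
        using \<nu> by (simp add: y_def power2_eq_square power3_eq_cube)
      also have "norm (X1 t) * \<nu> = xd t" using nX by (simp add: \<nu>_def)
      also have "xd t ^ 3 / \<omega> t = A * sqrt A"
      proof -
        have "A * sqrt A = A powr (3/2)"
          using A0 powr_add[of A 1 "1/2"] by (simp add: powr_half_sqrt)
        also have "\<dots> = ((xd t)\<^sup>2) powr (3/2) * (\<omega> t powr (-2/3)) powr (3/2)"
          unfolding A chart_q_def xd_def \<omega>_def by (rule powr_mult)
        also have "((xd t)\<^sup>2) powr (3/2) = xd t powr 3"
          using xt by (simp add: powr_powr flip: powr_numeral)
        also have "(\<omega> t powr (-2/3)) powr (3/2) = \<omega> t powr (-1)" by (simp add: powr_powr)
        finally show ?thesis using xt \<omega>[OF t] by (simp add: powr_minus_divide)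
      qed
      finally show ?thesis by simp
    qed
    have "- (\<tau> * C) * (4 * A\<^sup>2 * y\<^sup>2) \<le> 0"
      using gap unfolding disc width by (simp add: algebra_simps)
    moreover have "- (\<tau> * C) * (4 * A\<^sup>2 * y\<^sup>2) > 0" using C A0 y by (intro mult_pos_pos) auto
    ultimately show False by linarith
  qed
qed

text \<open>The degenerate case \<open>4 A C = B\<^sup>2\<close>, in which the closed form of the conic is not available, is reduced to
  the general one by halving \<open>C\<close>: this weakens the touching condition and keeps the sign.\<close>

lemma no_conic_touching':
  assumes law: two_thirds_law and t: "t \<in> I"
    and e: "dt (X1 t) e > 0" and \<tau>: "\<tau> = 1 \<or> \<tau> = -1" and C: "\<tau> * C < 0"
    and touch: "\<forall>\<^sub>F s in nhds t.
      \<tau> * (chart_q e s - (chart_q e t + B * dt (X s - X t) e + C * (dt (X s - X t) e)\<^sup>2)) \<le> 0"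
  shows False
proof -
  obtain h0 where h0: "h0 > 0" "\<And>h. 0 < h \<Longrightarrow> h < h0 \<Longrightarrow> S_area X I t h = 2 / 3 * V_area X I t h"
    using law t unfolding two_thirds_law_def by meson
  define A where "A = chart_q e t"
  have A: "A > 0" unfolding A_def by (rule chart_q_pos[OF t e])
  have touching: False if "\<tau> * C' < 0" "4 * A * C' - B\<^sup>2 \<noteq> 0"
    "\<forall>\<^sub>F s in nhds t. \<tau> * (chart_q e s - (A + B * dt (X s - X t) e + C' * (dt (X s - X t) e)\<^sup>2)) \<le> 0" for C'
    by (rule no_conic_touching[OF t h0(1) _ e \<tau> that(1) A_def that(2,3)]) (rule h0(2))
  show False
  proof (cases "4 * A * C - B\<^sup>2 = 0")
    case False
    show ?thesis by (rule touching[OF C False]) (use touch in \<open>simp add: A_def\<close>)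
  next
    case True
    have "4 * A * (C / 2) - B\<^sup>2 \<noteq> 0" using True A C by auto
    moreover have "\<tau> * (C / 2) < 0" using C by simp
    moreover have "\<forall>\<^sub>F s in nhds t.
      \<tau> * (chart_q e s - (A + B * dt (X s - X t) e + C / 2 * (dt (X s - X t) e)\<^sup>2)) \<le> 0"
      using touch
    proof eventually_elim
      case (elim s)
      define u where "u = dt (X s - X t) e"
      have "\<tau> * C * u\<^sup>2 \<le> 0" using C by (simp add: mult_nonpos_nonneg)
      moreover have "\<tau> * (chart_q e s - (A + B * u + C / 2 * u\<^sup>2)) =
          \<tau> * (chart_q e s - (A + B * u + C * u\<^sup>2)) + \<tau> * C * u\<^sup>2 / 2"
        by (simp add: algebra_simps)
      ultimately show ?case using elim unfolding u_def[symmetric] A_def[symmetric] by linarith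
    qed
    ultimately show ?thesis by (intro touching[of "C / 2"])
  qed
qed

lemma chart_q_isCont: "s \<in> I \<Longrightarrow> isCont (chart_q e) s"
proof -
  assume s: "s \<in> I"
  have "isCont (\<lambda>s. dt (X1 s) e) s"
    using DERIV_isCont[OF dt_left_derivative[OF X1_deriv[OF s]]] .
  moreover have "isCont (\<lambda>s. dt (X1 s) (X2 s)) s"
    using DERIV_isCont[OF dt_has_derivative[OF X1_deriv[OF s] X2_deriv[OF s]]] .
  moreover have "dt (X1 s) (X2 s) \<noteq> 0" using dt12_pos[OF s] by simp
  ultimately show ?thesis unfolding chart_q_def by (intro continuous_intros) auto
qed

text \<open>If \<open>chart_q e\<close> deviated from its linear interpolation somewhere, a small quadratic perturbation with
  the same zeros would produce an interior extremum at which a quadratic polynomial touches.\<close>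

lemma chart_q_affine:
  assumes law: two_thirds_law and t12: "t1 < t2" "{t1..t2} \<subseteq> I"
    and e: "\<And>s. s \<in> {t1..t2} \<Longrightarrow> dt (X1 s) e > 0"
  defines "m \<equiv> (chart_q e t2 - chart_q e t1) / (dt (X t2) e - dt (X t1) e)"
  assumes s: "s \<in> {t1..t2}"
  shows "chart_q e s = chart_q e t1 + m * (dt (X s) e - dt (X t1) e)"
proof (rule ccontr)
  assume neq: "\<not> ?thesis"
  define x where "x = (\<lambda>s. dt (X s) e)"
  define d where "d = (\<lambda>s. chart_q e s - (chart_q e t1 + m * (x s - x t1)))"
  have dx: "(x has_real_derivative dt (X1 s) e) (at s)" if "s \<in> I" for s
    unfolding x_def by (rule dt_left_derivative[OF X_deriv[OF that]])
  have xmono: "x r < x s" if "r < s" "r \<in> {t1..t2}" "s \<in> {t1..t2}" for r s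
  proof (rule DERIV_pos_imp_increasing[OF that(1)])
    fix z assume "r \<le> z" "z \<le> s"
    then have z: "z \<in> {t1..t2}" using that by auto
    then have "z \<in> I" using t12 by blast
    then show "\<exists>D. (x has_real_derivative D) (at z) \<and> 0 < D" using dx e[OF z] by blast
  qed
  have x12: "x t1 < x t2" using xmono[of t1 t2] t12 by simp
  have m_eq: "m * (x t2 - x t1) = chart_q e t2 - chart_q e t1"
    using x12 unfolding m_def x_def by simp
  have d0: "d t1 = 0" "d t2 = 0" using m_eq by (simp_all add: d_def)
  have ds: "d s \<noteq> 0" using neq by (simp add: d_def x_def)
  then have s12: "t1 < s" "s < t2" using d0 s by (auto simp: order.strict_iff_order)
  then have xs: "x t1 < x s" "x s < x t2" using xmono s t12 by auto
  define \<tau> :: real where "\<tau> = (if d s > 0 then 1 else -1)"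
  have \<tau>: "\<tau> = 1 \<or> \<tau> = -1" "\<tau> * \<tau> = 1" by (auto simp: \<tau>_def)
  have \<tau>d: "\<tau> * d s > 0" using ds by (auto simp: \<tau>_def)
  \<comment> \<open>The perturbation takes away half of the deviation at \<open>s\<close>.\<close>
  define \<epsilon> where "\<epsilon> = \<tau> * d s / (2 * ((x s - x t1) * (x t2 - x s)))"
  have \<epsilon>: "\<epsilon> > 0" using \<tau>d xs by (simp add: \<epsilon>_def)
  define F where "F = (\<lambda>r. \<tau> * d r + \<epsilon> * ((x r - x t1) * (x r - x t2)))"
  have "\<epsilon> * ((x s - x t1) * (x t2 - x s)) = \<tau> * d s / 2"
    using xs by (simp add: \<epsilon>_def)
  then have "F s = \<tau> * d s / 2" by (simp add: F_def algebra_simps)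
  then have Fs: "F s > 0" using \<tau>d by simp
  have F0: "F t1 = 0" "F t2 = 0" by (simp_all add: F_def d0)
  have "continuous_on {t1..t2} F"
  proof (intro continuous_at_imp_continuous_on ballI)
    fix r assume "r \<in> {t1..t2}"
    then have r: "r \<in> I" using t12 by blast
    show "isCont F r" unfolding F_def d_def
      by (intro continuous_intros chart_q_isCont DERIV_isCont[OF dx] r)
  qed
  then obtain r where r: "r \<in> {t1..t2}" and max: "\<And>z. z \<in> {t1..t2} \<Longrightarrow> F z \<le> F r"
    using continuous_attains_sup[of "{t1..t2}" F] t12 by auto
  have "F r > 0" using max[OF s] Fs by simp
  then have r12: "t1 < r" "r < t2" using F0 r by (auto simp: order.strict_iff_order)
  have rI: "r \<in> I" using r t12 by blast
  define B where "B = m - \<tau> * \<epsilon> * (2 * x r - x t1 - x t2)"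
  define C where "C = - \<tau> * \<epsilon>"
  have \<tau>C: "\<tau> * C < 0" using \<epsilon> \<tau>(2) by (simp add: C_def mult.assoc[symmetric])
  show False
  proof (rule no_conic_touching'[OF law rI e[OF r] \<tau>(1) \<tau>C])
    have "\<forall>\<^sub>F z in nhds r. z \<in> {t1<..<t2}" using r12 by (intro eventually_nhds_in_open) auto
    then show "\<forall>\<^sub>F z in nhds r. \<tau> * (chart_q e z -
        (chart_q e r + B * dt (X z - X r) e + C * (dt (X z - X r) e)\<^sup>2)) \<le> 0"
    proof eventually_elim
      case (elim z)
      then have "F z \<le> F r" using max[of z] by simp
      moreover have "\<tau> * (chart_q e z - (chart_q e r + B * (x z - x r) + C * (x z - x r)\<^sup>2)) = F z - F r"
      proof -
        have "\<tau> * (B * (x z - x r) + C * (x z - x r)\<^sup>2) =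
          \<tau> * m * (x z - x r) - (\<tau> * \<tau>) * \<epsilon> * ((2 * x r - x t1 - x t2) * (x z - x r) + (x z - x r)\<^sup>2)"
          by (simp add: B_def C_def algebra_simps)
        also have "(2 * x r - x t1 - x t2) * (x z - x r) + (x z - x r)\<^sup>2 =
          (x z - x t1) * (x z - x t2) - (x r - x t1) * (x r - x t2)"
          by (simp add: power2_eq_square algebra_simps)
        finally show ?thesis by (simp add: F_def d_def \<tau>(2) algebra_simps)
      qed
      ultimately show ?case by (simp add: x_def)
    qed
  qed
qed

section \<open>The affine normal is constant\<close>

text \<open>The density of the affine arc length \<open>\<sigma>\<close> is \<open>d\<sigma>/dt = \<omega>\<^bsup>1/3\<^esup> = 1 / \<rho>\<close>.  Therefore \<open>affine_tangent\<close> is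
  \<open>dX/d\<sigma>\<close>, the functions \<open>\<rho>'\<close> and \<open>affine_tangent'\<close> are derivatives with respect to the given parameter, and
  \<open>affine_normal\<close> is \<open>d\<^sup>2X/d\<sigma>\<^sup>2\<close>.\<close>

definition \<omega> :: "real \<Rightarrow> real" where "\<omega> s = dt (X1 s) (X2 s)"
definition \<rho> :: "real \<Rightarrow> real" where "\<rho> s = \<omega> s powr (-1/3)"
definition \<rho>' :: "real \<Rightarrow> real" where "\<rho>' s = -1/3 * \<omega> s powr (-4/3) * dt (X1 s) (X3 s)"
definition affine_tangent :: "real \<Rightarrow> real^2" where "affine_tangent s = \<rho> s *\<^sub>R X1 s"
definition affine_tangent' :: "real \<Rightarrow> real^2" where "affine_tangent' s = \<rho>' s *\<^sub>R X1 s + \<rho> s *\<^sub>R X2 s"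
definition affine_normal :: "real \<Rightarrow> real^2" where "affine_normal s = \<rho> s *\<^sub>R affine_tangent' s"

lemma \<omega>_pos: "s \<in> I \<Longrightarrow> \<omega> s > 0" using dt12_pos by (simp add: \<omega>_def)
lemma \<rho>_pos: "s \<in> I \<Longrightarrow> \<rho> s > 0" using \<omega>_pos[of s] by (simp add: \<rho>_def)

lemma affine_tangent_deriv:
  assumes s: "s \<in> I"
  shows "(affine_tangent has_vector_derivative affine_tangent' s) (at s)"
proof -
  have "(\<omega> has_real_derivative dt (X1 s) (X3 s)) (at s)"
    using dt_has_derivative[OF X1_deriv[OF s] X2_deriv[OF s]] by (simp add: \<omega>_def[abs_def])
  then have "(\<rho> has_real_derivative (-1/3) * \<omega> s powr (-1/3 - 1) * dt (X1 s) (X3 s)) (at s)"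
    unfolding \<rho>_def[abs_def]
    using DERIV_fun_powr[where g = \<omega> and r = "-1/3", OF _ \<omega>_pos[OF s]] by simp
  then have "(\<rho> has_vector_derivative \<rho>' s) (at s)"
    by (simp add: \<rho>'_def has_real_derivative_iff_has_vector_derivative)
  from has_vector_derivative_scaleR[OF this[folded has_real_derivative_iff_has_vector_derivative] X1_deriv[OF s]]
  show ?thesis unfolding affine_tangent_def[abs_def] affine_tangent'_def by (simp add: add.commute)
qed

lemma chart_q_eq: "s \<in> I \<Longrightarrow> chart_q e s = (dt (affine_tangent s) e)\<^sup>2"
  using \<omega>_pos[of s]
  by (simp add: chart_q_def affine_tangent_def \<rho>_def power_mult_distrib powr_power \<omega>_def mult.commute)

text \<open>The derivative of \<open>chart_q e\<close> with respect to \<open>x = dt X e\<close> is \<open>2 dt (affine_normal) e\<close>.\<close>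

lemma chart_q_deriv:
  assumes s: "s \<in> I"
  shows "(chart_q e has_real_derivative 2 * dt (X1 s) e * dt (affine_normal s) e) (at s)"
proof (rule has_field_derivative_transform_within_open[OF _ open_I s])
  show "((\<lambda>s. (dt (affine_tangent s) e)\<^sup>2) has_real_derivative 2 * dt (X1 s) e * dt (affine_normal s) e) (at s)"
    using DERIV_power[OF dt_left_derivative[OF affine_tangent_deriv[OF s], of e], of 2]
    by (simp add: affine_normal_def affine_tangent_def algebra_simps)
qed (simp add: chart_q_eq)

lemma affine_normal_locally_constant_in_chart:
  assumes law: two_thirds_law and t12: "t1 < t2" "{t1..t2} \<subseteq> I"
    and e: "\<And>s. s \<in> {t1..t2} \<Longrightarrow> dt (X1 s) e > 0"
  obtains c where "\<And>s. s \<in> {t1<..<t2} \<Longrightarrow> dt (affine_normal s) e = c"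
proof -
  define m where "m = (chart_q e t2 - chart_q e t1) / (dt (X t2) e - dt (X t1) e)"
  have "dt (affine_normal s) e = m / 2" if s: "s \<in> {t1<..<t2}" for s
  proof -
    have s': "s \<in> {t1..t2}" "s \<in> I" using s t12 by auto
    have "((\<lambda>s. m * (dt (X s) e - dt (X t1) e)) has_real_derivative m * (dt (X1 s) e - 0)) (at s)"
      by (intro DERIV_cmult DERIV_diff DERIV_const dt_left_derivative X_deriv s')
    from DERIV_add[OF DERIV_const[of "chart_q e t1"] this]
    have "((\<lambda>s. chart_q e t1 + m * (dt (X s) e - dt (X t1) e)) has_real_derivative m * dt (X1 s) e) (at s)"
      by simp
    then have "(chart_q e has_real_derivative m * dt (X1 s) e) (at s)"
    proof (rule has_field_derivative_transform_within_open[of _ _ _ "{t1<..<t2}"])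
      fix r assume "r \<in> {t1<..<t2}"
      then show "chart_q e t1 + m * (dt (X r) e - dt (X t1) e) = chart_q e r"
        using chart_q_affine[OF law t12 e, of r] by (simp add: m_def)
    qed (use s in auto)
    then have "m * dt (X1 s) e = 2 * dt (X1 s) e * dt (affine_normal s) e"
      using chart_q_deriv[OF s'(2)] by (rule DERIV_unique)
    then show ?thesis using e[OF s'(1)] by simp
  qed
  then show ?thesis by (rule that)
qed

text \<open>The components of the affine normal in two independent charts around the point determine it.\<close>

lemma affine_normal_locally_constant:
  assumes law: two_thirds_law and t: "t \<in> I"
  obtains \<delta> where "\<delta> > 0" "{t-\<delta><..<t+\<delta>} \<subseteq> I" "\<forall>s\<in>{t-\<delta><..<t+\<delta>}. affine_normal s = affine_normal t"
proof -
  define e1 where "e1 = normal t"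
  define e2 where "e2 = normal t + tangent t"
  have pos: "dt (X1 t) e1 > 0" "dt (X1 t) e2 > 0"
    using X1_nz[OF t] dt_swap[of "X1 t" "tangent t"]
    by (simp_all add: e1_def e2_def dt_normal[OF t] tangent_inner_X1[OF t] dt_tangent normal_inner_X1)
  have nbhd: "\<forall>\<^sub>F s in nhds t. dt (X1 s) e > 0" if "dt (X1 t) e > 0" for e
    using order_tendstoD(1)[OF DERIV_isCont[OF dt_left_derivative[OF X1_deriv[OF t]], unfolded isCont_def] that] that
    by (simp add: eventually_nhds_conv_at)
  have "\<forall>\<^sub>F s in nhds t. dt (X1 s) e1 > 0" "\<forall>\<^sub>F s in nhds t. dt (X1 s) e2 > 0"
    using nbhd pos by blast+
  moreover have "\<forall>\<^sub>F s in nhds t. s \<in> I" using open_I t by (rule eventually_nhds_in_open)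
  ultimately have "\<forall>\<^sub>F s in nhds t. dt (X1 s) e1 > 0 \<and> dt (X1 s) e2 > 0 \<and> s \<in> I"
    by eventually_elim auto
  then obtain d where d: "d > 0" "\<And>s. dist s t < d \<Longrightarrow> dt (X1 s) e1 > 0 \<and> dt (X1 s) e2 > 0 \<and> s \<in> I"
    unfolding eventually_nhds_metric by blast
  define \<delta> where "\<delta> = d / 2"
  have \<delta>: "\<delta> > 0" using d by (simp add: \<delta>_def)
  have near: "dist s t < d" if "s \<in> {t-\<delta>..t+\<delta>}" for s
    using that d(1) by (auto simp: \<delta>_def dist_real_def)
  have lt: "t - \<delta> < t + \<delta>" and sub: "{t-\<delta>..t+\<delta>} \<subseteq> I" using \<delta> d(2) near by auto
  obtain c1 where c1: "\<And>s. s \<in> {t-\<delta><..<t+\<delta>} \<Longrightarrow> dt (affine_normal s) e1 = c1"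
    by (rule affine_normal_locally_constant_in_chart[OF law lt sub, of e1]) (use d near in auto)
  obtain c2 where c2: "\<And>s. s \<in> {t-\<delta><..<t+\<delta>} \<Longrightarrow> dt (affine_normal s) e2 = c2"
    by (rule affine_normal_locally_constant_in_chart[OF law lt sub, of e2]) (use d near in auto)
  show ?thesis
  proof (rule that[OF \<delta>])
    show "{t-\<delta><..<t+\<delta>} \<subseteq> I" using sub by auto
    show "\<forall>s\<in>{t-\<delta><..<t+\<delta>}. affine_normal s = affine_normal t"
    proof
      fix s assume s: "s \<in> {t-\<delta><..<t+\<delta>}"
      have tin: "t \<in> {t-\<delta><..<t+\<delta>}" using \<delta> by simp
      have 1: "dt (affine_normal s) e1 = dt (affine_normal t) e1"
        and 2: "dt (affine_normal s) e2 = dt (affine_normal t) e2"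
        using c1[OF s] c1[OF tin] c2[OF s] c2[OF tin] by simp_all
      show "affine_normal s = affine_normal t"
      proof (rule orthoframe_eqI[OF frame[OF t]])
        show "affine_normal s \<bullet> tangent t = affine_normal t \<bullet> tangent t"
          using 1 by (simp add: e1_def dt_normal[OF t])
        have "dt (affine_normal s) (tangent t) = dt (affine_normal t) (tangent t)"
          using 1 2 by (simp add: e1_def e2_def)
        then show "affine_normal s \<bullet> normal t = affine_normal t \<bullet> normal t"
          using dt_swap[of "affine_normal s" "tangent t"] dt_swap[of "affine_normal t" "tangent t"]
          by (simp add: dt_tangent)
      qed
    qed
  qed
qed

lemma affine_normal_constant:
  assumes law: two_thirds_law
  obtains E where "\<And>s. s \<in> I \<Longrightarrow> affine_normal s = E"
proof -
  have "affine_normal constant_on I"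
  proof (rule locally_constant_imp_constant)
    show "connected I" using interval_I by (rule is_interval_connected)
    fix t assume t: "t \<in> I"
    obtain \<delta> where \<delta>: "\<delta> > 0" "{t-\<delta><..<t+\<delta>} \<subseteq> I" "\<forall>s\<in>{t-\<delta><..<t+\<delta>}. affine_normal s = affine_normal t"
      by (rule affine_normal_locally_constant[OF law t])
    have "openin (top_of_set I) {t-\<delta><..<t+\<delta>}" using \<delta>(2) open_greaterThanLessThan by (rule open_subset)
    moreover have "t \<in> {t-\<delta><..<t+\<delta>}" using \<delta>(1) by simp
    ultimately show "\<exists>T. openin (top_of_set I) T \<and> t \<in> T \<and> (\<forall>s\<in>T. affine_normal s = affine_normal t)"
      using \<delta>(3) by (intro exI[of _ "{t-\<delta><..<t+\<delta>}"] conjI)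
  qed
  then show ?thesis using that unfolding constant_on_def by blast
qed

lemma constant_of_zero_derivative:
  fixes f :: "real \<Rightarrow> real^2"
  assumes "\<And>s. s \<in> I \<Longrightarrow> (f has_vector_derivative 0) (at s)"
  obtains c where "\<forall>s\<in>I. f s = c"
proof -
  have "(f has_derivative (\<lambda>h. 0)) (at s within I)" if "s \<in> I" for s
    using has_vector_derivative_at_within[OF assms[OF that]] by (simp add: has_vector_derivative_def)
  then show ?thesis
    using has_derivative_zero_constant[of I f] interval_I that by (auto simp: is_interval_convex)
qed

text \<open>Since the affine normal has the constant value \<open>E\<close>, the coordinate \<open>z = dt X E\<close> is an affine arc
  length, and \<open>X\<close> is a quadratic polynomial of it.\<close>

lemma law_imp_parabola:
  assumes law: two_thirds_law
  shows "open_part_of_parabola (X ` I)"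
proof -
  obtain E where E: "\<And>s. s \<in> I \<Longrightarrow> affine_normal s = E"
    using affine_normal_constant[OF law] by blast
  define z where "z = (\<lambda>s. dt (X s) E)"
  have \<rho>3: "\<rho> s ^ 3 * \<omega> s = 1" if "s \<in> I" for s
  proof -
    have "\<rho> s ^ 3 = \<omega> s powr (-1)" using \<omega>_pos[OF that] by (simp add: \<rho>_def powr_power)
    then show ?thesis using \<omega>_pos[OF that] by (simp add: powr_minus_divide)
  qed
  have XE: "\<rho> s * dt (X1 s) E = 1" if "s \<in> I" for s
  proof -
    have "dt (X1 s) E = \<rho> s * \<rho> s * \<omega> s"
      unfolding E[OF that, symmetric] by (simp add: affine_normal_def affine_tangent'_def \<omega>_def)
    then show ?thesis using \<rho>3[OF that] by (simp add: power3_eq_cube mult.assoc)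
  qed
  have dz: "(z has_real_derivative dt (X1 s) E) (at s)" if "s \<in> I" for s
    unfolding z_def by (rule dt_left_derivative[OF X_deriv[OF that]])
  have dz': "(z has_vector_derivative dt (X1 s) E) (at s)" if "s \<in> I" for s
    using dz[OF that] by (simp add: has_real_derivative_iff_has_vector_derivative)
  have "((\<lambda>s. affine_tangent s - z s *\<^sub>R E) has_vector_derivative 0) (at s)" if s: "s \<in> I" for s
  proof -
    have "((\<lambda>s. affine_tangent s - z s *\<^sub>R E) has_vector_derivative
        affine_tangent' s - (z s *\<^sub>R 0 + dt (X1 s) E *\<^sub>R E)) (at s)"
      by (intro has_vector_derivative_diff has_vector_derivative_scaleR affine_tangent_deriv s dz
          has_vector_derivative_const)
    moreover have "affine_tangent' s = dt (X1 s) E *\<^sub>R E"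
    proof -
      have "\<rho> s *\<^sub>R affine_tangent' s = (\<rho> s * dt (X1 s) E) *\<^sub>R E"
        using XE[OF s] E[OF s] by (simp add: affine_normal_def)
      then have "\<rho> s *\<^sub>R affine_tangent' s = \<rho> s *\<^sub>R (dt (X1 s) E *\<^sub>R E)" by simp
      then show ?thesis using \<rho>_pos[OF s] by (simp only: scaleR_cancel_left) simp
    qed
    ultimately show ?thesis by simp
  qed
  then obtain V where V0: "\<forall>s\<in>I. affine_tangent s - z s *\<^sub>R E = V"
    by (rule constant_of_zero_derivative)
  have V: "affine_tangent s = V + z s *\<^sub>R E" if "s \<in> I" for s
    using V0[rule_format, OF that] by (simp add: algebra_simps)
  have X1_eq: "X1 s = dt (X1 s) E *\<^sub>R (V + z s *\<^sub>R E)" if s: "s \<in> I" for s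
  proof -
    have "dt (X1 s) E *\<^sub>R (V + z s *\<^sub>R E) = (\<rho> s * dt (X1 s) E) *\<^sub>R X1 s"
      unfolding V[OF s, symmetric] affine_tangent_def by (simp add: mult.commute)
    then show ?thesis using XE[OF s] by simp
  qed
  have "((\<lambda>s. X s - (z s *\<^sub>R V + (z s * z s) *\<^sub>R ((1/2) *\<^sub>R E))) has_vector_derivative 0) (at s)"
    if s: "s \<in> I" for s
  proof -
    have "((\<lambda>s. X s - (z s *\<^sub>R V + (z s * z s) *\<^sub>R ((1/2) *\<^sub>R E))) has_vector_derivative
      X1 s - ((z s *\<^sub>R 0 + dt (X1 s) E *\<^sub>R V) +
        ((z s * z s) *\<^sub>R 0 + (z s * dt (X1 s) E + dt (X1 s) E * z s) *\<^sub>R ((1/2) *\<^sub>R E)))) (at s)"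
      by (intro has_vector_derivative_diff has_vector_derivative_add has_vector_derivative_scaleR
          X_deriv s dz has_vector_derivative_const DERIV_mult')
    moreover have "(z s *\<^sub>R 0 + dt (X1 s) E *\<^sub>R V) +
        ((z s * z s) *\<^sub>R 0 + (z s * dt (X1 s) E + dt (X1 s) E * z s) *\<^sub>R ((1/2) *\<^sub>R E)) =
        dt (X1 s) E *\<^sub>R (V + z s *\<^sub>R E)"
      by (simp add: algebra_simps)
    ultimately show ?thesis using X1_eq[OF s] by simp
  qed
  then obtain P where P: "\<forall>s\<in>I. X s - (z s *\<^sub>R V + (z s * z s) *\<^sub>R ((1/2) *\<^sub>R E)) = P"
    by (rule constant_of_zero_derivative)
  define e where "e = (1/2) *\<^sub>R E"
  have X_eq: "X s = P + z s *\<^sub>R V + (z s)\<^sup>2 *\<^sub>R e" if "s \<in> I" for s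
    using P[rule_format, OF that] by (simp add: e_def power2_eq_square algebra_simps)
  obtain t where t: "t \<in> I" using I_ne by blast
  have VE: "dt V E = 1"
    using XE[OF t] arg_cong[OF V[OF t], of "\<lambda>v. dt v E"] by (simp add: affine_tangent_def)
  then have "cross2 V e \<noteq> 0" by (auto simp: dt_def e_def cross2_simps)
  define \<Gamma> where "\<Gamma> = {P + u *\<^sub>R V + u\<^sup>2 *\<^sub>R e | u. True}"
  have par: "parabola \<Gamma>" unfolding \<Gamma>_def by (rule parametrization_imp_parabola) fact
  have zP: "dt (P + u *\<^sub>R V + u\<^sup>2 *\<^sub>R e) E = dt P E + u" for u
    using VE by (simp add: e_def)
  have P0: "dt P E = 0" using arg_cong[OF X_eq[OF t], of "\<lambda>v. dt v E"] zP[of "z t"] by (simp add: z_def)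
  have cz: "continuous_on I z" using dz by (meson DERIV_isCont continuous_at_imp_continuous_on)
  have "inj_on z I"
  proof (rule inj_onI)
    fix r s assume rs: "r \<in> I" "s \<in> I" "z r = z s"
    then have "X r = X s" using X_eq by simp
    then show "r = s" using inj_X rs by (auto simp: inj_on_def)
  qed
  then have oz: "open (z ` I)" using invariance_of_domain[OF cz open_I] by simp
  have eq: "X ` I = \<Gamma> \<inter> {p. dt p E \<in> z ` I}"
  proof (intro subset_antisym subsetI)
    fix p assume "p \<in> X ` I"
    then obtain s where s: "s \<in> I" "p = X s" by blast
    then have "p \<in> \<Gamma>" using X_eq by (auto simp: \<Gamma>_def)
    then show "p \<in> \<Gamma> \<inter> {p. dt p E \<in> z ` I}" using s by (auto simp: z_def)
  next
    fix p assume "p \<in> \<Gamma> \<inter> {p. dt p E \<in> z ` I}"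
    then obtain u s where u: "p = P + u *\<^sub>R V + u\<^sup>2 *\<^sub>R e" and s: "s \<in> I" "dt p E = z s"
      by (auto simp: \<Gamma>_def)
    then have "u = z s" using zP[of u] P0 by simp
    then show "p \<in> X ` I" using u s X_eq by auto
  qed
  have "continuous_on UNIV (\<lambda>p. dt p E)"
    by (intro linear_continuous_on bounded_bilinear.bounded_linear_left[OF bounded_bilinear_dt])
  then have "open {p. dt p E \<in> z ` I}"
    using continuous_open_preimage[OF _ open_UNIV oz] by (simp add: vimage_def)
  then have "openin (top_of_set \<Gamma>) (X ` I)" unfolding eq by (rule openin_open_Int)
  moreover have "connected (X ` I)"
    using interval_I cont_X
    by (intro connected_continuous_image is_interval_connected continuous_at_imp_continuous_on) auto
  ultimately show ?thesis
    using par I_ne unfolding open_part_of_parabola_def by blast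
qed

end

section \<open>Strictly convex curves satisfy the parametric description\<close>

lemma Ck_on_3_derivatives:
  assumes "open I" "Ck_on 3 X I" and t: "t \<in> I"
  defines "V1 \<equiv> \<lambda>t. vector_derivative X (at t)"
  defines "V2 \<equiv> \<lambda>t. vector_derivative V1 (at t)"
  defines "V3 \<equiv> \<lambda>t. vector_derivative V2 (at t)"
  shows "(X has_vector_derivative V1 t) (at t)" "(V1 has_vector_derivative V2 t) (at t)"
    "(V2 has_vector_derivative V3 t) (at t)"
proof -
  have d: "(velocity ^^ j) X differentiable_on I" if "j < 3" for j
    using assms(2) that by (simp add: Ck_on_def)
  have "X differentiable_on I" "V1 differentiable_on I" "V2 differentiable_on I"
    using d[of 0] d[of 1] d[of 2] by (simp_all add: V1_def V2_def numeral_2_eq_2)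
  then have "X differentiable (at t)" "V1 differentiable (at t)" "V2 differentiable (at t)"
    using assms(1) t by (auto simp: differentiable_on_eq_differentiable_at)
  then show "(X has_vector_derivative V1 t) (at t)" "(V1 has_vector_derivative V2 t) (at t)"
    "(V2 has_vector_derivative V3 t) (at t)"
    by (simp_all add: vector_derivative_works V1_def V2_def V3_def)
qed

lemma unit_orthogonal_vector:
  fixes v n :: "real^2"
  assumes "v \<noteq> 0" "norm n = 1" "n \<bullet> v = 0"
  obtains \<tau> where "\<tau> = 1 \<or> \<tau> = -1" "n = (\<tau> / norm v) *\<^sub>R vector [- v$2, v$1]"
proof -
  define r where "r = norm v"
  define \<tau> where "\<tau> = (n$2 * v$1 - n$1 * v$2) / r"
  have r: "r > 0" "r * r = v$1 * v$1 + v$2 * v$2"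
    using assms(1) power2_norm_eq_inner[of v] by (simp_all add: r_def inner2 power2_eq_square)
  have n1: "n$1 * n$1 + n$2 * n$2 = 1" using assms(2) by (simp add: norm_eq_1 inner2)
  have o: "n$1 * v$1 + n$2 * v$2 = 0" using assms(3) by (simp add: inner2)
  have \<tau>r: "\<tau> * r = n$2 * v$1 - n$1 * v$2" using r by (simp add: \<tau>_def)
  have "(\<tau> * r) * (\<tau> * r) = 1 * (r * r)" unfolding \<tau>r r(2) using n1 o by algebra
  then have "\<tau> * \<tau> * (r * r) = 1 * (r * r)" by (simp add: algebra_simps)
  then have "\<tau> * \<tau> = 1" using r(1) by (metis mult_right_cancel less_irrefl mult_pos_pos)
  then have \<tau>: "\<tau> = 1 \<or> \<tau> = -1" by (simp add: square_eq_1_iff)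
  have "(r * r) * n$1 = (\<tau> * r) * - v$2" "(r * r) * n$2 = (\<tau> * r) * v$1"
    unfolding \<tau>r r(2) using o by algebra+
  then have "r * (r * n$1) = r * (\<tau> * - v$2)" "r * (r * n$2) = r * (\<tau> * v$1)"
    by (simp_all add: algebra_simps)
  then have "r * n$1 = \<tau> * - v$2" "r * n$2 = \<tau> * v$1"
    using r(1) by (simp_all only: mult_left_cancel[of r])
  then have "n = (\<tau> / r) *\<^sub>R vector [- v$2, v$1]"
    using r(1) by (simp add: vec_eq_iff forall_2 field_simps)
  then show ?thesis using that \<tau> unfolding r_def by blast
qed

text \<open>The derivative of the factor that normalizes the velocity contributes a tangential term only.\<close>

lemma curvature_eq:
  assumes V1: "(V1 has_vector_derivative v2) (at t)" and X: "\<And>s. vector_derivative X (at s) = V1 s"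
    and ne: "V1 t \<noteq> 0" and n: "unit_normal X I t \<bullet> V1 t = 0"
  shows "curvature X I t = (v2 \<bullet> unit_normal X I t) / (norm (V1 t))\<^sup>2"
proof -
  have "(\<lambda>s. inverse (norm (V1 s))) differentiable (at t)"
  proof -
    have "V1 differentiable (at t)" using V1 by (auto simp: has_vector_derivative_def differentiable_def)
    then have "(\<lambda>s. norm (V1 s)) differentiable (at t)"
      using differentiable_compose[of norm V1 t UNIV] ne by (simp add: differentiable_norm_at)
    then show ?thesis using ne by (intro differentiable_inverse) auto
  qed
  then obtain r where "((\<lambda>s. inverse (norm (V1 s))) has_real_derivative r) (at t)"
    using real_differentiableE by blast
  from has_vector_derivative_scaleR[OF this V1]
  have "((\<lambda>s. V1 s /\<^sub>R norm (V1 s)) has_vector_derivative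
      (v2 /\<^sub>R norm (V1 t) + r *\<^sub>R V1 t)) (at t)" by simp
  moreover have "arclength_deriv X X = (\<lambda>s. V1 s /\<^sub>R norm (V1 s))"
    by (simp add: arclength_deriv_def[abs_def] X)
  ultimately have eq: "arclength_deriv X (arclength_deriv X X) t = (v2 /\<^sub>R norm (V1 t) + r *\<^sub>R V1 t) /\<^sub>R norm (V1 t)"
    by (simp add: arclength_deriv_def[of X "\<lambda>s. V1 s /\<^sub>R norm (V1 s)"] X vector_derivative_at)
  have "V1 t \<bullet> unit_normal X I t = 0" using n by (simp add: inner_commute)
  then show ?thesis
    unfolding curvature_def eq inner_scaleR_left inner_add_left
    by (simp add: power2_eq_square divide_inverse)
qed

lemma strictly_convex_curve_imp_param:
  assumes "strictly_convex_curve X I"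
  obtains X1 X2 X3 sg where "strictly_convex_param X X1 X2 X3 I sg"
proof -
  define V1 where "V1 = (\<lambda>t. vector_derivative X (at t))"
  define V2 where "V2 = (\<lambda>t. vector_derivative V1 (at t))"
  define V3 where "V3 = (\<lambda>t. vector_derivative V2 (at t))"
  have I: "open I" "is_interval I" "I \<noteq> {}" and C3: "Ck_on 3 X I"
    and reg: "\<And>t. t \<in> I \<Longrightarrow> V1 t \<noteq> 0"
    and side: "\<And>t. t \<in> I \<Longrightarrow> \<exists>n. convex_side_normal X I t n"
    and inj: "inj_on X I" and curv: "\<And>t. t \<in> I \<Longrightarrow> curvature X I t > 0"
    using assms by (auto simp: strictly_convex_curve_def convex_curve_def regular_curve_def V1_def)
  have der: "(X has_vector_derivative V1 t) (at t)" "(V1 has_vector_derivative V2 t) (at t)"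
    "(V2 has_vector_derivative V3 t) (at t)" if "t \<in> I" for t
    using Ck_on_3_derivatives[OF I(1) C3 that] by (simp_all only: V1_def V2_def V3_def)
  have un: "convex_side_normal X I t (unit_normal X I t)" if "t \<in> I" for t
    unfolding unit_normal_def using side[OF that] by (rule someI_ex)
  have nrm: "norm (unit_normal X I t) = 1" "unit_normal X I t \<bullet> V1 t = 0"
    "\<And>s. s \<in> I \<Longrightarrow> (X s - X t) \<bullet> unit_normal X I t \<ge> 0" if "t \<in> I" for t
    using un[OF that] by (auto simp: convex_side_normal_def V1_def)
  have X_V1: "vector_derivative X (at s) = V1 s" for s by (simp add: V1_def)
  have V2n: "V2 t \<bullet> unit_normal X I t > 0" if t: "t \<in> I" for t
    using curv[OF t] reg[OF t] curvature_eq[OF der(2)[OF t] X_V1 reg[OF t] nrm(2)[OF t]]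
    by (simp add: zero_less_divide_iff)
  define c where "c = (\<lambda>t. cross2 (V1 t) (V2 t))"
  have loc: "\<exists>\<tau>. (\<tau> = 1 \<or> \<tau> = -1) \<and> unit_normal X I t = (\<tau> / norm (V1 t)) *\<^sub>R vector [- (V1 t)$2, (V1 t)$1] \<and> \<tau> * c t > 0"
    if t: "t \<in> I" for t
  proof -
    obtain \<tau> where \<tau>: "\<tau> = 1 \<or> \<tau> = -1" and eq: "unit_normal X I t = (\<tau> / norm (V1 t)) *\<^sub>R vector [- (V1 t)$2, (V1 t)$1]"
      using unit_orthogonal_vector[OF reg[OF t] nrm(1,2)[OF t]] by blast
    have "V2 t \<bullet> unit_normal X I t = \<tau> * c t / norm (V1 t)"
      unfolding eq c_def by (simp add: inner2 cross2_def divide_inverse algebra_simps)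
    then have "\<tau> * c t > 0" using V2n[OF t] reg[OF t] by (simp add: zero_less_divide_iff)
    then show ?thesis using \<tau> eq by blast
  qed
  have c_ne: "c t \<noteq> 0" if "t \<in> I" for t using loc[OF that] by auto
  have cont: "continuous_on I c"
  proof (intro continuous_at_imp_continuous_on ballI)
    fix t assume t: "t \<in> I"
    have "isCont V1 t" "isCont V2 t"
      using der(2,3)[OF t] has_vector_derivative_continuous by blast+
    then show "isCont c t" unfolding c_def cross2_def by (intro continuous_intros)
  qed
  obtain t0 where t0: "t0 \<in> I" using I(3) by blast
  define sg where "sg = sgn (c t0)"
  have sg: "sg = 1 \<or> sg = -1" using c_ne[OF t0] by (auto simp: sg_def sgn_if)
  \<comment> \<open>The determinant has no zero on the interval, so that its sign is constant.\<close>
  have same: "sg * c t > 0" if t: "t \<in> I" for t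
  proof -
    have "connected (c ` I)"
      by (intro connected_continuous_image cont is_interval_connected I)
    then have iv: "is_interval (c ` I)" by (simp add: is_interval_connected_1)
    have "0 \<notin> c ` I" using c_ne by auto
    then have "\<not> (c t < 0 \<and> 0 < c t0)" "\<not> (c t0 < 0 \<and> 0 < c t)"
      using iv t t0 unfolding is_interval_1 by (meson imageI less_imp_le)+
    then show ?thesis using c_ne[OF t] c_ne[OF t0] by (auto simp: sg_def sgn_if)
  qed
  have normal: "unit_normal X I t = (sg / norm (V1 t)) *\<^sub>R vector [- (V1 t)$2, (V1 t)$1]" if t: "t \<in> I" for t
  proof -
    obtain \<tau> where \<tau>: "\<tau> = 1 \<or> \<tau> = -1" "\<tau> * c t > 0"
      and eq: "unit_normal X I t = (\<tau> / norm (V1 t)) *\<^sub>R vector [- (V1 t)$2, (V1 t)$1]"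
      using loc[OF t] by blast
    have "\<tau> = sg" using \<tau> sg same[OF t] by auto
    then show ?thesis using eq by simp
  qed
  have "strictly_convex_param X V1 V2 V3 I sg"
  proof
    fix s t assume t: "t \<in> I" and s: "s \<in> I"
    have "(X s - X t) \<bullet> unit_normal X I t = sg * cross2 (V1 t) (X s - X t) / norm (V1 t)"
      unfolding normal[OF t] by (simp add: inner2 cross2_def divide_inverse algebra_simps)
    then show "0 \<le> sg * cross2 (V1 t) (X s - X t)"
      using nrm(3)[OF t s] reg[OF t] by (simp add: zero_le_divide_iff)
  qed (use I sg der same inj normal in \<open>auto simp: c_def\<close>)
  then show ?thesis by (rule that)
qed

section \<open>The equivalence\<close>

theorem theorem1p2:
  fixes X :: "real \<Rightarrow> real^2" and I :: "real set"
  assumes "strictly_convex_curve X I"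
  shows
    "((\<exists>lam :: real^2 \<Rightarrow> real. \<forall>t\<in>I. \<exists>h0>0. \<forall>h. 0 < h \<and> h < h0 \<longrightarrow>
          S_area X I t h = lam (X t) * V_area X I t h)
      \<longleftrightarrow> (\<forall>t\<in>I. \<exists>h0>0. \<forall>h. 0 < h \<and> h < h0 \<longrightarrow> S_area X I t h = 2 / 3 * V_area X I t h))
     \<and> ((\<forall>t\<in>I. \<exists>h0>0. \<forall>h. 0 < h \<and> h < h0 \<longrightarrow> S_area X I t h = 2 / 3 * V_area X I t h)
      \<longleftrightarrow> open_part_of_parabola (X ` I))"
proof -
  obtain X1 X2 X3 sg where "strictly_convex_param X X1 X2 X3 I sg"
    by (rule strictly_convex_curve_imp_param[OF assms])
  then interpret strictly_convex_param X X1 X2 X3 I sg .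
  show ?thesis
    unfolding two_thirds_law_def[symmetric]
  proof (intro conjI iffI)
    assume "\<exists>lam :: real^2 \<Rightarrow> real. \<forall>t\<in>I. \<exists>h0>0. \<forall>h. 0 < h \<and> h < h0 \<longrightarrow>
      S_area X I t h = lam (X t) * V_area X I t h"
    then show two_thirds_law by (elim exE) (rule proportional_imp_law)
  next
    assume two_thirds_law
    then show "\<exists>lam :: real^2 \<Rightarrow> real. \<forall>t\<in>I. \<exists>h0>0. \<forall>h. 0 < h \<and> h < h0 \<longrightarrow>
      S_area X I t h = lam (X t) * V_area X I t h"
      unfolding two_thirds_law_def by (rule exI[of _ "\<lambda>_. 2 / 3"])
  next
    assume two_thirds_law
    then show "open_part_of_parabola (X ` I)" by (rule law_imp_parabola)
  next
    assume "open_part_of_parabola (X ` I)"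
    then show two_thirds_law by (rule parabola_imp_law)
  qed
qed

end
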